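(* Let $N\ge2$, $\omega>0$, $1<p<p_{\max}$, and let $u$ be a positive, radial, decreasing ground state of $-\Delta u-u\Delta|u|^2+\omega u-|u|^{p-1}u=0$ in $\mathbb{R}^N$. Let $\mathcal{L}_+$ be the operator $\mathcal{L}_+\eta=-\Delta\eta-2u\Delta(u\eta)+\omega\eta-(\Delta u^2+pu^{p-1})\eta$ on $L^2(\mathbb{R}^N)$ with domain $H^2(\mathbb{R}^N)$. Then $\sigma_{\mathrm{cont}}(\mathcal{L}_+)\subset[\omega,\infty)$.
   Context: $p_{\max}=\frac{3N+2}{N-2}$ if $N\ge3$ and $p_{\max}=\infty$ if $N=1,2$. All functions are complex valued unless stated. Define $\mathbb{X}_{\mathbb{C}}=\{u\in H^1(\mathbb{R}^N):\int_{\mathbb{R}^N}|u|^2|\nabla|u||^2\,dx<\infty\}$ and $$\mathcal{E}_\omega(u)=\frac12\int|\nabla u|^2dx+\int|u|^2|\nabla|u||^2dx+\frac{\omega}{2}\int|u|^2dx-\frac1{p+1}\int|u|^{p+1}dx .$$ A function $u\in\mathbb{X}_{\mathbb{C}}$ is a solution of $-\Delta u-u\Delta|u|^2+\omega u-|u|^{p-1}u=0$ if for all $\phi\in C_0^\infty(\mathbb{R}^N)$, $\mathrm{Re}\int(\nabla u\cdot\nabla\bar\phi+\nabla|u|^2\cdot\nabla(u\bar\phi)+\omega u\bar\phi-|u|^{p-1}u\bar\phi)dx=0$. A solution $u$ is a ground state if $\mathcal{E}_\omega(u)=\inf\{\mathcal{E}_\omega(v):v\in\mathbb{X}_{\mathbb{C}}\text{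 a nontrivial solution}\}$ (a ground state is itself nontrivial). It is known that ground states are $C^\infty$ and decay exponentially together with all derivatives. $\mathcal{L}_+$ is self-adjoint on $L^2(\mathbb{R}^N)$ with domain $H^2(\mathbb{R}^N)$. Its continuous (essential) spectrum $\sigma_{\mathrm{cont}}(\mathcal{L}_+)$ is the set of $\lambda$ for which there is a sequence $\phi_n\in H^2(\mathbb{R}^N)$ with $\|\phi_n\|_2=1$ for all $n$, $\phi_n\rightharpoonup0$ weakly in $L^2(\mathbb{R}^N)$, and $\|\mathcal{L}_+\phi_n-\lambda\phi_n\|_2\to0$. *)

theory Defs
  imports "HOL-Analysis.Analysis"
begin

text \<open>
  The space R^N is an arbitrary type of class \<open>euclidean_space\<close> with \<open>N = DIM('a)\<close>; partial derivatives
  are taken along its orthonormal \<open>Basis\<close>.  Elements of Lebesgue and Sobolev spaces are represented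
  by Borel functions; integrals and weak derivatives depend on these only up to equality almost
  everywhere.
\<close>

subsection \<open>Classical derivatives and test functions\<close>

definition partial :: "'a::euclidean_space \<Rightarrow> ('a \<Rightarrow> 'b::real_normed_vector) \<Rightarrow> 'a \<Rightarrow> 'b" where
  "partial b f = (\<lambda>x. frechet_derivative f (at x) b)"

definition laplacian :: "('a::euclidean_space \<Rightarrow> 'b::real_normed_vector) \<Rightarrow> 'a \<Rightarrow> 'b" where
  "laplacian f = (\<lambda>x. \<Sum>b\<in>Basis. partial b (partial b f) x)"

text \<open>Infinitely differentiable: all iterated partial derivatives exist and are differentiable.\<close>

definition smooth :: "('a::euclidean_space \<Rightarrow> 'b::real_normed_vector) \<Rightarrow> bool" where
  "smooth f \<longleftrightarrow> (\<forall>bs\<in>lists Basis. \<forall>x. (foldr partial bs f) differentiable (at x))"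

definition test_function :: "('a::euclidean_space \<Rightarrow> complex) \<Rightarrow> bool" where
  "test_function \<phi> \<longleftrightarrow> smooth \<phi> \<and> compact (closure {x. \<phi> x \<noteq> 0})"

subsection \<open>Lebesgue and Sobolev spaces of complex-valued functions\<close>

definition L2 :: "('a::euclidean_space \<Rightarrow> complex) set" where
  "L2 = {f \<in> borel_measurable lborel. integrable lborel (\<lambda>x. (cmod (f x))\<^sup>2)}"

definition norm_L2 :: "('a::euclidean_space \<Rightarrow> complex) \<Rightarrow> real" where
  "norm_L2 f = sqrt (LBINT x. (cmod (f x))\<^sup>2)"

definition locally_integrable :: "('a::euclidean_space \<Rightarrow> complex) \<Rightarrow> bool" where
  "locally_integrable f \<longleftrightarrow>
     f \<in> borel_measurable lborel \<and> (\<forall>K. compact K \<longrightarrow> set_integrable lborel K f)"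

definition is_weak_partial ::
    "'a::euclidean_space \<Rightarrow> ('a \<Rightarrow> complex) \<Rightarrow> ('a \<Rightarrow> complex) \<Rightarrow> bool" where
  "is_weak_partial b f g \<longleftrightarrow>
     locally_integrable f \<and> locally_integrable g \<and>
     (\<forall>\<psi>. test_function \<psi> \<longrightarrow> (LBINT x. f x * partial b \<psi> x) = - (LBINT x. g x * \<psi> x))"

text \<open>A weak derivative is unique up to a null set, so the choice of representative is immaterial.\<close>

definition weak_partial :: "'a::euclidean_space \<Rightarrow> ('a \<Rightarrow> complex) \<Rightarrow> 'a \<Rightarrow> complex" where
  "weak_partial b f = (SOME g. is_weak_partial b f g)"

definition weak_laplacian :: "('a::euclidean_space \<Rightarrow> complex) \<Rightarrow> 'a \<Rightarrow> complex" where
  "weak_laplacian f = (\<lambda>x. \<Sum>b\<in>Basis. weak_partial b (weak_partial b f) x)"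

definition grad_sq :: "('a::euclidean_space \<Rightarrow> complex) \<Rightarrow> 'a \<Rightarrow> real" where
  "grad_sq f = (\<lambda>x. \<Sum>b\<in>Basis. (cmod (weak_partial b f x))\<^sup>2)"

definition H1 :: "('a::euclidean_space \<Rightarrow> complex) set" where
  "H1 = {f \<in> L2. \<forall>b\<in>Basis. \<exists>g\<in>L2. is_weak_partial b f g}"

definition H2 :: "('a::euclidean_space \<Rightarrow> complex) set" where
  "H2 = {f \<in> L2. \<forall>b\<in>Basis. \<exists>g\<in>H1. is_weak_partial b f g}"

subsection \<open>The equation, its energy and its ground states\<close>

definition p_max :: "nat \<Rightarrow> ereal" where
  "p_max N = (if N \<ge> 3 then ereal ((3 * real N + 2) / (real N - 2)) else \<infinity>)"

definition X_C :: "('a::euclidean_space \<Rightarrow> complex) set" where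
  "X_C = {u \<in> H1. integrable lborel
            (\<lambda>x. (cmod (u x))\<^sup>2 * grad_sq (\<lambda>y. complex_of_real (cmod (u y))) x)}"

definition energy :: "real \<Rightarrow> real \<Rightarrow> ('a::euclidean_space \<Rightarrow> complex) \<Rightarrow> real" where
  "energy \<omega> p u =
     1 / 2 * (LBINT x. grad_sq u x)
     + (LBINT x. (cmod (u x))\<^sup>2 * grad_sq (\<lambda>y. complex_of_real (cmod (u y))) x)
     + \<omega> / 2 * (LBINT x. (cmod (u x))\<^sup>2)
     - 1 / (p + 1) * (LBINT x. cmod (u x) powr (p + 1))"

text \<open>The gradient products are bilinear; the conjugate falls on the test function only.\<close>

definition is_solution :: "real \<Rightarrow> real \<Rightarrow> ('a::euclidean_space \<Rightarrow> complex) \<Rightarrow> bool" where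
  "is_solution \<omega> p u \<longleftrightarrow> u \<in> X_C \<and>
     (\<forall>\<phi>. test_function \<phi> \<longrightarrow>
        Re (LBINT x.
              (\<Sum>b\<in>Basis. weak_partial b u x * partial b (\<lambda>y. cnj (\<phi> y)) x)
            + (\<Sum>b\<in>Basis. weak_partial b (\<lambda>y. complex_of_real ((cmod (u y))\<^sup>2)) x
                          * weak_partial b (\<lambda>y. u y * cnj (\<phi> y)) x)
            + complex_of_real \<omega> * u x * cnj (\<phi> x)
            - complex_of_real (cmod (u x) powr (p - 1)) * u x * cnj (\<phi> x)) = 0)"

definition nontrivial_solutions ::
    "real \<Rightarrow> real \<Rightarrow> ('a::euclidean_space \<Rightarrow> complex) set" where
  "nontrivial_solutions \<omega> p = {v. is_solution \<omega> p v \<and> \<not> (AE x in lborel. v x = 0)}"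

text \<open>The infimum is taken in the extended reals, so that it is meaningful without knowing in advance
  that the energy of solutions is bounded below.\<close>

definition ground_state :: "real \<Rightarrow> real \<Rightarrow> ('a::euclidean_space \<Rightarrow> complex) \<Rightarrow> bool" where
  "ground_state \<omega> p u \<longleftrightarrow> u \<in> nontrivial_solutions \<omega> p \<and>
     ereal (energy \<omega> p u) = (INF v\<in>(nontrivial_solutions \<omega> p :: ('a \<Rightarrow> complex) set). ereal (energy \<omega> p v))"

definition radial :: "('a::euclidean_space \<Rightarrow> real) \<Rightarrow> bool" where
  "radial u \<longleftrightarrow> (\<exists>f. \<forall>x. u x = f (norm x))"

text \<open>Decreasing is understood in the weak sense, as non-increasing.\<close>

definition radially_decreasing :: "('a::euclidean_space \<Rightarrow> real) \<Rightarrow> bool" where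
  "radially_decreasing u \<longleftrightarrow> (\<forall>x y. norm x \<le> norm y \<longrightarrow> u y \<le> u x)"

subsection \<open>The linearized operator and its continuous spectrum\<close>

text \<open>The profile \<open>u\<close> is the smooth representative of its class, whereas \<open>\<eta>\<close> is in H^2, so the derivatives of
  \<open>\<eta>\<close> and of \<open>u \<eta>\<close> are weak ones.\<close>

definition L_plus ::
    "real \<Rightarrow> real \<Rightarrow> ('a::euclidean_space \<Rightarrow> real) \<Rightarrow> ('a \<Rightarrow> complex) \<Rightarrow> 'a \<Rightarrow> complex" where
  "L_plus \<omega> p u \<eta> = (\<lambda>x.
     - weak_laplacian \<eta> x
     - 2 * complex_of_real (u x) * weak_laplacian (\<lambda>y. complex_of_real (u y) * \<eta> y) x
     + complex_of_real \<omega> * \<eta> x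
     - complex_of_real (laplacian (\<lambda>y. (u y)\<^sup>2) x + p * u x powr (p - 1)) * \<eta> x)"

definition weakly_null_L2 :: "(nat \<Rightarrow> 'a::euclidean_space \<Rightarrow> complex) \<Rightarrow> bool" where
  "weakly_null_L2 \<phi> \<longleftrightarrow> (\<forall>g\<in>L2. (\<lambda>n. LBINT x. \<phi> n x * cnj (g x)) \<longlonglongrightarrow> 0)"

text \<open>Continuous (essential) spectrum of an operator \<open>T\<close> on L^2 with domain \<open>D\<close>, by singular
  sequences.\<close>

definition cont_spectrum ::
    "('a::euclidean_space \<Rightarrow> complex) set \<Rightarrow> (('a \<Rightarrow> complex) \<Rightarrow> 'a \<Rightarrow> complex) \<Rightarrow> complex set" where
  "cont_spectrum D T = {z. \<exists>\<phi>::nat \<Rightarrow> 'a \<Rightarrow> complex.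
     (\<forall>n. \<phi> n \<in> D \<and> norm_L2 (\<phi> n) = 1) \<and>
     weakly_null_L2 \<phi> \<and>
     (\<lambda>n. norm_L2 (\<lambda>x. T (\<phi> n) x - z * \<phi> n x)) \<longlonglongrightarrow> 0}"

end

(*
  The quadratic form of L_+ controls the H^1 norm.  Expanding the derivatives of u eta gives the
  divergence form

    L_+ eta = - div ((1 + 2 u^2) grad eta) + (omega - W) eta,
    W = 2 u Lap u + Lap (u^2) + p u^(p-1),

  so <L_+ eta, eta> is real and bounded below by |grad eta|^2 + omega |eta|^2 - int W |eta|^2.  Along a
  singular sequence for z this form tends to z; hence the gradients are bounded, the sequence tends to 0
  in L^2 on compact sets (compare with its averages over small cubes), and if W vanishes at infinity
  then int W |eta|^2 tends to 0, which leaves z >= omega.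

  That W vanishes at infinity only uses that u is a positive, radially decreasing L^2 solution:
  u tends to 0, grad u tends to 0 by a convexity argument along a ray, and the equation then gives the
  same for Lap u.
*)
theory Submission
  imports Defs "HOL-Real_Asymp.Real_Asymp"
begin

subsection \<open>Smooth functions and smooth bumps\<close>

text \<open>Much of the analysis rests on one device, the finite increment along a coordinate
  direction: for almost every \<open>x\<close>, \<open>f (x + h *\<^sub>R b) - f x\<close> is the
  integral of the weak derivative over the segment. It yields integration by parts in L2, so that
  elements of \<open>H2\<close> can be paired with the operator directly, and it shows that
  functions with bounded gradients are uniformly close in L2 to their averages over a small cube.
  The divergence form is coercive because its coefficient \<open>1 + 2 u^2\<close> is at least 1; it
  arises because the cross term \<open>4 u grad u . grad eta\<close> of
  \<open>2 u Lap (u eta)\<close> is exactly the gradient of this coefficient paired with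
  \<open>grad eta\<close>. The obstacle in the decay of the profile is that \<open>u\<close> tending
  to 0 says nothing about \<open>grad u\<close>. A substitution that turns
  \<open>Lap u + u Lap (u^2)\<close> into a positive multiple of a Laplacian makes a weighted radial
  derivative monotone far out, and for a positive decreasing function such a derivative must tend to
  0. Weak derivatives are chosen representatives, so the two forms of the operator agree only almost
  everywhere.\<close>

primrec diffn :: "nat \<Rightarrow> ('a::euclidean_space \<Rightarrow> 'b::real_normed_vector) \<Rightarrow> bool" where
  "diffn 0 f \<longleftrightarrow> (\<forall>x. f differentiable (at x))"
| "diffn (Suc n) f \<longleftrightarrow> (\<forall>x. f differentiable (at x)) \<and> (\<forall>b\<in>Basis. diffn n (partial b f))"

lemma diffn_differentiable: "diffn n f \<Longrightarrow> f differentiable (at x)"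
  by (cases n) auto

lemma smooth_differentiable: "smooth f \<Longrightarrow> f differentiable (at x)"
  unfolding smooth_def by (drule bspec[of _ _ "[]"]) auto

lemma smooth_partial:
  fixes f :: "'a::euclidean_space \<Rightarrow> 'b::real_normed_vector"
  assumes "smooth f" and b: "b \<in> Basis"
  shows "smooth (partial b f)"
  unfolding smooth_def
proof (intro ballI allI)
  fix bs :: "'a list" and x assume "bs \<in> lists Basis"
  then have "bs @ [b] \<in> lists Basis" using b by auto
  then have "foldr partial (bs @ [b]) f differentiable at x" using assms(1) unfolding smooth_def by blast
  then show "foldr partial bs (partial b f) differentiable at x" by simp
qed

text \<open>In \<open>foldr partial bs f\<close> the last entry of \<open>bs\<close> is
  differentiated first. \<open>diffn\<close> recurses on this innermost derivative, so that closure
  under products and compositions becomes an induction on the order; lists are therefore taken apart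
  from the right.\<close>

lemma smooth_iff_diffn: "smooth f \<longleftrightarrow> (\<forall>n. diffn n f)"
proof
  assume "smooth f"
  show "\<forall>n. diffn n f"
  proof
    fix n show "diffn n f" using \<open>smooth f\<close>
    proof (induction n arbitrary: f)
      case 0 then show ?case by (simp add: smooth_differentiable)
    next
      case (Suc n) then show ?case by (simp add: smooth_differentiable smooth_partial)
    qed
  qed
next
  assume *: "\<forall>n. diffn n f"
  have "diffn (length bs) f \<Longrightarrow> bs \<in> lists Basis \<Longrightarrow> diffn 0 (foldr partial bs f)" for bs
  proof (induction bs arbitrary: f rule: rev_induct)
    case (snoc b bs) then show ?case by simp
  qed simp
  with * show "smooth f" unfolding smooth_def by auto
qed

lemma diffn_Suc: "diffn (Suc n) f \<Longrightarrow> diffn n f"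
proof (induction n arbitrary: f)
  case (Suc n)
  have "diffn n (partial b f)" if "b \<in> Basis" for b using Suc.IH Suc.prems that by auto
  then show ?case using Suc.prems by auto
qed auto

lemma partial_eq: "(f has_derivative f') (at x) \<Longrightarrow> partial b f x = f' b"
  by (simp add: partial_def frechet_derivative_at[symmetric])

lemma partial_has_derivative:
  "f differentiable (at x) \<Longrightarrow> (f has_derivative (\<lambda>h. partial h f x)) (at x)"
  unfolding partial_def by (metis eta_contract_eq frechet_derivative_works)

lemma partial_add: "f differentiable (at x) \<Longrightarrow> g differentiable (at x) \<Longrightarrow>
    partial b (\<lambda>x. f x + g x) x = partial b f x + partial b g x"
  by (rule partial_eq) (auto intro!: derivative_eq_intros partial_has_derivative)

lemma partial_mult:
  fixes f g :: "'a::euclidean_space \<Rightarrow> 'b::real_normed_algebra"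
  shows "f differentiable (at x) \<Longrightarrow> g differentiable (at x) \<Longrightarrow>
    partial b (\<lambda>x. f x * g x) x = partial b f x * g x + f x * partial b g x"
  by (rule partial_eq[THEN trans, OF has_derivative_mult[OF partial_has_derivative partial_has_derivative]])
     (auto simp: add.commute)

lemma partial_bounded_linear:
  "bounded_linear L \<Longrightarrow> f differentiable (at x) \<Longrightarrow> partial b (\<lambda>x. L (f x)) x = L (partial b f x)"
  by (rule partial_eq[OF bounded_linear.has_derivative[OF _ partial_has_derivative]])

lemma diffn_add: "diffn n f \<Longrightarrow> diffn n g \<Longrightarrow> diffn n (\<lambda>x. f x + g x)"
proof (induction n arbitrary: f g)
  case (Suc n)
  have "partial b (\<lambda>x. f x + g x) = (\<lambda>x. partial b f x + partial b g x)" for b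
    by (intro ext partial_add diffn_differentiable[OF Suc.prems(1)] diffn_differentiable[OF Suc.prems(2)])
  with Suc show ?case by (auto intro!: differentiable_add)
qed auto

lemma differentiable_bounded_linear:
  "bounded_linear L \<Longrightarrow> f differentiable (at x) \<Longrightarrow> (\<lambda>x. L (f x)) differentiable (at x)"
  unfolding differentiable_def by (blast intro: bounded_linear.has_derivative)

lemma diffn_bounded_linear: "bounded_linear L \<Longrightarrow> diffn n f \<Longrightarrow> diffn n (\<lambda>x. L (f x))"
proof (induction n arbitrary: f)
  case 0
  have "(\<lambda>x. L (f x)) differentiable (at x)" for x
    by (rule differentiable_bounded_linear[OF 0(1) diffn_differentiable[OF 0(2)]])
  then show ?case by simp
next
  case (Suc n)
  have "partial b (\<lambda>x. L (f x)) = (\<lambda>x. L (partial b f x))" for b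
    by (intro ext partial_bounded_linear Suc.prems(1) diffn_differentiable[OF Suc.prems(2)])
  moreover have "(\<lambda>x. L (f x)) differentiable (at x)" for x
    by (rule differentiable_bounded_linear[OF Suc.prems(1) diffn_differentiable[OF Suc.prems(2)]])
  ultimately show ?case using Suc by simp
qed

lemma diffn_mult:
  fixes f g :: "'a::euclidean_space \<Rightarrow> 'b::real_normed_algebra"
  shows "diffn n f \<Longrightarrow> diffn n g \<Longrightarrow> diffn n (\<lambda>x. f x * g x)"
proof (induction n arbitrary: f g)
  case 0 then show ?case by (auto intro!: differentiable_mult)
next
  case (Suc n)
  have "partial b (\<lambda>x. f x * g x) = (\<lambda>x. partial b f x * g x + f x * partial b g x)" for b
    by (intro ext partial_mult diffn_differentiable[OF Suc.prems(1)] diffn_differentiable[OF Suc.prems(2)])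
  moreover have "diffn n f" "diffn n g" using Suc.prems diffn_Suc by auto
  ultimately show ?case using Suc by (auto intro!: differentiable_mult diffn_add)
qed

text \<open>The candidates for a derivative of the translate at \<open>x\<close> and of
  \<open>f\<close> at \<open>x + c\<close> are the same linear maps, so the choice inside
  \<open>frechet_derivative\<close> returns the same map for both, differentiable or not.\<close>

lemma partial_translate: "partial b (\<lambda>x. f (x + c)) x = partial b f (x + c)"
proof -
  have "((\<lambda>x. f (x + c)) has_derivative D) (at x) \<longleftrightarrow> (f has_derivative D) (at (x + c))" for D
  proof
    assume "((\<lambda>x. f (x + c)) has_derivative D) (at x)"
    then have *: "((\<lambda>x. f (x + c)) has_derivative D) (at ((x + c) - c))" by simp
    have "((\<lambda>y. (\<lambda>x. f (x + c)) (y - c)) has_derivative (\<lambda>h. D h)) (at (x + c))"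
      by (rule has_derivative_compose[where f="\<lambda>y. y - c", OF _ *]) (auto intro!: derivative_eq_intros)
    then show "(f has_derivative D) (at (x + c))" by simp
  next
    assume *: "(f has_derivative D) (at (x + c))"
    show "((\<lambda>x. f (x + c)) has_derivative D) (at x)"
      by (rule has_derivative_compose[where f="\<lambda>x. x + c", OF _ *]) (auto intro!: derivative_eq_intros)
  qed
  then show ?thesis by (simp add: partial_def frechet_derivative_def)
qed

lemma differentiable_translate:
  "f differentiable (at (x + c)) \<Longrightarrow> (\<lambda>x. f (x + c)) differentiable (at x)"
  by (rule differentiable_compose[of f]) simp_all

lemma diffn_translate: "diffn n f \<Longrightarrow> diffn n (\<lambda>x. f (x + c))"
proof (induction n arbitrary: f)
  case (Suc n)
  have "(\<lambda>x. f (x + c)) differentiable (at x)" for x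
    by (rule differentiable_translate) (rule diffn_differentiable[OF Suc.prems])
  moreover have "partial b (\<lambda>x. f (x + c)) = (\<lambda>x. partial b f (x + c))" for b
    by (intro ext partial_translate)
  ultimately show ?case using Suc by simp
next
  case 0
  have "(\<lambda>x. f (x + c)) differentiable (at x)" for x
    by (rule differentiable_translate) (rule diffn_differentiable[OF 0])
  then show ?case by simp
qed

lemma smooth_const: "smooth (\<lambda>x. c)"
proof -
  have "diffn n (\<lambda>x::'a. c::'b)" for n c
    by (induction n arbitrary: c) (simp_all add: partial_def)
  then show ?thesis by (simp add: smooth_iff_diffn)
qed

lemma smooth_inner: "smooth (\<lambda>x. x \<bullet> c)"
proof -
  have "partial b (\<lambda>x. x \<bullet> c) = (\<lambda>x. b \<bullet> c)" for b
    by (rule ext, rule partial_eq) (auto intro!: derivative_eq_intros)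
  then have "diffn n (\<lambda>x. x \<bullet> c)" for n
    using smooth_const by (cases n) (auto simp: smooth_iff_diffn)
  then show ?thesis by (simp add: smooth_iff_diffn)
qed

lemma smooth_add: "smooth f \<Longrightarrow> smooth g \<Longrightarrow> smooth (\<lambda>x. f x + g x)"
  by (simp add: smooth_iff_diffn diffn_add)

lemma smooth_mult:
  fixes f g :: "'a::euclidean_space \<Rightarrow> 'b::real_normed_algebra"
  shows "smooth f \<Longrightarrow> smooth g \<Longrightarrow> smooth (\<lambda>x. f x * g x)"
  by (simp add: smooth_iff_diffn diffn_mult)

lemma smooth_bounded_linear: "bounded_linear L \<Longrightarrow> smooth f \<Longrightarrow> smooth (\<lambda>x. L (f x))"
  unfolding smooth_iff_diffn by (rule allI, rule diffn_bounded_linear, assumption, erule spec)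

lemma smooth_translate: "smooth f \<Longrightarrow> smooth (\<lambda>x. f (x + c))"
  unfolding smooth_iff_diffn by (rule allI, rule diffn_translate, erule spec)

lemma smooth_diff: "smooth f \<Longrightarrow> smooth g \<Longrightarrow> smooth (\<lambda>x. f x - g x)"
  using smooth_add[of f "\<lambda>x. - g x"] smooth_bounded_linear[of "\<lambda>x. - x" g]
  by (simp add: bounded_linear_minus bounded_linear_ident)

lemma smooth_prod:
  fixes f :: "'i \<Rightarrow> 'a::euclidean_space \<Rightarrow> 'b::{real_normed_algebra_1, comm_monoid_mult}"
  shows "(\<And>i. i \<in> I \<Longrightarrow> smooth (f i)) \<Longrightarrow> smooth (\<lambda>x. \<Prod>i\<in>I. f i x)"
  by (induction I rule: infinite_finite_induct) (simp_all add: smooth_const smooth_mult)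

lemma smooth_of_real: "smooth f \<Longrightarrow> smooth (\<lambda>x. complex_of_real (f x))"
  by (rule smooth_bounded_linear[OF bounded_linear_of_real])

lemma smooth_continuous: "smooth f \<Longrightarrow> continuous_on S f"
  by (intro continuous_at_imp_continuous_on ballI differentiable_imp_continuous_within smooth_differentiable)

text \<open>The family is closed under differentiation up to linear combinations, which is what makes
  \<open>bump_fun 0\<close>, the function \<open>exp (- 1 / t)\<close> cut off at 0, smooth.\<close>

definition bump_fun :: "nat \<Rightarrow> real \<Rightarrow> real" where
  "bump_fun m t = (if t > 0 then inverse t ^ m * exp (- inverse t) else 0)"

text \<open>For \<open>t > 0\<close> this is the product rule. At 0 the right difference quotient
  tends to 0 because the exponential beats every power of \<open>inverse t\<close>, the left one is
  identically 0, and the stated formula gives 0 there too.\<close>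

lemma bump_fun_deriv:
  "(bump_fun m has_real_derivative (- real m * bump_fun (m + 1) t + bump_fun (m + 2) t)) (at t)"
proof (cases t "0::real" rule: linorder_cases)
  case less
  have "((\<lambda>t. 0) has_real_derivative 0) (at t)" by simp
  then have "(bump_fun m has_real_derivative 0) (at t)"
    by (rule has_field_derivative_transform_within_open[where S="{..<0}"])
       (use less in \<open>auto simp: bump_fun_def\<close>)
  then show ?thesis using less by (simp add: bump_fun_def)
next
  case equal
  have "((\<lambda>h. bump_fun m h / h) \<longlongrightarrow> 0) (at_right 0)"
  proof (rule Lim_transform_eventually)
    show "((\<lambda>h::real. inverse h ^ m * exp (- inverse h) / h) \<longlongrightarrow> 0) (at_right 0)"
      by real_asymp
    show "\<forall>\<^sub>F h in at_right 0. inverse h ^ m * exp (- inverse h) / h = bump_fun m h / h"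
      by (auto simp: eventually_at_filter bump_fun_def)
  qed
  moreover have "((\<lambda>h. bump_fun m h / h) \<longlongrightarrow> 0) (at_left 0)"
  proof (rule Lim_transform_eventually)
    show "((\<lambda>h::real. 0::real) \<longlongrightarrow> 0) (at_left 0)" by simp
    show "\<forall>\<^sub>F h in at_left 0. 0 = bump_fun m h / h"
      by (auto simp: eventually_at_filter bump_fun_def)
  qed
  ultimately have "((\<lambda>h. bump_fun m h / h) \<longlongrightarrow> 0) (at 0)"
    by (simp add: filterlim_at_split)
  then show ?thesis using equal by (simp add: DERIV_def bump_fun_def)
next
  case greater
  have inv: "(inverse has_real_derivative - (inverse t ^ 2)) (at t)"
    using DERIV_inverse[of t UNIV] greater by (simp add: numeral_2_eq_2)
  have "((\<lambda>t. inverse t ^ m) has_real_derivative - real m * inverse t ^ (m + 1)) (at t)"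
    using DERIV_power[OF inv, of m] by (cases m) (simp_all add: power2_eq_square algebra_simps)
  from DERIV_mult[OF this DERIV_chain'[OF DERIV_minus[OF inv] DERIV_exp]]
  have "((\<lambda>t. inverse t ^ m * exp (- inverse t)) has_real_derivative
      (- real m * bump_fun (m + 1) t + bump_fun (m + 2) t)) (at t)"
    using greater by (simp add: bump_fun_def power2_eq_square mult_ac)
  then show ?thesis
    by (rule has_field_derivative_transform_within_open[where S="{0<..}"])
       (use greater in \<open>auto simp: bump_fun_def\<close>)
qed

text \<open>The chain rule produces the indices \<open>m + 1\<close> and \<open>m + 2\<close>
  together with a derivative of \<open>q\<close>, so the induction on the order runs over all
  \<open>m\<close> at once.\<close>

lemma diffn_bump_fun: "smooth q \<Longrightarrow> diffn n (\<lambda>x. bump_fun m (q x))"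
proof (induction n arbitrary: m)
  have der: "((\<lambda>x. bump_fun m (q x)) has_derivative
      (\<lambda>h. partial h q x * (- real m * bump_fun (m + 1) (q x) + bump_fun (m + 2) (q x)))) (at x)"
    if "smooth q" for m x
    using has_derivative_compose[OF partial_has_derivative[OF smooth_differentiable[OF that]]
        bump_fun_deriv[where m=m, unfolded has_field_derivative_def]]
    by (simp add: mult.commute)
  {
    case 0
    with der[where m=m] show ?case by (auto simp: differentiable_def)
  next
    case (Suc n)
    have "partial b (\<lambda>x. bump_fun m (q x)) =
      (\<lambda>x. partial b q x * (- real m * bump_fun (m + 1) (q x) + bump_fun (m + 2) (q x)))" for b
      by (rule ext, rule partial_eq) (rule der[OF Suc.prems])
    moreover have "diffn n (\<lambda>x. partial b q x * (- real m * bump_fun (m + 1) (q x) + bump_fun (m + 2) (q x)))"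
      if "b \<in> Basis" for b
      using Suc smooth_partial[OF Suc.prems that]
      by (intro diffn_mult diffn_add) (use smooth_const[of "- real m"] in \<open>auto simp: smooth_iff_diffn\<close>)
    ultimately show ?case using der[OF Suc.prems, where m=m] by (auto simp: differentiable_def)
  }
qed

lemma smooth_bump_fun: "smooth q \<Longrightarrow> smooth (\<lambda>x. bump_fun m (q x))"
  by (simp add: smooth_iff_diffn diffn_bump_fun)

section \<open>Smooth approximation of indicators of boxes\<close>

definition box_bump :: "nat \<Rightarrow> 'a::euclidean_space \<Rightarrow> 'a \<Rightarrow> 'a \<Rightarrow> real" where
  "box_bump k l r x = (\<Prod>b\<in>Basis. bump_fun 0 (real k * ((x \<bullet> b - l \<bullet> b) * (r \<bullet> b - x \<bullet> b))))"

lemma smooth_box_bump: "smooth (box_bump k l r)"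
  unfolding box_bump_def[abs_def]
  by (intro smooth_prod smooth_bump_fun smooth_mult smooth_diff smooth_const smooth_inner)

lemma bump_fun_bounds: "0 \<le> bump_fun 0 t" "bump_fun 0 t \<le> 1"
  by (auto simp: bump_fun_def)

lemma box_bump_bounds: "0 \<le> box_bump k l r x" "box_bump k l r x \<le> 1"
  by (auto simp: box_bump_def bump_fun_bounds intro!: prod_nonneg prod_le_1)

text \<open>The product of the signed distances to two opposite faces is positive only between the
  faces. Ordered corners matter: if \<open>r \<bullet> b < x \<bullet> b\<close> and
  \<open>x \<bullet> b < l \<bullet> b\<close>, both factors are negative and the product is
  positive.\<close>

lemma box_bump_eq_0:
  assumes "\<forall>b\<in>Basis. l \<bullet> b \<le> r \<bullet> b" "x \<notin> box l r"
  shows "box_bump k l r x = 0"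
proof -
  obtain b where b: "b \<in> Basis" "\<not> (l \<bullet> b < x \<bullet> b \<and> x \<bullet> b < r \<bullet> b)"
    using assms by (auto simp: mem_box)
  then have "(x \<bullet> b - l \<bullet> b) * (r \<bullet> b - x \<bullet> b) \<le> 0"
    using assms(1) by (metis diff_ge_0_iff_ge diff_le_0_iff_le linorder_not_less mult_nonneg_nonpos mult_nonpos_nonneg order_trans less_imp_le)
  then have "real k * ((x \<bullet> b - l \<bullet> b) * (r \<bullet> b - x \<bullet> b)) \<le> 0" by (simp add: mult_le_0_iff)
  then have "bump_fun 0 (real k * ((x \<bullet> b - l \<bullet> b) * (r \<bullet> b - x \<bullet> b))) = 0" by (simp add: bump_fun_def)
  then show ?thesis unfolding box_bump_def using b by (intro prod_zero) auto
qed

text \<open>Scaling by \<open>k\<close> leaves the support alone and drives each factor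
  \<open>exp (- inverse (k * c))\<close> up to 1 for fixed \<open>c > 0\<close>.\<close>

lemma box_bump_LIMSEQ:
  assumes "\<forall>b\<in>Basis. l \<bullet> b \<le> r \<bullet> b"
  shows "(\<lambda>k. box_bump k l r x) \<longlonglongrightarrow> indicator (box l r) x"
proof (cases "x \<in> box l r")
  case False then show ?thesis using box_bump_eq_0[OF assms] by simp
next
  case True
  have "(\<lambda>k. box_bump k l r x) \<longlonglongrightarrow> (\<Prod>b\<in>(Basis::'a set). 1)"
    unfolding box_bump_def
  proof (intro tendsto_prod)
    fix b :: 'a assume b: "b \<in> Basis"
    define c where "c = (x \<bullet> b - l \<bullet> b) * (r \<bullet> b - x \<bullet> b)"
    have c: "c > 0" using True b by (auto simp: c_def mem_box)
    have "(\<lambda>k. exp (- inverse (real k * c))) \<longlonglongrightarrow> 1" using c by real_asymp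
    then have "(\<lambda>k. bump_fun 0 (real k * c)) \<longlonglongrightarrow> 1"
      by (rule Lim_transform_eventually)
         (use c in \<open>auto simp: bump_fun_def eventually_at_top_linorder intro!: exI[of _ 1]\<close>)
    then show "(\<lambda>k. bump_fun 0 (real k * ((x \<bullet> b - l \<bullet> b) * (r \<bullet> b - x \<bullet> b)))) \<longlonglongrightarrow> 1"
      by (simp add: c_def)
  qed
  then show ?thesis using True by simp
qed

lemma test_function_box_bump:
  assumes "\<forall>b\<in>Basis. l \<bullet> b \<le> r \<bullet> b"
  shows "test_function (\<lambda>x. complex_of_real (box_bump k l r x))"
proof -
  have "{x. complex_of_real (box_bump k l r x) \<noteq> 0} \<subseteq> box l r"
    using box_bump_eq_0[OF assms] by auto
  then have "bounded {x. complex_of_real (box_bump k l r x) \<noteq> 0}"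
    using bounded_box bounded_subset by blast
  then show ?thesis
    by (auto simp: test_function_def smooth_of_real smooth_box_bump compact_closure)
qed

subsection \<open>The fundamental lemma of the calculus of variations\<close>

lemma shift_nn_integral:
  fixes f :: "'a::euclidean_space \<Rightarrow> ennreal"
  assumes [measurable]: "f \<in> borel_measurable borel"
  shows "(\<integral>\<^sup>+x. f (x + c) \<partial>lborel) = (\<integral>\<^sup>+x. f x \<partial>lborel)"
proof -
  have "(\<integral>\<^sup>+x. f x \<partial>distr lborel borel ((+) c)) = (\<integral>\<^sup>+x. f (c + x) \<partial>lborel)"
    by (rule nn_integral_distr) auto
  then show ?thesis by (simp add: lborel_distr_plus add.commute)
qed

lemma shift_integral:
  fixes f :: "'a::euclidean_space \<Rightarrow> 'b::{banach, second_countable_topology}"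
  assumes [measurable]: "f \<in> borel_measurable borel"
  shows "(LBINT x. f (x + c)) = (LBINT x. f x)"
proof -
  have "(\<integral>x. f x \<partial>distr lborel borel ((+) c)) = (\<integral>x. f (c + x) \<partial>lborel)"
    by (rule integral_distr) auto
  then show ?thesis by (simp add: lborel_distr_plus add.commute)
qed

lemma shift_integrable:
  fixes f :: "'a::euclidean_space \<Rightarrow> 'b::{banach, second_countable_topology}"
  assumes "integrable lborel f"
  shows "integrable lborel (\<lambda>x. f (x + c))"
proof -
  have [measurable]: "f \<in> borel_measurable borel" using borel_measurable_integrable[OF assms] by simp
  have "integrable (distr lborel borel ((+) c)) f = integrable lborel (\<lambda>x. f (c + x))"
    by (rule integrable_distr_eq) auto
  then show ?thesis using assms by (simp add: lborel_distr_plus add.commute)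
qed

section \<open>Compactly supported functions and test functions\<close>

definition cc_fun :: "('a::euclidean_space \<Rightarrow> complex) \<Rightarrow> bool" where
  "cc_fun k \<longleftrightarrow> continuous_on UNIV k \<and> (\<exists>R. \<forall>x. R < norm x \<longrightarrow> k x = 0)"

lemma cc_fun_bounded: "cc_fun k \<Longrightarrow> \<exists>M. \<forall>x. cmod (k x) \<le> M"
proof -
  assume "cc_fun k"
  then obtain R where k: "continuous_on UNIV k" and R: "\<And>x. R < norm x \<Longrightarrow> k x = 0"
    by (auto simp: cc_fun_def)
  have "compact (k ` cball 0 R)"
    using k by (intro compact_continuous_image) (auto intro: continuous_on_subset)
  then obtain M where "\<And>x. x \<in> cball 0 R \<Longrightarrow> cmod (k x) \<le> M"
    by (force simp: bounded_iff dest!: compact_imp_bounded)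
  then have "cmod (k x) \<le> max M 0" for x
    by (cases "R < norm x") (use R in \<open>auto simp: le_max_iff_disj\<close>)
  then show ?thesis by blast
qed

lemma cc_fun_measurable: "cc_fun k \<Longrightarrow> k \<in> borel_measurable borel"
  by (auto simp: cc_fun_def intro: borel_measurable_continuous_onI)

lemma continuous_locally_integrable:
  "continuous_on UNIV f \<Longrightarrow> locally_integrable f"
  unfolding locally_integrable_def set_integrable_def
  by (auto intro: borel_measurable_continuous_onI borel_integrable_compact continuous_on_subset)

lemma locint_cc_integrable:
  assumes f: "locally_integrable f" and k: "cc_fun k"
  shows "integrable lborel (\<lambda>x. f x * k x)"
proof -
  obtain R where R: "\<And>x. R < norm x \<Longrightarrow> k x = 0" using k by (auto simp: cc_fun_def)
  obtain M where M: "\<And>x. cmod (k x) \<le> M" using cc_fun_bounded[OF k] by auto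
  have [measurable]: "k \<in> borel_measurable borel" "f \<in> borel_measurable borel"
    using k f by (auto simp: cc_fun_measurable locally_integrable_def)
  have "set_integrable lborel (cball 0 R) f"
    using f by (auto simp: locally_integrable_def)
  then have i: "integrable lborel (\<lambda>x. M *\<^sub>R (indicator (cball 0 R) x *\<^sub>R f x))"
    unfolding set_integrable_def by (rule integrable_scaleR_right)
  show ?thesis
  proof (rule Bochner_Integration.integrable_bound[OF i])
    show "AE x in lborel. norm (f x * k x) \<le> norm (M *\<^sub>R (indicat_real (cball 0 R) x *\<^sub>R f x))"
    proof (intro AE_I2)
      fix x
      have "0 \<le> M" using M norm_ge_zero order_trans by blast
      then show "norm (f x * k x) \<le> norm (M *\<^sub>R (indicat_real (cball 0 R) x *\<^sub>R f x))"
        using R[of x] M[of x]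
        by (cases "R < norm x") (auto simp: norm_mult indicator_def mult.commute[of M] intro: mult_left_mono)
    qed
  qed measurable
qed

lemma smooth_support_partial:
  assumes "\<And>x. R < norm x \<Longrightarrow> f x = 0" "R < norm x"
  shows "partial b f x = 0"
proof (rule partial_eq)
  have "open {x. R < norm x}" by (rule open_Collect_less) (auto intro: continuous_intros)
  moreover have "((\<lambda>x. 0) has_derivative (\<lambda>h. 0)) (at x)" by simp
  ultimately show "(f has_derivative (\<lambda>h. 0)) (at x)"
    using has_derivative_transform_within_open[of "\<lambda>x. 0" "\<lambda>h. 0" x UNIV "{x. R < norm x}" f] assms by auto
qed

lemma test_functionI:
  assumes "smooth \<psi>" "\<And>x. R < norm x \<Longrightarrow> \<psi> x = 0"
  shows "test_function \<psi>"
proof -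
  have "{x. \<psi> x \<noteq> 0} \<subseteq> cball 0 R" using assms(2) by force
  then have "bounded {x. \<psi> x \<noteq> 0}" using bounded_cball bounded_subset by blast
  then show ?thesis using assms(1) by (auto simp: test_function_def compact_closure)
qed

lemma test_functionE:
  assumes "test_function \<psi>"
  obtains R where "smooth \<psi>" "\<And>x. R < norm x \<Longrightarrow> \<psi> x = 0"
proof -
  have "bounded {x. \<psi> x \<noteq> 0}" using assms by (auto simp: test_function_def compact_closure)
  then obtain R where "\<And>x. \<psi> x \<noteq> 0 \<Longrightarrow> norm x \<le> R" by (auto simp: bounded_iff)
  then have "R < norm x \<Longrightarrow> \<psi> x = 0" for x by force
  then show ?thesis using that assms by (auto simp: test_function_def)
qed

lemma test_function_cc: "test_function \<psi> \<Longrightarrow> cc_fun \<psi>"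
  by (elim test_functionE) (auto simp: cc_fun_def smooth_continuous)

lemma test_function_partial: "test_function \<psi> \<Longrightarrow> b \<in> Basis \<Longrightarrow> test_function (partial b \<psi>)"
  by (elim test_functionE, rule test_functionI, erule (1) smooth_partial, rule smooth_support_partial) auto

lemma test_function_mult: "smooth f \<Longrightarrow> test_function \<psi> \<Longrightarrow> test_function (\<lambda>x. f x * \<psi> x)"
  by (elim test_functionE, rule test_functionI) (auto simp: smooth_mult)

lemma test_function_cnj: "test_function \<psi> \<Longrightarrow> test_function (\<lambda>x. cnj (\<psi> x))"
  by (elim test_functionE, rule test_functionI, rule smooth_bounded_linear[OF bounded_linear_cnj]) auto

lemma test_function_translate: "test_function \<psi> \<Longrightarrow> test_function (\<lambda>x. \<psi> (x + c))"
proof (elim test_functionE)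
  fix R assume *: "smooth \<psi>" "\<And>x. R < norm x \<Longrightarrow> \<psi> x = 0"
  show ?thesis
  proof (rule test_functionI[where R="R + norm c"])
    show "smooth (\<lambda>x. \<psi> (x + c))" by (rule smooth_translate[OF *(1)])
    fix x :: 'a assume "R + norm c < norm x"
    then have "R < norm (x + c)" using norm_diff_ineq[of x c] by linarith
    then show "\<psi> (x + c) = 0" by (rule *(2))
  qed
qed

text \<open>Box bumps converge to the indicator of the box and are dominated by that of the closed
  box, so \<open>f\<close> has integral 0 over every box. Boxes are stable under intersection and
  generate the Borel sets; hence the integral vanishes over every Borel set, which forces the
  density to be 0 almost everywhere.\<close>

lemma locint_AE_zero:
  fixes f :: "'a::euclidean_space \<Rightarrow> complex"
  assumes f: "locally_integrable f"
    and z: "\<And>\<psi>. test_function \<psi> \<Longrightarrow> (LBINT x. f x * \<psi> x) = 0"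
  shows "AE x in lborel. f x = 0"
proof -
  have [measurable]: "f \<in> borel_measurable borel" using f by (simp add: locally_integrable_def)
  have box0: "(LINT x:box l r|lborel. f x) = 0" for l r
  proof (cases "\<forall>b\<in>Basis. l \<bullet> b \<le> r \<bullet> b")
    case False
    then have "box l r = {}" by (force simp: box_eq_empty not_le intro: less_imp_le)
    then show ?thesis by (simp add: set_lebesgue_integral_def)
  next
    case True
    have "(\<lambda>k. LBINT x. f x * complex_of_real (box_bump k l r x))
        \<longlonglongrightarrow> (LBINT x. f x * complex_of_real (indicator (box l r) x))"
    proof (rule integral_dominated_convergence)
      have "set_integrable lborel (cbox l r) f"
        using f compact_cbox by (auto simp: locally_integrable_def)
      then show "integrable lborel (\<lambda>x. norm (indicator (cbox l r) x *\<^sub>R f x))"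
        unfolding set_integrable_def by (rule integrable_norm)
      show "AE x in lborel. (\<lambda>k. f x * complex_of_real (box_bump k l r x))
          \<longlonglongrightarrow> f x * complex_of_real (indicat_real (box l r) x)"
        using box_bump_LIMSEQ[OF True] by (intro AE_I2 tendsto_intros)
      show "(\<lambda>x. f x * complex_of_real (box_bump k l r x)) \<in> borel_measurable lborel" for k
        using borel_measurable_continuous_onI[OF smooth_continuous[OF smooth_box_bump[of k l r]]]
        by measurable
      show "AE x in lborel. norm (f x * complex_of_real (box_bump k l r x))
          \<le> norm (indicat_real (cbox l r) x *\<^sub>R f x)" for k
      proof (intro AE_I2)
        fix x show "norm (f x * complex_of_real (box_bump k l r x)) \<le> norm (indicat_real (cbox l r) x *\<^sub>R f x)"
          using box_bump_eq_0[OF True, of x k] box_bump_bounds[of k l r x] box_subset_cbox[of l r]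
          by (cases "x \<in> box l r") (auto simp: norm_mult indicator_def mult_left_le)
      qed
    qed measurable
    then have "(LBINT x. f x * complex_of_real (indicator (box l r) x)) = 0"
      using z[OF test_function_box_bump[OF True]] by (simp add: LIMSEQ_const_iff)
    then show ?thesis
      by (simp add: set_lebesgue_integral_def scaleR_conv_of_real mult.commute)
  qed
  have "AE x in lborel. indicator (box (- real n *\<^sub>R One) (real n *\<^sub>R One)) x *\<^sub>R f x = 0" for n
  proof -
    \<comment> \<open>Truncation to a fixed box makes the function integrable on the whole space;
      the complement step of the set induction subtracts from its total integral, which is
      0.\<close>
    define B where "B = box (- real n *\<^sub>R One) (real n *\<^sub>R One :: 'a)"
    define F where "F x = indicat_real B x *\<^sub>R f x" for x
    have "set_integrable lborel (cbox (- real n *\<^sub>R One) (real n *\<^sub>R One :: 'a)) f"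
      using f compact_cbox by (auto simp: locally_integrable_def)
    then have "set_integrable lborel B f"
      by (rule set_integrable_subset) (auto simp: B_def box_subset_cbox[THEN subsetD])
    then have F: "integrable lborel F" by (simp add: set_integrable_def F_def[abs_def])
    have total: "(LBINT x. F x) = 0"
      using box0 by (simp add: F_def B_def set_lebesgue_integral_def)
    have "(LINT x:A|lborel. F x) = 0" if "A \<in> sets borel" for A
    proof -
      have "Int_stable (range (\<lambda>(a, b). box a b :: 'a set))"
        by (auto simp: Int_stable_def box_Int_box)
      moreover have "range (\<lambda>(a, b). box a b :: 'a set) \<subseteq> Pow UNIV" by simp
      moreover have "A \<in> sigma_sets UNIV (range (\<lambda>(a, b). box a b :: 'a set))"
        using that by (subst (asm) borel_eq_box) simp
      ultimately show ?thesis
      proof (induction rule: sigma_sets_induct_disjoint)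
        case (basic A)
        then obtain a b where A: "A = box a b" by auto
        obtain c d where cd: "box a b \<inter> B = box c d" unfolding B_def box_Int_box by blast
        have "(LINT x:A|lborel. F x) = (LINT x:box a b \<inter> B|lborel. f x)"
          by (simp add: A F_def set_lebesgue_integral_def indicator_inter_arith)
        then show ?case using cd box0 by simp
      next
        case empty show ?case by (simp add: set_lebesgue_integral_def)
      next
        case (compl A)
        have A: "A \<in> sets borel" using compl by (subst borel_eq_box) simp
        have "(LBINT x. F x) = (LINT x:A \<union> (UNIV - A)|lborel. F x)" by (simp add: set_lebesgue_integral_def)
        also have "\<dots> = (LINT x:A|lborel. F x) + (LINT x:UNIV - A|lborel. F x)"
          using F A by (intro set_integral_Un) (auto simp: set_integrable_def integrable_mult_indicator)
        finally show ?case using compl total by simp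
      next
        case (union A)
        have A: "A i \<in> sets lborel" for i using union by (subst sets_lborel, subst borel_eq_box) auto
        have "(LINT x:(\<Union>i. A i)|lborel. F x) = (\<Sum>i. (LINT x:(A i)|lborel. F x))"
          using union A F
          by (intro lebesgue_integral_countable_add)
             (auto simp: set_integrable_def disjoint_family_on_def intro!: integrable_mult_indicator)
        then show ?case using union by (simp add: set_lebesgue_integral_def)
      qed
    qed
    then have "AE x in lborel. F x = 0"
      by (intro sigma_finite_measure.density_zero[OF sigma_finite_lborel F]) (auto simp: set_lebesgue_integral_def)
    then show ?thesis by (simp add: F_def B_def)
  qed
  then have "AE x in lborel. \<forall>n. indicator (box (- real n *\<^sub>R One) (real n *\<^sub>R One)) x *\<^sub>R f x = 0"
    by (simp only: AE_all_countable) blast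
  then show ?thesis
  proof eventually_elim
    case (elim x)
    obtain n where n: "norm x < real n" using reals_Archimedean2 by blast
    have "x \<in> box (- real n *\<^sub>R One) (real n *\<^sub>R One)"
      using n Basis_le_norm[of _ x] by (force simp: mem_box abs_le_iff)
    then show ?case using elim[rule_format, of n] by simp
  qed
qed

subsection \<open>Weak derivatives\<close>

text \<open>The bound is uniform in \<open>t\<close>, so the integrand is absolutely integrable on
  the product of \<open>{0..h}\<close> with the space, and all three claims are Fubini. A
  nonnegative integral in the hypothesis carries integrability with it, which a bound on a Bochner
  integral would not.\<close>

lemma seg_fubini:
  fixes f k :: "'a::euclidean_space \<Rightarrow> complex" and b :: 'a and C :: real
  assumes f[measurable]: "f \<in> borel_measurable borel" and k[measurable]: "k \<in> borel_measurable borel"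
    and bound: "\<And>t. 0 \<le> t \<Longrightarrow> t \<le> h \<Longrightarrow>
        (\<integral>\<^sup>+x. ennreal (cmod (f (x + t *\<^sub>R b) * k x)) \<partial>lborel) \<le> ennreal C"
  shows "(LINT t:{0..h}|lborel. LBINT x. f (x + t *\<^sub>R b) * k x)
       = (LBINT x. (LINT t:{0..h}|lborel. f (x + t *\<^sub>R b)) * k x)"
    and "integrable lborel (\<lambda>x. (LINT t:{0..h}|lborel. f (x + t *\<^sub>R b)) * k x)"
    and "set_integrable lborel {0..h} (\<lambda>t. LBINT x. f (x + t *\<^sub>R b) * k x)"
proof -
  define H where "H t x = indicator {0..h} t *\<^sub>R (f (x + t *\<^sub>R b) * k x)" for t x
  have [measurable]: "(\<lambda>(t, x). H t x) \<in> borel_measurable (lborel \<Otimes>\<^sub>M lborel)"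
    unfolding H_def by measurable
  have int: "integrable (lborel \<Otimes>\<^sub>M lborel) (\<lambda>(t, x). H t x)"
    unfolding integrable_iff_bounded
  proof
    have "(\<integral>\<^sup>+p. ennreal (norm (case p of (t, x) \<Rightarrow> H t x)) \<partial>(lborel \<Otimes>\<^sub>M lborel))
        = (\<integral>\<^sup>+t. \<integral>\<^sup>+x. ennreal (norm (H t x)) \<partial>lborel \<partial>lborel)"
      by (subst lborel.nn_integral_fst[symmetric]) auto
    also have "\<dots> \<le> (\<integral>\<^sup>+t. ennreal C * indicator {0..h} t \<partial>lborel)"
    proof (rule nn_integral_mono)
      fix t :: real
      show "(\<integral>\<^sup>+x. ennreal (norm (H t x)) \<partial>lborel) \<le> ennreal C * indicator {0..h} t"
        using bound[of t] by (auto simp: H_def indicator_def)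
    qed
    also have "\<dots> < \<infinity>"
      by (subst nn_integral_cmult_indicator) (auto simp: ennreal_mult_less_top emeasure_lborel_Icc_eq)
    finally show "(\<integral>\<^sup>+p. ennreal (norm (case p of (t, x) \<Rightarrow> H t x)) \<partial>(lborel \<Otimes>\<^sub>M lborel)) < \<infinity>" .
  qed measurable
  have 1: "(LBINT x. H t x) = indicator {0..h} t *\<^sub>R (LBINT x. f (x + t *\<^sub>R b) * k x)" for t
    by (simp add: H_def indicator_def)
  have 2: "(LBINT t. H t x) = (LINT t:{0..h}|lborel. f (x + t *\<^sub>R b)) * k x" for x
  proof -
    have "(LBINT t. H t x) = (LBINT t. (indicator {0..h} t *\<^sub>R f (x + t *\<^sub>R b)) * k x)"
      by (simp add: H_def)
    also have "\<dots> = (LINT t:{0..h}|lborel. f (x + t *\<^sub>R b)) * k x"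
      unfolding set_lebesgue_integral_def by (rule integral_mult_left_zero)
    finally show ?thesis .
  qed
  show "(LINT t:{0..h}|lborel. LBINT x. f (x + t *\<^sub>R b) * k x)
       = (LBINT x. (LINT t:{0..h}|lborel. f (x + t *\<^sub>R b)) * k x)"
    using lborel_pair.Fubini_integral[OF int] by (simp add: 1 2 set_lebesgue_integral_def)
  show "integrable lborel (\<lambda>x. (LINT t:{0..h}|lborel. f (x + t *\<^sub>R b)) * k x)"
    using lborel_pair.integrable_snd[OF int] by (simp add: 2)
  show "set_integrable lborel {0..h} (\<lambda>t. LBINT x. f (x + t *\<^sub>R b) * k x)"
    using lborel_pair.integrable_fst[OF int] by (simp add: 1 set_integrable_def)
qed

text \<open>While \<open>x\<close> stays in the ball of radius \<open>R\<close> and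
  \<open>0 \<le> t \<le> h\<close>, the point \<open>x + t *\<^sub>R b\<close> stays in the ball of
  radius \<open>R + h * norm b\<close>, over which \<open>f\<close> is integrable. This supplies the
  hypothesis of \<open>seg_fubini\<close>.\<close>

lemma locint_seg_bound:
  fixes f k :: "'a::euclidean_space \<Rightarrow> complex"
  assumes f: "locally_integrable f" and [measurable]: "k \<in> borel_measurable borel"
    and M: "\<And>x. cmod (k x) \<le> M" and R: "\<And>x. R < norm x \<Longrightarrow> k x = 0"
  shows "\<exists>C. \<forall>t. 0 \<le> t \<longrightarrow> t \<le> h \<longrightarrow>
    (\<integral>\<^sup>+x. ennreal (cmod (f (x + t *\<^sub>R b) * k x)) \<partial>lborel) \<le> ennreal C"
proof -
  have [measurable]: "f \<in> borel_measurable borel" using f by (simp add: locally_integrable_def)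
  define S where "S = R + h * norm b"
  have [measurable]: "cball 0 S \<in> sets (borel :: 'a measure)" by simp
  have "set_integrable lborel (cball 0 S) f" using f by (auto simp: locally_integrable_def)
  then have i: "integrable lborel (\<lambda>x. indicator (cball 0 S) x *\<^sub>R f x)" by (simp add: set_integrable_def)
  have "(\<integral>\<^sup>+x. ennreal (cmod (f (x + t *\<^sub>R b) * k x)) \<partial>lborel)
      \<le> ennreal (\<bar>M\<bar> * (LBINT x. norm (indicator (cball 0 S) x *\<^sub>R f x)))" if t: "0 \<le> t" "t \<le> h" for t
  proof -
    have "(\<integral>\<^sup>+x. ennreal (cmod (f (x + t *\<^sub>R b) * k x)) \<partial>lborel)
       \<le> (\<integral>\<^sup>+x. ennreal (\<bar>M\<bar> * norm (indicator (cball 0 S) (x + t *\<^sub>R b) *\<^sub>R f (x + t *\<^sub>R b))) \<partial>lborel)"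
    proof (intro nn_integral_mono ennreal_leI)
      fix x
      show "cmod (f (x + t *\<^sub>R b) * k x)
          \<le> \<bar>M\<bar> * norm (indicator (cball 0 S) (x + t *\<^sub>R b) *\<^sub>R f (x + t *\<^sub>R b))"
      proof (cases "R < norm x")
        case True then show ?thesis using R by simp
      next
        case False
        have "norm (x + t *\<^sub>R b) \<le> norm x + t * norm b" using t norm_triangle_ineq[of x "t *\<^sub>R b"] by simp
        also have "\<dots> \<le> S" using False t by (auto simp: S_def intro!: add_mono mult_right_mono)
        finally have "x + t *\<^sub>R b \<in> cball 0 S" by simp
        moreover have "cmod (k x) \<le> \<bar>M\<bar>" using M[of x] by linarith
        ultimately show ?thesis by (simp add: norm_mult mult.commute[of "\<bar>M\<bar>"] mult_left_mono)
      qed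
    qed
    also have "\<dots> = (\<integral>\<^sup>+x. ennreal (\<bar>M\<bar> * norm (indicator (cball 0 S) x *\<^sub>R f x)) \<partial>lborel)"
      by (rule shift_nn_integral[of "\<lambda>x. ennreal (\<bar>M\<bar> * norm (indicator (cball 0 S) x *\<^sub>R f x))"]) measurable
    also have "\<dots> = ennreal (LBINT x. \<bar>M\<bar> * norm (indicator (cball 0 S) x *\<^sub>R f x))"
      using i by (intro nn_integral_eq_integral integrable_mult_right integrable_norm) auto
    also have "(LBINT x. \<bar>M\<bar> * norm (indicator (cball 0 S) x *\<^sub>R f x))
        = \<bar>M\<bar> * (LBINT x. norm (indicator (cball 0 S) x *\<^sub>R f x))" by (rule integral_mult_right_zero)
    finally show ?thesis .
  qed
  then show ?thesis by blast
qed

lemma seg_integral_partial: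
  fixes \<psi> :: "'a::euclidean_space \<Rightarrow> complex"
  assumes "\<And>x. \<psi> differentiable (at x)" "continuous_on UNIV (partial c \<psi>)" "0 \<le> h"
  shows "(LINT t:{0..h}|lborel. partial c \<psi> (x + t *\<^sub>R c)) = \<psi> (x + h *\<^sub>R c) - \<psi> x"
proof -
  have "(LBINT t. indicator {0..h} t *\<^sub>R partial c \<psi> (x + t *\<^sub>R c))
      = \<psi> (x + h *\<^sub>R c) - \<psi> (x + 0 *\<^sub>R c)"
  proof (rule integral_FTC_Icc)
    fix t :: real
    have *: "((\<lambda>t. x + t *\<^sub>R c) has_derivative (\<lambda>s. s *\<^sub>R c)) (at t within {0..h})"
      by (auto intro!: derivative_eq_intros)
    have D: "(\<psi> has_derivative (\<lambda>v. partial v \<psi> (x + t *\<^sub>R c))) (at (x + t *\<^sub>R c))"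
      by (rule partial_has_derivative[OF assms(1)])
    have "((\<lambda>t. \<psi> (x + t *\<^sub>R c)) has_derivative (\<lambda>s. partial (s *\<^sub>R c) \<psi> (x + t *\<^sub>R c))) (at t within {0..h})"
      by (rule has_derivative_compose[OF * D])
    moreover have "partial (s *\<^sub>R c) \<psi> (x + t *\<^sub>R c) = s *\<^sub>R partial c \<psi> (x + t *\<^sub>R c)" for s
      using linear_scale[OF has_derivative_linear[OF D]] by simp
    ultimately show "((\<lambda>t. \<psi> (x + t *\<^sub>R c)) has_vector_derivative partial c \<psi> (x + t *\<^sub>R c)) (at t within {0..h})"
      by (simp add: has_vector_derivative_def)
  next
    show "continuous_on {0..h} (\<lambda>t. partial c \<psi> (x + t *\<^sub>R c))"
      by (rule continuous_on_compose2[OF assms(2)]) (auto intro!: continuous_intros)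
  qed fact
  then show ?thesis by (simp add: set_lebesgue_integral_def)
qed

text \<open>By translation invariance \<open>\<psi> (x + b) - \<psi> x\<close> has integral 0.
  Written as the derivative integrated over the unit segment, and after Fubini, the same integral is
  an average of integrals of translates of the derivative, all equal.\<close>

lemma integral_partial_test:
  assumes \<psi>: "test_function \<psi>" and b: "b \<in> Basis"
  shows "(LBINT x. partial b \<psi> x) = 0"
proof -
  note p = test_function_partial[OF \<psi> b]
  have s: "smooth \<psi>" using \<psi> by (simp add: test_function_def)
  have [measurable]: "partial b \<psi> \<in> borel_measurable borel" "\<psi> \<in> borel_measurable borel"
    using cc_fun_measurable test_function_cc p \<psi> by auto
  have one: "locally_integrable (\<lambda>x::'a. 1::complex)" by (rule continuous_locally_integrable) simp
  have i: "integrable lborel (partial b \<psi>)" "integrable lborel \<psi>"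
    using locint_cc_integrable[OF one test_function_cc] p \<psi> by simp_all
  have bound: "(\<integral>\<^sup>+x. ennreal (cmod (partial b \<psi> (x + t *\<^sub>R b) * 1)) \<partial>lborel)
      \<le> ennreal (LBINT x. norm (partial b \<psi> x))" for t
    using shift_nn_integral[of "\<lambda>x. ennreal (norm (partial b \<psi> x))" "t *\<^sub>R b"]
    by (simp add: nn_integral_eq_integral[OF integrable_norm[OF i(1)]])
  have "(LINT t:{0..1::real}|lborel. LBINT x. partial b \<psi> (x + t *\<^sub>R b) * 1)
       = (LBINT x. (LINT t:{0..1}|lborel. partial b \<psi> (x + t *\<^sub>R b)) * 1)"
    by (rule seg_fubini(1)[OF _ _ bound]) auto
  moreover have "(LINT t:{0..1}|lborel. partial b \<psi> (x + t *\<^sub>R b)) = \<psi> (x + 1 *\<^sub>R b) - \<psi> x" for x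
    by (rule seg_integral_partial) (auto simp: smooth_differentiable[OF s] smooth_continuous[OF smooth_partial[OF s b]])
  moreover have "(LBINT x. partial b \<psi> (x + t *\<^sub>R b) * 1) = (LBINT x. partial b \<psi> x)" for t
    using shift_integral[of "partial b \<psi>"] by simp
  moreover have "(LBINT x. \<psi> (x + b) - \<psi> x) = 0"
    using i(2) shift_integrable[OF i(2), of b] shift_integral[of \<psi> b] by simp
  ultimately show ?thesis by (simp add: set_integral_const)
qed

lemma continuous_mult_locint:
  assumes c: "continuous_on UNIV c" and f: "locally_integrable f"
  shows "locally_integrable (\<lambda>x. c x * f x)"
  unfolding locally_integrable_def
proof (intro conjI allI impI)
  have [measurable]: "c \<in> borel_measurable borel" "f \<in> borel_measurable borel"
    using c f by (auto simp: locally_integrable_def intro: borel_measurable_continuous_onI)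
  show "(\<lambda>x. c x * f x) \<in> borel_measurable lborel" by measurable
  fix K :: "'a set" assume K: "compact K"
  then have [measurable]: "K \<in> sets borel" by (rule borel_compact)
  have "compact (c ` K)"
    using c K by (intro compact_continuous_image) (auto intro: continuous_on_subset)
  then obtain M where M: "\<And>x. x \<in> K \<Longrightarrow> cmod (c x) \<le> M"
    by (force simp: bounded_iff dest!: compact_imp_bounded)
  have i: "integrable lborel (\<lambda>x. M *\<^sub>R (indicator K x *\<^sub>R f x))"
    using f K unfolding locally_integrable_def set_integrable_def by (intro integrable_scaleR_right) blast
  show "set_integrable lborel K (\<lambda>x. c x * f x)"
    unfolding set_integrable_def
  proof (rule Bochner_Integration.integrable_bound[OF i])
    show "AE x in lborel. norm (indicat_real K x *\<^sub>R (c x * f x)) \<le> norm (M *\<^sub>R (indicat_real K x *\<^sub>R f x))"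
      using M by (intro AE_I2) (fastforce simp: indicator_def norm_mult intro: mult_right_mono order_trans[OF _ abs_ge_self])
  qed measurable
qed

lemma locint_add: "locally_integrable f \<Longrightarrow> locally_integrable g \<Longrightarrow> locally_integrable (\<lambda>x. f x + g x)"
  unfolding locally_integrable_def by auto

lemma locint_diff: "locally_integrable f \<Longrightarrow> locally_integrable g \<Longrightarrow> locally_integrable (\<lambda>x. f x - g x)"
  unfolding locally_integrable_def by auto

lemma locint_translate:
  assumes f: "locally_integrable f"
  shows "locally_integrable (\<lambda>x. f (x + c))"
  unfolding locally_integrable_def
proof (intro conjI allI impI)
  have [measurable]: "f \<in> borel_measurable borel" using f by (simp add: locally_integrable_def)
  show "(\<lambda>x. f (x + c)) \<in> borel_measurable lborel" by measurable
  fix K :: "'a set" assume "compact K"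
  then have "compact ((\<lambda>x. x + c) ` K)" by (intro compact_continuous_image continuous_intros)
  then have "integrable lborel (\<lambda>x. indicator ((\<lambda>x. x + c) ` K) x *\<^sub>R f x)"
    using f by (auto simp: locally_integrable_def set_integrable_def)
  from shift_integrable[OF this, of c] show "set_integrable lborel K (\<lambda>x. f (x + c))"
    by (simp add: set_integrable_def indicator_def image_iff)
qed

lemma is_weak_partialD:
  "is_weak_partial b f g \<Longrightarrow> test_function \<psi> \<Longrightarrow> (LBINT x. f x * partial b \<psi> x) = - (LBINT x. g x * \<psi> x)"
  by (simp add: is_weak_partial_def)

text \<open>The weak derivative of \<open>\<eta>\<close> is tested against
  \<open>f x * \<psi> x\<close>, whose classical product rule is then rearranged.\<close>

lemma weak_partial_mult:
  assumes s: "smooth f" and w: "is_weak_partial b \<eta> g" and b: "b \<in> Basis"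
  shows "is_weak_partial b (\<lambda>x. f x * \<eta> x) (\<lambda>x. partial b f x * \<eta> x + f x * g x)"
  unfolding is_weak_partial_def
proof (intro conjI allI impI)
  note sp = smooth_partial[OF s b]
  have l: "locally_integrable \<eta>" "locally_integrable g" using w by (auto simp: is_weak_partial_def)
  show "locally_integrable (\<lambda>x. f x * \<eta> x)"
    by (rule continuous_mult_locint[OF smooth_continuous[OF s] l(1)])
  have l1: "locally_integrable (\<lambda>x. partial b f x * \<eta> x)"
    by (rule continuous_mult_locint[OF smooth_continuous[OF sp] l(1)])
  have l2: "locally_integrable (\<lambda>x. f x * g x)"
    by (rule continuous_mult_locint[OF smooth_continuous[OF s] l(2)])
  show "locally_integrable (\<lambda>x. partial b f x * \<eta> x + f x * g x)" by (rule locint_add[OF l1 l2])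
  fix \<psi> :: "'a \<Rightarrow> complex" assume \<psi>: "test_function \<psi>"
  then have s\<psi>: "smooth \<psi>" by (simp add: test_function_def)
  have p: "partial b (\<lambda>x. f x * \<psi> x) = (\<lambda>x. partial b f x * \<psi> x + f x * partial b \<psi> x)"
    by (intro ext partial_mult smooth_differentiable s s\<psi>)
  have i: "integrable lborel (\<lambda>x. \<eta> x * (partial b f x * \<psi> x))"
    by (rule locint_cc_integrable[OF l(1) test_function_cc[OF test_function_mult[OF sp \<psi>]]])
  have i2: "integrable lborel (\<lambda>x. \<eta> x * (f x * partial b \<psi> x))"
    by (rule locint_cc_integrable[OF l(1) test_function_cc[OF test_function_mult[OF s test_function_partial[OF \<psi> b]]]])
  have i3: "integrable lborel (\<lambda>x. g x * (f x * \<psi> x))"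
    by (rule locint_cc_integrable[OF l(2) test_function_cc[OF test_function_mult[OF s \<psi>]]])
  have "(LBINT x. \<eta> x * partial b (\<lambda>x. f x * \<psi> x) x) = - (LBINT x. g x * (f x * \<psi> x))"
    by (rule is_weak_partialD[OF w test_function_mult[OF s \<psi>]])
  also have "(LBINT x. \<eta> x * partial b (\<lambda>x. f x * \<psi> x) x)
      = (LBINT x. \<eta> x * (partial b f x * \<psi> x)) + (LBINT x. \<eta> x * (f x * partial b \<psi> x))"
    unfolding p distrib_left by (rule Bochner_Integration.integral_add[OF i i2])
  finally have "(LBINT x. \<eta> x * (f x * partial b \<psi> x))
      = - ((LBINT x. \<eta> x * (partial b f x * \<psi> x)) + (LBINT x. g x * (f x * \<psi> x)))" by (simp add: algebra_simps)
  also have "\<dots> = - (LBINT x. \<eta> x * (partial b f x * \<psi> x) + g x * (f x * \<psi> x))"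
    by (simp add: Bochner_Integration.integral_add[OF i i3])
  finally show "(LBINT x. f x * \<eta> x * partial b \<psi> x) = - (LBINT x. (partial b f x * \<eta> x + f x * g x) * \<psi> x)"
    by (simp add: algebra_simps)
qed

text \<open>The constant 1 has weak derivative 0 because derivatives of test functions integrate to
  0; the product rule with this second factor does the rest.\<close>

lemma smooth_is_weak_partial:
  assumes s: "smooth f" and b: "b \<in> Basis"
  shows "is_weak_partial b f (partial b f)"
proof -
  have "is_weak_partial b (\<lambda>x. 1) (\<lambda>x. 0)"
    by (auto simp: is_weak_partial_def continuous_locally_integrable integral_partial_test[OF _ b])
  from weak_partial_mult[OF s this b] show ?thesis by simp
qed

lemma is_weak_partial_add:
  assumes "is_weak_partial b f f'" "is_weak_partial b g g'" and b: "b \<in> Basis"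
  shows "is_weak_partial b (\<lambda>x. f x + g x) (\<lambda>x. f' x + g' x)"
  unfolding is_weak_partial_def
proof (intro conjI allI impI)
  have l: "locally_integrable f" "locally_integrable f'" "locally_integrable g" "locally_integrable g'"
    using assms by (auto simp: is_weak_partial_def)
  then show "locally_integrable (\<lambda>x. f x + g x)" "locally_integrable (\<lambda>x. f' x + g' x)"
    by (auto intro: locint_add)
  fix \<psi> :: "'a \<Rightarrow> complex" assume \<psi>: "test_function \<psi>"
  note c = test_function_cc[OF \<psi>] test_function_cc[OF test_function_partial[OF \<psi> b]]
  show "(LBINT x. (f x + g x) * partial b \<psi> x) = - (LBINT x. (f' x + g' x) * \<psi> x)"
    using locint_cc_integrable[OF l(1) c(2)] locint_cc_integrable[OF l(3) c(2)]
      locint_cc_integrable[OF l(2) c(1)] locint_cc_integrable[OF l(4) c(1)]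
      is_weak_partialD[OF assms(1) \<psi>] is_weak_partialD[OF assms(2) \<psi>]
    by (simp add: distrib_right)
qed

lemma is_weak_partial_unique:
  assumes "is_weak_partial b f g" "is_weak_partial b f g'"
  shows "AE x in lborel. g x = g' x"
proof -
  have l: "locally_integrable g" "locally_integrable g'" using assms by (auto simp: is_weak_partial_def)
  have "AE x in lborel. g x - g' x = 0"
  proof (rule locint_AE_zero[OF locint_diff[OF l]])
    fix \<psi> :: "'a \<Rightarrow> complex" assume \<psi>: "test_function \<psi>"
    show "(LBINT x. (g x - g' x) * \<psi> x) = 0"
      using locint_cc_integrable[OF l(1) test_function_cc[OF \<psi>]] locint_cc_integrable[OF l(2) test_function_cc[OF \<psi>]]
        is_weak_partialD[OF assms(1) \<psi>] is_weak_partialD[OF assms(2) \<psi>]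
      by (simp add: left_diff_distrib)
  qed
  then show ?thesis by simp
qed

text \<open>\<open>weak_partial\<close> is a bare choice and carries information only once some weak
  derivative has been exhibited.\<close>

lemma is_weak_partial_weak_partial: "is_weak_partial b f g \<Longrightarrow> is_weak_partial b f (weak_partial b f)"
  unfolding weak_partial_def by (rule someI[of "is_weak_partial b f"])

lemma weak_partial_AE: "is_weak_partial b f g \<Longrightarrow> AE x in lborel. weak_partial b f x = g x"
  by (rule is_weak_partial_unique[OF is_weak_partial_weak_partial])

text \<open>Iterated weak derivatives, as in \<open>weak_laplacian\<close>, are taken of the
  representative picked by \<open>weak_partial\<close>, not of an explicit formula for the first
  derivative. This moves a derivative from the formula to the representative.\<close>

lemma is_weak_partial_cong:
  assumes w: "is_weak_partial b f g" and f': "locally_integrable f'" and eq: "AE x in lborel. f' x = f x"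
    and b: "b \<in> Basis"
  shows "is_weak_partial b f' g"
  unfolding is_weak_partial_def
proof (intro conjI allI impI)
  show "locally_integrable g" using w by (simp add: is_weak_partial_def)
  fix \<psi> :: "'a \<Rightarrow> complex" assume \<psi>: "test_function \<psi>"
  have [measurable]: "f \<in> borel_measurable borel" "f' \<in> borel_measurable borel"
    using w f' by (auto simp: is_weak_partial_def locally_integrable_def)
  have [measurable]: "partial b \<psi> \<in> borel_measurable borel"
    by (rule cc_fun_measurable[OF test_function_cc[OF test_function_partial[OF \<psi> b]]])
  have "(LBINT x. f' x * partial b \<psi> x) = (LBINT x. f x * partial b \<psi> x)"
    by (rule integral_cong_AE) (use eq in auto)
  then show "(LBINT x. f' x * partial b \<psi> x) = - (LBINT x. g x * \<psi> x)"
    using is_weak_partialD[OF w \<psi>] by simp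
qed fact

text \<open>Paired with a test function, the increment moves onto that function by translation,
  where the classical fundamental theorem applies; for each \<open>t\<close> the weak derivative
  then returns the differentiation to \<open>f\<close>, and Fubini reassembles the segment
  integral.\<close>

lemma weak_partial_increment:
  assumes w: "is_weak_partial b f g" and b: "b \<in> Basis" and h: "0 \<le> h"
  shows "AE x in lborel. f (x + h *\<^sub>R b) - f x = (LINT t:{0..h}|lborel. g (x + t *\<^sub>R b))"
proof -
  have l: "locally_integrable f" "locally_integrable g" using w by (auto simp: is_weak_partial_def)
  have [measurable]: "f \<in> borel_measurable borel" "g \<in> borel_measurable borel"
    using l by (auto simp: locally_integrable_def)
  define G where "G x = (LINT t:{0..h}|lborel. g (x + t *\<^sub>R b))" for x
  have Gm[measurable]: "G \<in> borel_measurable borel"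
    unfolding G_def set_lebesgue_integral_def by measurable
  \<comment> \<open>The fundamental lemma asks for local integrability of \<open>G\<close>; the
    indicator of \<open>K\<close> plays the kernel in \<open>seg_fubini\<close>.\<close>
  have lG: "locally_integrable G"
    unfolding locally_integrable_def
  proof (intro conjI allI impI)
    fix K :: "'a set" assume K: "compact K"
    then have [measurable]: "K \<in> sets borel" by (rule borel_compact)
    obtain R where R: "\<And>x. x \<in> K \<Longrightarrow> norm x \<le> R" using compact_imp_bounded[OF K] by (auto simp: bounded_iff)
    have "\<exists>C. \<forall>t. 0 \<le> t \<longrightarrow> t \<le> h \<longrightarrow>
      (\<integral>\<^sup>+x. ennreal (cmod (g (x + t *\<^sub>R b) * complex_of_real (indicator K x))) \<partial>lborel) \<le> ennreal C"
      by (rule locint_seg_bound[OF l(2), where M=1 and R=R]) (use R in \<open>force simp: indicator_def\<close>)+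
    then obtain C where "\<And>t. 0 \<le> t \<Longrightarrow> t \<le> h \<Longrightarrow>
      (\<integral>\<^sup>+x. ennreal (cmod (g (x + t *\<^sub>R b) * complex_of_real (indicator K x))) \<partial>lborel) \<le> ennreal C" by blast
    then have "integrable lborel (\<lambda>x. G x * complex_of_real (indicator K x))"
      unfolding G_def by (intro seg_fubini(2)) auto
    then show "set_integrable lborel K G"
      by (simp add: set_integrable_def scaleR_conv_of_real mult.commute)
  qed measurable
  have lt: "locally_integrable (\<lambda>x. f (x + h *\<^sub>R b))" by (rule locint_translate[OF l(1)])
  have "AE x in lborel. f (x + h *\<^sub>R b) - f x - G x = 0"
  proof (rule locint_AE_zero[OF locint_diff[OF locint_diff[OF lt l(1)] lG]])
    fix \<psi> :: "'a \<Rightarrow> complex" assume \<psi>: "test_function \<psi>"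
    note p = test_function_partial[OF \<psi> b]
    have s: "smooth \<psi>" using \<psi> by (simp add: test_function_def)
    note cs = smooth_continuous[OF smooth_partial[OF s b]]
    have c: "cc_fun \<psi>" "cc_fun (partial b \<psi>)" using \<psi> p by (auto simp: test_function_cc)
    have [measurable]: "\<psi> \<in> borel_measurable borel" "partial b \<psi> \<in> borel_measurable borel"
      using c by (auto simp: cc_fun_measurable)
    note int = locint_cc_integrable[OF lt c(1)] locint_cc_integrable[OF l(1) c(1)] locint_cc_integrable[OF lG c(1)]
    have A: "(LBINT x. (f (x + h *\<^sub>R b) - f x - G x) * \<psi> x)
      = (LBINT x. f (x + h *\<^sub>R b) * \<psi> x) - (LBINT x. f x * \<psi> x) - (LBINT x. G x * \<psi> x)"
      using int by (simp add: left_diff_distrib)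
    have sh: "(LBINT x. q (x + t *\<^sub>R b) * k x) = (LBINT x. q x * k (x - t *\<^sub>R b))"
      if "q \<in> borel_measurable borel" "k \<in> borel_measurable borel"
      for t and q k :: "'a \<Rightarrow> complex"
    proof -
      note that[measurable]
      show ?thesis using shift_integral[of "\<lambda>x. q x * k (x - t *\<^sub>R b)" "t *\<^sub>R b"] by simp
    qed
    obtain M R where M: "\<And>x. cmod (partial b \<psi> x) \<le> M" and R: "\<And>x. R < norm x \<Longrightarrow> partial b \<psi> x = 0"
      using cc_fun_bounded[OF c(2)] c(2) by (auto simp: cc_fun_def)
    from locint_seg_bound[where k="partial b \<psi>" and f=f and M=M and R=R and h=h and b=b] l M R obtain C where
      C: "\<And>t. 0 \<le> t \<Longrightarrow> t \<le> h \<Longrightarrow>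
        (\<integral>\<^sup>+x. ennreal (cmod (f (x + t *\<^sub>R b) * partial b \<psi> x)) \<partial>lborel) \<le> ennreal C" by auto
    have C': "(\<integral>\<^sup>+x. ennreal (cmod (partial b \<psi> (x + t *\<^sub>R (- b)) * f x)) \<partial>lborel) \<le> ennreal C"
      if "0 \<le> t" "t \<le> h" for t
      using C[OF that] shift_nn_integral[of "\<lambda>x. ennreal (cmod (partial b \<psi> (x + t *\<^sub>R (- b)) * f x))" "t *\<^sub>R b"]
      by (simp add: mult.commute)
    obtain M' R' where M': "\<And>x. cmod (\<psi> x) \<le> M'" and R': "\<And>x. R' < norm x \<Longrightarrow> \<psi> x = 0"
      using cc_fun_bounded[OF c(1)] c(1) by (auto simp: cc_fun_def)
    from locint_seg_bound[where k="\<psi>" and f=g and M=M' and R=R' and h=h and b=b] l M' R' obtain C2 where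
      C2: "\<And>t. 0 \<le> t \<Longrightarrow> t \<le> h \<Longrightarrow>
        (\<integral>\<^sup>+x. ennreal (cmod (g (x + t *\<^sub>R b) * \<psi> x)) \<partial>lborel) \<le> ennreal C2" by auto
    \<comment> \<open>On the test function the increment is a step by
      \<open>- (h *\<^sub>R b)\<close>, so the classical theorem is used in the direction
      \<open>- b\<close>; the sign comes from linearity of the derivative in its direction.\<close>
    have D: "\<psi> (x - h *\<^sub>R b) - \<psi> x = - (LINT t:{0..h}|lborel. partial b \<psi> (x + t *\<^sub>R (- b)))" for x
    proof -
      have m: "partial (- b) \<psi> = (\<lambda>x. - partial b \<psi> x)"
        using linear_neg[OF has_derivative_linear[OF partial_has_derivative[OF smooth_differentiable[OF s]]]]
        by (simp add: fun_eq_iff)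
      have "(LINT t:{0..h}|lborel. partial (- b) \<psi> (x + t *\<^sub>R (- b))) = \<psi> (x + h *\<^sub>R (- b)) - \<psi> x"
        by (rule seg_integral_partial)
           (use h smooth_differentiable[OF s] cs in \<open>auto simp: m intro!: continuous_intros\<close>)
      then show ?thesis by (simp add: m set_lebesgue_integral_def)
    qed
    have i2: "integrable lborel (\<lambda>x. f x * \<psi> (x - h *\<^sub>R b))"
      using locint_cc_integrable[OF l(1) test_function_cc[OF test_function_translate[OF \<psi>, of "- (h *\<^sub>R b)"]]]
      by simp
    \<comment> \<open>A translate of a test function is again a test function, so the weak
      derivative may be tested against it before the translation passes to \<open>g\<close>.\<close>
    have E: "(LBINT x. partial b \<psi> (x + t *\<^sub>R (- b)) * f x) = - (LBINT x. g (x + t *\<^sub>R b) * \<psi> x)" for t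
    proof -
      have e: "partial b (\<lambda>x. \<psi> (x + t *\<^sub>R (- b))) = (\<lambda>x. partial b \<psi> (x + t *\<^sub>R (- b)))"
        by (intro ext partial_translate)
      have "(LBINT x. f x * partial b \<psi> (x + t *\<^sub>R (- b))) = - (LBINT x. g x * \<psi> (x + t *\<^sub>R (- b)))"
        using is_weak_partialD[OF w test_function_translate[OF \<psi>, of "t *\<^sub>R (- b)"]] unfolding e .
      then show ?thesis by (simp add: sh mult.commute[of "partial b \<psi> _"])
    qed
    have "(LBINT x. f (x + h *\<^sub>R b) * \<psi> x) - (LBINT x. f x * \<psi> x)
        = (LBINT x. f x * (\<psi> (x - h *\<^sub>R b) - \<psi> x))"
      using i2 int(2) by (simp add: sh right_diff_distrib)
    also have "\<dots> = - (LBINT x. (LINT t:{0..h}|lborel. partial b \<psi> (x + t *\<^sub>R (- b))) * f x)"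
      unfolding D by (simp add: mult.commute)
    also have "\<dots> = - (LINT t:{0..h}|lborel. LBINT x. partial b \<psi> (x + t *\<^sub>R (- b)) * f x)"
      by (subst seg_fubini(1)[OF _ _ C']) auto
    also have "\<dots> = - (LINT t:{0..h}|lborel. - (LBINT x. g (x + t *\<^sub>R b) * \<psi> x))"
      by (simp only: E)
    also have "- (LINT t:{0..h}|lborel. - (LBINT x. g (x + t *\<^sub>R b) * \<psi> x))
        = (LINT t:{0..h}|lborel. (LBINT x. g (x + t *\<^sub>R b) * \<psi> x))"
      by (simp add: set_lebesgue_integral_def)
    also have "\<dots> = (LBINT x. G x * \<psi> x)"
      unfolding G_def by (rule seg_fubini(1)[OF _ _ C2]) auto
    finally show "(LBINT x. (f (x + h *\<^sub>R b) - f x - G x) * \<psi> x) = 0" using A by simp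
  qed
  then show ?thesis by (simp add: G_def)
qed

subsection \<open>Integration by parts in L2\<close>

lemma L2_measurable[measurable_dest]: "f \<in> L2 \<Longrightarrow> f \<in> borel_measurable borel"
  by (simp add: L2_def)

lemma L2_integrable: "f \<in> L2 \<Longrightarrow> integrable lborel (\<lambda>x. (cmod (f x))\<^sup>2)"
  by (simp add: L2_def)

lemma L2_bound:
  assumes [measurable]: "f \<in> borel_measurable borel" and g: "integrable lborel g"
    and le: "AE x in lborel. (cmod (f x))\<^sup>2 \<le> g x"
  shows "f \<in> L2"
proof -
  have "integrable lborel (\<lambda>x. (cmod (f x))\<^sup>2)"
    by (rule Bochner_Integration.integrable_bound[OF g]) (use le in \<open>auto intro: order_trans[OF _ abs_ge_self]\<close>)
  then show ?thesis by (simp add: L2_def)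
qed

lemma L2_mult_integrable:
  assumes f: "f \<in> L2" and g: "g \<in> L2"
  shows "integrable lborel (\<lambda>x. f x * g x)"
proof -
  note [measurable] = L2_measurable[OF f] L2_measurable[OF g]
  have i: "integrable lborel (\<lambda>x. (cmod (f x))\<^sup>2 + (cmod (g x))\<^sup>2)"
    using L2_integrable[OF f] L2_integrable[OF g] by simp
  show ?thesis
  proof (rule Bochner_Integration.integrable_bound[OF i])
    show "AE x in lborel. norm (f x * g x) \<le> norm ((cmod (f x))\<^sup>2 + (cmod (g x))\<^sup>2)"
    proof (intro AE_I2)
      fix x
      have "0 \<le> (cmod (f x) - cmod (g x))\<^sup>2" "0 \<le> cmod (f x) * cmod (g x)" by simp_all
      then have "cmod (f x) * cmod (g x) \<le> (cmod (f x))\<^sup>2 + (cmod (g x))\<^sup>2"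
        unfolding power2_diff mult.assoc by linarith
      then show "norm (f x * g x) \<le> norm ((cmod (f x))\<^sup>2 + (cmod (g x))\<^sup>2)" by (simp add: norm_mult)
    qed
  qed measurable
qed

lemma L2_norm_mult_integrable:
  "f \<in> L2 \<Longrightarrow> g \<in> L2 \<Longrightarrow> integrable lborel (\<lambda>x. cmod (f x) * cmod (g x))"
  using integrable_norm[OF L2_mult_integrable[of f g]] by (simp add: norm_mult)

lemma L2_add: "f \<in> L2 \<Longrightarrow> g \<in> L2 \<Longrightarrow> (\<lambda>x. f x + g x) \<in> L2"
proof -
  assume f: "f \<in> L2" and g: "g \<in> L2"
  note [measurable] = L2_measurable[OF f] L2_measurable[OF g]
  have i: "integrable lborel (\<lambda>x. 2 * (cmod (f x))\<^sup>2 + 2 * (cmod (g x))\<^sup>2)"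
    using L2_integrable[OF f] L2_integrable[OF g] by simp
  have "(cmod (f x + g x))\<^sup>2 \<le> 2 * (cmod (f x))\<^sup>2 + 2 * (cmod (g x))\<^sup>2" for x
  proof -
    have "(cmod (f x + g x))\<^sup>2 \<le> (cmod (f x) + cmod (g x))\<^sup>2"
      by (intro power_mono norm_triangle_ineq) simp
    also have "\<dots> \<le> 2 * (cmod (f x))\<^sup>2 + 2 * (cmod (g x))\<^sup>2"
      using zero_le_power2[of "cmod (f x) - cmod (g x)"] unfolding power2_sum power2_diff by linarith
    finally show ?thesis .
  qed
  then show ?thesis by (intro L2_bound[OF _ i]) auto
qed

lemma L2_bounded_mult:
  assumes c: "c \<in> borel_measurable borel" and M: "\<And>x. cmod (c x) \<le> M" and f: "f \<in> L2"
  shows "(\<lambda>x. c x * f x) \<in> L2"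
proof -
  note [measurable] = L2_measurable[OF f] c
  have i: "integrable lborel (\<lambda>x. M\<^sup>2 * (cmod (f x))\<^sup>2)" using L2_integrable[OF f] by simp
  show ?thesis
    by (rule L2_bound[OF _ i]) (auto simp: norm_mult power_mult_distrib intro!: mult_right_mono power_mono M)
qed

lemma L2_cmult: "f \<in> L2 \<Longrightarrow> (\<lambda>x. c * f x) \<in> L2"
  by (rule L2_bounded_mult[where M="cmod c"]) auto

lemma L2_diff: "f \<in> L2 \<Longrightarrow> g \<in> L2 \<Longrightarrow> (\<lambda>x. f x - g x) \<in> L2"
  using L2_add[of f "\<lambda>x. (-1) * g x"] L2_cmult[of g "-1"] by simp

lemma borel_measurable_cnj[measurable]: "cnj \<in> borel_measurable borel"
  by (intro borel_measurable_continuous_onI continuous_intros)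

lemma L2_cnj: "f \<in> L2 \<Longrightarrow> (\<lambda>x. cnj (f x)) \<in> L2"
  by (auto simp: L2_def)

lemma L2_sum: "finite I \<Longrightarrow> (\<And>i. i \<in> I \<Longrightarrow> f i \<in> L2) \<Longrightarrow> (\<lambda>x. \<Sum>i\<in>I. f i x) \<in> L2"
proof (induction I rule: finite_induct)
  case empty show ?case by (simp add: L2_def)
next
  case (insert i I) then show ?case by (simp add: L2_add)
qed

lemma L2_translate: "f \<in> L2 \<Longrightarrow> (\<lambda>x. f (x + c)) \<in> L2"
  using shift_integrable[of "\<lambda>x. (cmod (f x))\<^sup>2" c] by (auto simp: L2_def)

lemma norm_L2_translate: "f \<in> L2 \<Longrightarrow> norm_L2 (\<lambda>x. f (x + c)) = norm_L2 f"
  using shift_integral[of "\<lambda>x. (cmod (f x))\<^sup>2" c] by (auto simp: norm_L2_def L2_def)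

lemma norm_L2_cnj: "norm_L2 (\<lambda>x. cnj (f x)) = norm_L2 f"
  by (simp add: norm_L2_def)

lemma norm_L2_nonneg: "0 \<le> norm_L2 f"
  by (simp add: norm_L2_def)

lemma norm_L2_sq: "(norm_L2 f)\<^sup>2 = (LBINT x. (cmod (f x))\<^sup>2)"
  by (simp add: norm_L2_def)

lemma norm_L2_minus: "norm_L2 (\<lambda>x. f x - g x) = norm_L2 (\<lambda>x. g x - f x)"
  by (simp add: norm_L2_def norm_minus_commute)

text \<open>The integral of \<open>(s * cmod (f x) - cmod (g x))\<^sup>2\<close> is a polynomial in
  \<open>s\<close>, of degree at most 2, that is nowhere negative.\<close>

lemma L2_cauchy_schwarz:
  assumes f: "f \<in> L2" and g: "g \<in> L2"
  shows "(LBINT x. cmod (f x) * cmod (g x)) \<le> norm_L2 f * norm_L2 g"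
proof -
  define A B C where "A = (LBINT x. (cmod (f x))\<^sup>2)" and "B = (LBINT x. cmod (f x) * cmod (g x))"
    and "C = (LBINT x. (cmod (g x))\<^sup>2)"
  note i = L2_integrable[OF f] L2_integrable[OF g] L2_norm_mult_integrable[OF f g]
  have pos: "0 \<le> A" "0 \<le> B" "0 \<le> C" by (auto simp: A_def B_def C_def)
  have q: "0 \<le> A * s\<^sup>2 - 2 * s * B + C" for s
  proof -
    have "0 \<le> (LBINT x. (s * cmod (f x) - cmod (g x))\<^sup>2)" by simp
    also have "\<dots> = (LBINT x. s\<^sup>2 * (cmod (f x))\<^sup>2 - 2 * s * (cmod (f x) * cmod (g x)) + (cmod (g x))\<^sup>2)"
      by (simp add: power2_diff power_mult_distrib algebra_simps)
    also have "\<dots> = A * s\<^sup>2 - 2 * s * B + C" using i by (simp add: A_def B_def C_def)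
    finally show ?thesis .
  qed
  have "B\<^sup>2 \<le> A * C"
  proof (cases "A = 0")
    case True
    have "B = 0"
    proof (rule ccontr)
      assume "B \<noteq> 0"
      \<comment> \<open>With \<open>A = 0\<close> the polynomial is affine in \<open>s\<close>, and
        this \<open>s\<close> gives it the value -1.\<close>
      then show False using q[of "(C + 1) / (2 * B)"] True by simp
    qed
    then show ?thesis using pos by simp
  next
    case False
    \<comment> \<open>The minimiser of the quadratic.\<close>
    then show ?thesis using q[of "B / A"] pos by (simp add: field_simps power2_eq_square)
  qed
  then have "B \<le> sqrt (A * C)" using pos by (simp add: real_le_rsqrt)
  then show ?thesis by (simp add: norm_L2_def real_sqrt_mult A_def B_def C_def)
qed

lemma L2_inner_bound:
  assumes "f \<in> L2" "g \<in> L2"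
  shows "cmod (LBINT x. f x * g x) \<le> norm_L2 f * norm_L2 g"
proof -
  have "cmod (LBINT x. f x * g x) \<le> (LBINT x. cmod (f x * g x))" by (rule integral_norm_bound)
  then show ?thesis using L2_cauchy_schwarz[OF assms] by (simp add: norm_mult)
qed

lemma norm_L2_triangle:
  assumes f: "f \<in> L2" and g: "g \<in> L2"
  shows "norm_L2 (\<lambda>x. f x + g x) \<le> norm_L2 f + norm_L2 g"
proof (rule power2_le_imp_le)
  note i = L2_integrable[OF f] L2_integrable[OF g] L2_norm_mult_integrable[OF f g]
  have "(norm_L2 (\<lambda>x. f x + g x))\<^sup>2 = (LBINT x. (cmod (f x + g x))\<^sup>2)" by (rule norm_L2_sq)
  also have "\<dots> \<le> (LBINT x. (cmod (f x))\<^sup>2 + 2 * (cmod (f x) * cmod (g x)) + (cmod (g x))\<^sup>2)"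
  proof (rule integral_mono)
    show "integrable lborel (\<lambda>x. (cmod (f x + g x))\<^sup>2)" by (rule L2_integrable[OF L2_add[OF f g]])
    fix x
    have "(cmod (f x + g x))\<^sup>2 \<le> (cmod (f x) + cmod (g x))\<^sup>2"
      by (intro power_mono norm_triangle_ineq) simp
    then show "(cmod (f x + g x))\<^sup>2 \<le> (cmod (f x))\<^sup>2 + 2 * (cmod (f x) * cmod (g x)) + (cmod (g x))\<^sup>2"
      by (simp add: power2_sum)
  qed (use i in simp)
  also have "\<dots> = (norm_L2 f)\<^sup>2 + 2 * (LBINT x. cmod (f x) * cmod (g x)) + (norm_L2 g)\<^sup>2"
    using i by (simp add: norm_L2_sq)
  also have "\<dots> \<le> (norm_L2 f + norm_L2 g)\<^sup>2"
    using L2_cauchy_schwarz[OF f g] by (simp add: power2_sum)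
  finally show "(norm_L2 (\<lambda>x. f x + g x))\<^sup>2 \<le> (norm_L2 f + norm_L2 g)\<^sup>2" .
qed (simp add: norm_L2_nonneg)

lemma L2_indicator_compact:
  assumes K: "compact K"
  shows "(\<lambda>x. complex_of_real (indicator K x)) \<in> L2"
proof -
  have [measurable]: "K \<in> sets borel" using K by (rule borel_compact)
  have "integrable lborel (\<lambda>x. indicat_real K x *\<^sub>R (1::real))"
    by (rule borel_integrable_compact[OF K]) simp
  then have "integrable lborel (\<lambda>x. indicat_real K x)" by simp
  then show ?thesis by (rule L2_bound[rotated]) (auto simp: indicator_def)
qed

lemma L2_locint: assumes f: "f \<in> L2" shows "locally_integrable f"
  unfolding locally_integrable_def
proof (intro conjI allI impI)
  show "f \<in> borel_measurable lborel" using f by (simp add: L2_def)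
  fix K :: "'a set" assume "compact K"
  from L2_mult_integrable[OF L2_indicator_compact[OF this] f] show "set_integrable lborel K f"
    by (simp add: set_integrable_def scaleR_conv_of_real)
qed

text \<open>Cauchy-Schwarz and the translation invariance of \<open>norm_L2\<close> bound the
  pairing uniformly in \<open>t\<close>, so \<open>seg_fubini\<close> applies to any
  \<open>k\<close> in \<open>L2\<close> without compact support.\<close>

lemma weak_partial_increment_L2:
  assumes w: "is_weak_partial b f g" and b: "b \<in> Basis" and h: "0 \<le> h"
    and g: "g \<in> L2" and k: "k \<in> L2"
  shows "(LBINT x. (f (x + h *\<^sub>R b) - f x) * k x) = (LINT t:{0..h}|lborel. LBINT x. g (x + t *\<^sub>R b) * k x)"
    and "set_integrable lborel {0..h} (\<lambda>t. LBINT x. g (x + t *\<^sub>R b) * k x)"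
proof -
  note [measurable] = L2_measurable[OF g] L2_measurable[OF k]
  have [measurable]: "f \<in> borel_measurable borel"
    using w by (simp add: is_weak_partial_def locally_integrable_def)
  have bd: "(\<integral>\<^sup>+x. ennreal (cmod (g (x + t *\<^sub>R b) * k x)) \<partial>lborel) \<le> ennreal (norm_L2 g * norm_L2 k)" for t
  proof -
    note gt = L2_translate[OF g, of "t *\<^sub>R b"]
    have "(\<integral>\<^sup>+x. ennreal (cmod (g (x + t *\<^sub>R b) * k x)) \<partial>lborel)
        = ennreal (LBINT x. cmod (g (x + t *\<^sub>R b)) * cmod (k x))"
      using L2_norm_mult_integrable[OF gt k] by (simp add: norm_mult nn_integral_eq_integral)
    then show ?thesis using L2_cauchy_schwarz[OF gt k] norm_L2_translate[OF g] by (simp add: ennreal_leI)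
  qed
  have "(LBINT x. (f (x + h *\<^sub>R b) - f x) * k x)
      = (LBINT x. (LINT t:{0..h}|lborel. g (x + t *\<^sub>R b)) * k x)"
  proof (rule integral_cong_AE)
    show "(\<lambda>x. (LINT t:{0..h}|lborel. g (x + t *\<^sub>R b)) * k x) \<in> borel_measurable lborel"
      unfolding set_lebesgue_integral_def by measurable
    show "AE x in lborel. (f (x + h *\<^sub>R b) - f x) * k x = (LINT t:{0..h}|lborel. g (x + t *\<^sub>R b)) * k x"
      using weak_partial_increment[OF w b h] by eventually_elim simp
  qed measurable
  also have "\<dots> = (LINT t:{0..h}|lborel. LBINT x. g (x + t *\<^sub>R b) * k x)"
    by (rule seg_fubini(1)[OF _ _ bd, symmetric]) auto
  finally show "(LBINT x. (f (x + h *\<^sub>R b) - f x) * k x) = (LINT t:{0..h}|lborel. LBINT x. g (x + t *\<^sub>R b) * k x)" .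
  show "set_integrable lborel {0..h} (\<lambda>t. LBINT x. g (x + t *\<^sub>R b) * k x)"
    by (rule seg_fubini(3)[OF _ _ bd]) auto
qed

text \<open>With \<open>c = 0\<close> this serves as a size bound; with \<open>c\<close> the value
  at an endpoint of the segment it is a first-order expansion in \<open>h\<close>, with the
  variation of \<open>P\<close> as error.\<close>

lemma seg_integral_estimate:
  fixes P :: "real \<Rightarrow> complex"
  assumes i: "set_integrable lborel {0..h} P" and h: "0 \<le> h"
    and e: "\<And>t. 0 \<le> t \<Longrightarrow> t \<le> h \<Longrightarrow> cmod (P t - c) \<le> e"
  shows "cmod ((LINT t:{0..h}|lborel. P t) - h *\<^sub>R c) \<le> h * e"
proof -
  have ic: "set_integrable lborel {0..h} (\<lambda>t. c)"
    unfolding set_integrable_def by (rule borel_integrable_compact) auto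
  have ie: "integrable lborel (\<lambda>t. indicator {0..h} t *\<^sub>R e)"
    by (rule borel_integrable_compact) auto
  have "(LINT t:{0..h}|lborel. P t) - h *\<^sub>R c = (LINT t:{0..h}|lborel. P t - c)"
    using set_integral_diff(2)[OF i ic] h by (simp add: set_integral_const)
  also have "cmod \<dots> \<le> (LBINT t. cmod (indicator {0..h} t *\<^sub>R (P t - c)))"
    unfolding set_lebesgue_integral_def by (rule integral_norm_bound)
  also have "\<dots> \<le> (LBINT t. indicator {0..h} t *\<^sub>R e)"
  proof (rule integral_mono[OF _ ie])
    show "integrable lborel (\<lambda>t. cmod (indicator {0..h} t *\<^sub>R (P t - c)))"
      using set_integral_diff(1)[OF i ic] unfolding set_integrable_def by (rule integrable_norm)
  qed (use e in \<open>auto simp: indicator_def\<close>)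
  also have "\<dots> = h * e" using h by simp
  finally show ?thesis .
qed

text \<open>Duality replaces Minkowski's inequality for integrals: the increment is paired with its
  own conjugate, the pairing is bounded for each \<open>t\<close> by Cauchy-Schwarz, and one factor
  \<open>norm_L2 D\<close> is cancelled.\<close>

lemma weak_partial_increment_norm:
  assumes w: "is_weak_partial b f g" and b: "b \<in> Basis" and h: "0 \<le> h"
    and f: "f \<in> L2" and g: "g \<in> L2"
  shows "norm_L2 (\<lambda>x. f (x + h *\<^sub>R b) - f x) \<le> h * norm_L2 g"
proof -
  define D where "D x = f (x + h *\<^sub>R b) - f x" for x
  have D: "D \<in> L2" unfolding D_def by (intro L2_diff L2_translate f)
  note cD = L2_cnj[OF D]
  have "(norm_L2 D)\<^sup>2 = cmod (LBINT x. D x * cnj (D x))"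
    by (simp add: norm_L2_sq complex_norm_square[symmetric] flip: of_real_power)
  also have "(LBINT x. D x * cnj (D x)) = (LINT t:{0..h}|lborel. LBINT x. g (x + t *\<^sub>R b) * cnj (D x))"
    unfolding D_def by (rule weak_partial_increment_L2(1)[OF w b h g, of "\<lambda>x. cnj (D x)", unfolded D_def])
      (use cD in \<open>simp add: D_def[abs_def]\<close>)
  also have "cmod \<dots> \<le> h * (norm_L2 g * norm_L2 D)"
  proof -
    have "cmod ((LINT t:{0..h}|lborel. LBINT x. g (x + t *\<^sub>R b) * cnj (D x)) - h *\<^sub>R 0) \<le> h * (norm_L2 g * norm_L2 D)"
    proof (rule seg_integral_estimate[OF weak_partial_increment_L2(2)[OF w b h g cD] h])
      fix t :: real
      show "cmod ((LBINT x. g (x + t *\<^sub>R b) * cnj (D x)) - 0) \<le> norm_L2 g * norm_L2 D"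
        using L2_inner_bound[OF L2_translate[OF g, of "t *\<^sub>R b"] cD] norm_L2_translate[OF g]
        by (simp add: norm_L2_cnj)
    qed
    then show ?thesis by simp
  qed
  finally have "norm_L2 D * norm_L2 D \<le> (h * norm_L2 g) * norm_L2 D" by (simp add: power2_eq_square mult_ac)
  then have "norm_L2 D \<le> h * norm_L2 g"
    using norm_L2_nonneg[of D] norm_L2_nonneg[of g] h
    by (cases "norm_L2 D = 0") (auto simp: mult_le_cancel_right)
  then show ?thesis by (simp add: D_def[abs_def])
qed

text \<open>No density of test functions is needed: \<open>\<integral> (f (x + h b) - f x) g x\<close> is evaluated to first order in \<open>h\<close>
  with the increment on \<open>f\<close> and, after a translation, on \<open>g\<close>; both errors are \<open>O(h\<^sup>2)\<close>.\<close>

lemma weak_integration_by_parts: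
  assumes wf: "is_weak_partial b f f'" and wg: "is_weak_partial b g g'" and b: "b \<in> Basis"
    and f: "f \<in> L2" and f': "f' \<in> L2" and g: "g \<in> L2" and g': "g' \<in> L2"
  shows "(LBINT x. f' x * g x) = - (LBINT x. g' x * f x)"
proof -
  define P where "P = (LBINT x. f' x * g x)"
  define Q where "Q = (LBINT x. g' x * f x)"
  define C where "C = norm_L2 f' * norm_L2 g'"
  have est: "cmod (P + Q) \<le> 2 * h * C" if h: "0 < h" for h
  proof -
    have h0: "0 \<le> h" using h by simp
    define A where "A = (LBINT x. (f (x + h *\<^sub>R b) - f x) * g x)"
    note tr = L2_translate[of _ "_ *\<^sub>R b"]
    have "cmod ((LINT t:{0..h}|lborel. LBINT x. f' (x + t *\<^sub>R b) * g x) - h *\<^sub>R P) \<le> h * (h * C)"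
    proof (rule seg_integral_estimate[OF weak_partial_increment_L2(2)[OF wf b h0 f' g] h0])
      fix t assume t: "0 \<le> t" "t \<le> h"
      have "P = (LBINT x. f' (x + t *\<^sub>R b) * g (x + t *\<^sub>R b))"
        unfolding P_def using f' g
        by (subst shift_integral[of "\<lambda>x. f' x * g x"]) (auto dest: L2_measurable)
      then have "(LBINT x. f' (x + t *\<^sub>R b) * g x) - P
          = (LBINT x. f' (x + t *\<^sub>R b) * (g x - g (x + t *\<^sub>R b)))"
        using L2_mult_integrable[OF tr[OF f', of t] g] L2_mult_integrable[OF tr[OF f', of t] tr[OF g, of t]]
        by (simp add: right_diff_distrib)
      also have "cmod \<dots> \<le> norm_L2 f' * norm_L2 (\<lambda>x. g x - g (x + t *\<^sub>R b))"
        using L2_inner_bound[OF tr[OF f', of t] L2_diff[OF g tr[OF g, of t]]] norm_L2_translate[OF f'] by simp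
      also have "\<dots> \<le> norm_L2 f' * (t * norm_L2 g')"
        using weak_partial_increment_norm[OF wg b t(1) g g']
        by (intro mult_left_mono) (simp_all add: norm_L2_minus[of g] norm_L2_nonneg)
      also have "\<dots> \<le> h * C"
        using t norm_L2_nonneg[of f'] norm_L2_nonneg[of g'] by (simp add: C_def mult_ac mult_right_mono)
      finally show "cmod ((LBINT x. f' (x + t *\<^sub>R b) * g x) - P) \<le> h * C" .
    qed
    then have 1: "cmod (A - h *\<^sub>R P) \<le> h * (h * C)"
      by (simp add: A_def weak_partial_increment_L2(1)[OF wf b h0 f' g])
    note fh = tr[OF f, of h]
    have "cmod ((LINT t:{0..h}|lborel. LBINT x. g' (x + t *\<^sub>R b) * f (x + h *\<^sub>R b)) - h *\<^sub>R Q) \<le> h * (h * C)"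
    proof (rule seg_integral_estimate[OF weak_partial_increment_L2(2)[OF wg b h0 g' fh] h0])
      fix t assume t: "0 \<le> t" "t \<le> h"
      have "Q = (LBINT x. g' (x + t *\<^sub>R b) * f (x + t *\<^sub>R b))"
        unfolding Q_def using f g'
        by (subst shift_integral[of "\<lambda>x. g' x * f x"]) (auto dest: L2_measurable)
      then have "(LBINT x. g' (x + t *\<^sub>R b) * f (x + h *\<^sub>R b)) - Q
          = (LBINT x. g' (x + t *\<^sub>R b) * (f (x + h *\<^sub>R b) - f (x + t *\<^sub>R b)))"
        using L2_mult_integrable[OF tr[OF g', of t] fh] L2_mult_integrable[OF tr[OF g', of t] tr[OF f, of t]]
        by (simp add: right_diff_distrib)
      also have "cmod \<dots> \<le> norm_L2 g' * norm_L2 (\<lambda>x. f (x + h *\<^sub>R b) - f (x + t *\<^sub>R b))"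
        using L2_inner_bound[OF tr[OF g', of t] L2_diff[OF fh tr[OF f, of t]]] norm_L2_translate[OF g'] by simp
      also have "norm_L2 (\<lambda>x. f (x + h *\<^sub>R b) - f (x + t *\<^sub>R b)) = norm_L2 (\<lambda>x. f (x + (h - t) *\<^sub>R b) - f x)"
      proof -
        have "(\<lambda>x. f (x + h *\<^sub>R b) - f (x + t *\<^sub>R b))
            = (\<lambda>x. (\<lambda>y. f (y + (h - t) *\<^sub>R b) - f y) (x + t *\<^sub>R b))"
          by (simp add: algebra_simps)
        then show ?thesis
          using norm_L2_translate[OF L2_diff[OF tr[OF f, of "h - t"] f], of "t *\<^sub>R b"] by simp
      qed
      also have "norm_L2 g' * \<dots> \<le> norm_L2 g' * ((h - t) * norm_L2 f')"
        using weak_partial_increment_norm[OF wf b _ f f', of "h - t"] t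
        by (intro mult_left_mono) (simp_all add: norm_L2_nonneg)
      also have "\<dots> = (h - t) * C" by (simp add: C_def)
      also have "\<dots> \<le> h * C"
        using t by (intro mult_right_mono) (auto simp: C_def norm_L2_nonneg)
      finally show "cmod ((LBINT x. g' (x + t *\<^sub>R b) * f (x + h *\<^sub>R b)) - Q) \<le> h * C" .
    qed
    \<comment> \<open>The integral of \<open>f x * g x\<close> may be evaluated at
      \<open>x + h *\<^sub>R b\<close> instead; this exchange puts the increment on
      \<open>g\<close>.\<close>
    moreover have "A = - (LBINT x. (g (x + h *\<^sub>R b) - g x) * f (x + h *\<^sub>R b))"
    proof -
      have "(LBINT x. f x * g x) = (LBINT x. f (x + h *\<^sub>R b) * g (x + h *\<^sub>R b))"
        using f g by (subst shift_integral[of "\<lambda>x. f x * g x"]) (auto dest: L2_measurable)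
      then show ?thesis unfolding A_def
        using L2_mult_integrable[OF fh g] L2_mult_integrable[OF f g] L2_mult_integrable[OF fh tr[OF g, of h]]
        by (simp add: left_diff_distrib mult.commute[of "g _"])
    qed
    ultimately have 2: "cmod (- A - h *\<^sub>R Q) \<le> h * (h * C)"
      by (simp add: weak_partial_increment_L2(1)[OF wg b h0 g' fh])
    \<comment> \<open>\<open>A\<close> enters the two expansions with opposite signs and
      cancels.\<close>
    have "h * cmod (P + Q) = cmod ((A - h *\<^sub>R P) + (- A - h *\<^sub>R Q))"
    proof -
      have "(A - h *\<^sub>R P) + (- A - h *\<^sub>R Q) = - (h *\<^sub>R (P + Q))" by (simp add: scaleR_add_right)
      then show ?thesis using h by (simp only: norm_minus_cancel norm_scaleR)
    qed
    also have "\<dots> \<le> h * (h * C) + h * (h * C)" by (rule order_trans[OF norm_triangle_ineq add_mono[OF 1 2]])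
    finally have "h * cmod (P + Q) \<le> h * (2 * h * C)" by (simp add: mult_ac)
    then show ?thesis using h by simp
  qed
  have "cmod (P + Q) \<le> 0"
  proof (rule tendsto_lowerbound)
    show "((\<lambda>h. 2 * h * C) \<longlongrightarrow> 0) (at_right 0)" by (auto intro!: tendsto_eq_intros)
    show "\<forall>\<^sub>F h in at_right 0. cmod (P + Q) \<le> 2 * h * C"
      using est by (auto simp: eventually_at_filter)
  qed simp
  then have "P + Q = 0" by simp
  then show ?thesis by (simp add: P_def Q_def eq_neg_iff_add_eq_0)
qed

subsection \<open>Local compactness\<close>

text \<open>The shift is made one coordinate at a time and each leg costs at most
  \<open>e * M\<close>. Coordinates are nonnegative because increments are controlled for steps
  \<open>h \<ge> 0\<close>; the induction is over the set of coordinates already shifted.\<close>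

lemma L2_shift_norm:
  fixes f :: "'a::euclidean_space \<Rightarrow> complex" and y :: 'a
  assumes f: "f \<in> L2"
    and w: "\<And>b. b \<in> Basis \<Longrightarrow> \<exists>g\<in>L2. is_weak_partial b f g \<and> norm_L2 g \<le> M"
    and y: "\<And>b. b \<in> Basis \<Longrightarrow> 0 \<le> y \<bullet> b \<and> y \<bullet> b \<le> e"
  shows "norm_L2 (\<lambda>x. f (x + y) - f x) \<le> real DIM('a) * (e * M)"
proof -
  have "norm_L2 (\<lambda>x. f (x + (\<Sum>b\<in>S. (y \<bullet> b) *\<^sub>R b)) - f x) \<le> real (card S) * (e * M)"
    if "S \<subseteq> Basis" for S :: "'a set"
    using finite_subset[OF that finite_Basis] that
  proof (induction S rule: finite_induct)
    case empty then show ?case by (simp add: norm_L2_def)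
  next
    case (insert b S)
    define z where "z = (\<Sum>b\<in>S. (y \<bullet> b) *\<^sub>R b)"
    define t where "t = y \<bullet> b"
    have b: "b \<in> Basis" using insert.prems by simp
    have t: "0 \<le> t" "t \<le> e" using y[OF b] by (auto simp: t_def)
    obtain g where g: "g \<in> L2" "is_weak_partial b f g" "norm_L2 g \<le> M" using w[OF b] by blast
    have D: "(\<lambda>x. f (x + t *\<^sub>R b) - f x) \<in> L2" by (intro L2_diff L2_translate f)
    have eq: "(\<lambda>x. f (x + (t *\<^sub>R b + z)) - f x) =
        (\<lambda>x. (f ((x + z) + t *\<^sub>R b) - f (x + z)) + (f (x + z) - f x))"
      by (simp add: algebra_simps)
    have "norm_L2 (\<lambda>x. f (x + (t *\<^sub>R b + z)) - f x)
        \<le> norm_L2 (\<lambda>x. f ((x + z) + t *\<^sub>R b) - f (x + z)) + norm_L2 (\<lambda>x. f (x + z) - f x)"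
      unfolding eq
      by (rule norm_L2_triangle[OF L2_translate[OF D] L2_diff[OF L2_translate[OF f] f]])
    also have "norm_L2 (\<lambda>x. f ((x + z) + t *\<^sub>R b) - f (x + z)) = norm_L2 (\<lambda>x. f (x + t *\<^sub>R b) - f x)"
      by (rule norm_L2_translate[OF D])
    also have "\<dots> \<le> t * norm_L2 g" by (rule weak_partial_increment_norm[OF g(2) b t(1) f g(1)])
    also have "\<dots> \<le> e * M" using t g(3) norm_L2_nonneg[of g] by (intro mult_mono) auto
    also have "norm_L2 (\<lambda>x. f (x + z) - f x) \<le> real (card S) * (e * M)"
      using insert by (simp add: z_def)
    finally show ?case using insert.hyps by (simp add: z_def t_def algebra_simps)
  qed
  from this[of Basis] show ?thesis by (simp add: euclidean_representation)
qed

definition box_average :: "'a::euclidean_space set \<Rightarrow> ('a \<Rightarrow> complex) \<Rightarrow> 'a \<Rightarrow> complex" where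
  "box_average Q f x = (LINT y:Q|lborel. f (x + y)) / measure lborel Q"

text \<open>By Jensen's inequality the squared deviation from the average is at most the average of
  \<open>(cmod (f (x + y) - f x))\<^sup>2\<close> over \<open>y\<close> in \<open>Q\<close>; after
  exchanging integrals each \<open>y\<close> contributes a squared shift norm. The nonnegative
  integral makes the bound a proof of integrability as well.\<close>

lemma box_average_diff:
  fixes f :: "'a::euclidean_space \<Rightarrow> complex"
  assumes f: "f \<in> L2" and Q: "compact Q" "0 < measure lborel Q" and e: "0 \<le> e"
    and sh: "\<And>y. y \<in> Q \<Longrightarrow> norm_L2 (\<lambda>x. f (x + y) - f x) \<le> e"
  shows "(\<integral>\<^sup>+x. ennreal ((cmod (f x - box_average Q f x))\<^sup>2) \<partial>lborel) \<le> ennreal (e\<^sup>2)"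
proof -
  have [measurable]: "f \<in> borel_measurable borel" by (rule L2_measurable[OF f])
  have [measurable]: "Q \<in> sets borel" using Q(1) by (rule borel_compact)
  define m where "m = measure lborel Q"
  have m: "0 < m" using Q(2) by (simp add: m_def)
  have IQ: "(\<lambda>y. complex_of_real (indicator Q y)) \<in> L2" by (rule L2_indicator_compact[OF Q(1)])
  have nIQ: "(norm_L2 (\<lambda>y. complex_of_real (indicat_real Q y)))\<^sup>2 = m"
  proof -
    have "(norm_L2 (\<lambda>y. complex_of_real (indicat_real Q y)))\<^sup>2 = (LBINT y. indicat_real Q y)"
      unfolding norm_L2_sq by (intro Bochner_Integration.integral_cong) (auto simp: indicator_def)
    then show ?thesis by (simp add: m_def)
  qed
  \<comment> \<open>Jensen's inequality, obtained from Cauchy-Schwarz against the indicator of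
    \<open>Q\<close>, whose squared norm is \<open>m\<close>.\<close>
  have pt: "ennreal ((cmod (f x - box_average Q f x))\<^sup>2)
      \<le> (\<integral>\<^sup>+y. ennreal (indicator Q y * (cmod (f (x + y) - f x))\<^sup>2 / m) \<partial>lborel)" for x
  proof -
    define d where "d y = complex_of_real (indicator Q y) * (f (x + y) - f x)" for y
    have fy: "(\<lambda>y. f (x + y)) \<in> L2" using L2_translate[OF f, of x] by (simp add: add.commute)
    have d2: "d = (\<lambda>y. complex_of_real (indicator Q y) * f (x + y) - f x * complex_of_real (indicator Q y))"
      by (auto simp: d_def algebra_simps)
    have dL: "d \<in> L2"
      unfolding d2 by (intro L2_diff L2_cmult IQ L2_bounded_mult[OF _ _ fy, where M=1]) (auto simp: indicator_def)
    have sI: "set_integrable lborel Q (\<lambda>y. f (x + y))"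
      using L2_mult_integrable[OF IQ fy] by (simp add: set_integrable_def scaleR_conv_of_real)
    have sc: "set_integrable lborel Q (\<lambda>y. f x)"
      unfolding set_integrable_def by (rule borel_integrable_compact[OF Q(1)]) simp
    have "(LBINT y. d y * complex_of_real (indicator Q y)) = (LINT y:Q|lborel. f (x + y) - f x)"
      unfolding set_lebesgue_integral_def d_def
      by (intro Bochner_Integration.integral_cong) (auto simp: indicator_def)
    also have "\<dots> = m * (box_average Q f x - f x)"
      unfolding set_integral_diff(2)[OF sI sc] box_average_def
      using m emeasure_compact_finite[OF Q(1)]
      by (subst set_integral_const) (auto simp: m_def[symmetric] field_simps scaleR_conv_of_real)
    finally have "m * cmod (f x - box_average Q f x) = cmod (LBINT y. d y * complex_of_real (indicator Q y))"
      using m by (simp add: norm_mult norm_minus_commute)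
    also have "\<dots> \<le> norm_L2 d * norm_L2 (\<lambda>y. complex_of_real (indicat_real Q y))"
      by (rule L2_inner_bound[OF dL IQ])
    finally have "(m * cmod (f x - box_average Q f x))\<^sup>2 \<le> (norm_L2 d * norm_L2 (\<lambda>y. complex_of_real (indicat_real Q y)))\<^sup>2"
      using m by (intro power_mono) auto
    then have "m * (m * (cmod (f x - box_average Q f x))\<^sup>2) \<le> m * (norm_L2 d)\<^sup>2"
      unfolding power_mult_distrib nIQ by (simp add: power2_eq_square mult_ac)
    then have "(cmod (f x - box_average Q f x))\<^sup>2 \<le> (LBINT y. (cmod (d y))\<^sup>2 / m)"
      using m by (simp add: norm_L2_sq field_simps)
    also have "\<dots> = (LBINT y. indicator Q y * (cmod (f (x + y) - f x))\<^sup>2 / m)"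
      by (intro Bochner_Integration.integral_cong) (auto simp: d_def indicator_def)
    finally have "ennreal ((cmod (f x - box_average Q f x))\<^sup>2)
        \<le> ennreal (LBINT y. indicator Q y * (cmod (f (x + y) - f x))\<^sup>2 / m)" by (rule ennreal_leI)
    also have "\<dots> = (\<integral>\<^sup>+y. ennreal (indicator Q y * (cmod (f (x + y) - f x))\<^sup>2 / m) \<partial>lborel)"
    proof (rule nn_integral_eq_integral[symmetric])
      have "integrable lborel (\<lambda>y. (cmod (d y))\<^sup>2 / m)" using L2_integrable[OF dL] by simp
      moreover have "(\<lambda>y. (cmod (d y))\<^sup>2 / m) = (\<lambda>y. indicator Q y * (cmod (f (x + y) - f x))\<^sup>2 / m)"
        by (auto simp: d_def indicator_def)
      ultimately show "integrable lborel (\<lambda>y. indicator Q y * (cmod (f (x + y) - f x))\<^sup>2 / m)" by simp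
    qed (use m in auto)
    finally show ?thesis .
  qed
  have "(\<integral>\<^sup>+x. ennreal ((cmod (f x - box_average Q f x))\<^sup>2) \<partial>lborel)
      \<le> (\<integral>\<^sup>+x. \<integral>\<^sup>+y. ennreal (indicator Q y * (cmod (f (x + y) - f x))\<^sup>2 / m) \<partial>lborel \<partial>lborel)"
    by (intro nn_integral_mono pt)
  also have "\<dots> = (\<integral>\<^sup>+y. \<integral>\<^sup>+x. ennreal (indicator Q y * (cmod (f (x + y) - f x))\<^sup>2 / m) \<partial>lborel \<partial>lborel)"
    by (rule lborel_pair.Fubini'[symmetric]) measurable
  also have "\<dots> \<le> (\<integral>\<^sup>+y. ennreal (indicator Q y * (e\<^sup>2 / m)) \<partial>lborel)"
  proof (rule nn_integral_mono)
    fix y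
    show "(\<integral>\<^sup>+x. ennreal (indicator Q y * (cmod (f (x + y) - f x))\<^sup>2 / m) \<partial>lborel)
        \<le> ennreal (indicator Q y * (e\<^sup>2 / m))"
    proof (cases "y \<in> Q")
      case True
      have i: "integrable lborel (\<lambda>x. (cmod (f (x + y) - f x))\<^sup>2 / m)"
        using L2_integrable[OF L2_diff[OF L2_translate[OF f] f]] by simp
      have "(norm_L2 (\<lambda>x. f (x + y) - f x))\<^sup>2 \<le> e\<^sup>2"
        using sh[OF True] norm_L2_nonneg by (intro power_mono)
      then have "(LBINT x. (cmod (f (x + y) - f x))\<^sup>2 / m) \<le> e\<^sup>2 / m"
        using m by (simp add: norm_L2_sq divide_right_mono)
      then show ?thesis using True m nn_integral_eq_integral[OF i] by (simp add: ennreal_leI)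
    qed simp
  qed
  also have "\<dots> = ennreal (LBINT y. indicator Q y * (e\<^sup>2 / m))"
  proof (rule nn_integral_eq_integral)
    have "integrable lborel (\<lambda>y. indicator Q y *\<^sub>R (e\<^sup>2 / m))"
      by (rule borel_integrable_compact[OF Q(1)]) simp
    then show "integrable lborel (\<lambda>y. indicator Q y * (e\<^sup>2 / m))" by simp
  qed (use m in auto)
  also have "(LBINT y. indicator Q y * (e\<^sup>2 / m)) = e\<^sup>2" using m by (simp add: m_def)
  finally show ?thesis .
qed

text \<open>The average at \<open>x\<close> is a pairing of \<open>\<phi> n\<close> with the fixed
  L2 function given by the indicator of \<open>Q\<close> translated to \<open>x\<close>. So it tends
  to 0 at every \<open>x\<close> by weak convergence, while Cauchy-Schwarz bounds it uniformly in
  \<open>x\<close> and \<open>n\<close>; dominated convergence on \<open>K\<close> finishes.\<close>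

lemma box_average_null:
  fixes \<phi> :: "nat \<Rightarrow> 'a::euclidean_space \<Rightarrow> complex"
  assumes \<phi>: "\<And>n. \<phi> n \<in> L2" and n1: "\<And>n. norm_L2 (\<phi> n) \<le> M" and wk: "weakly_null_L2 \<phi>"
    and Q: "compact Q" and K: "compact K"
  shows "(\<lambda>n. LBINT x. indicator K x * (cmod (box_average Q (\<phi> n) x))\<^sup>2) \<longlonglongrightarrow> 0"
proof -
  have [measurable]: "\<phi> n \<in> borel_measurable borel" for n by (rule L2_measurable[OF \<phi>])
  have [measurable]: "Q \<in> sets borel" "K \<in> sets borel" using Q K by (auto intro: borel_compact)
  define c where "c = M * norm_L2 (\<lambda>y. complex_of_real (indicat_real Q y)) / measure lborel Q"
  have IQ: "(\<lambda>y. complex_of_real (indicator Q y)) \<in> L2" by (rule L2_indicator_compact[OF Q])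
  have eq: "box_average Q (\<phi> n) x = (LBINT y. \<phi> n y * complex_of_real (indicator Q (y - x))) / measure lborel Q" for n x
  proof -
    have "(LINT y:Q|lborel. \<phi> n (x + y)) = (LBINT y. \<phi> n (y + x) * complex_of_real (indicator Q (y + x - x)))"
      by (simp add: set_lebesgue_integral_def scaleR_conv_of_real mult.commute add.commute)
    also have "\<dots> = (LBINT y. \<phi> n y * complex_of_real (indicator Q (y - x)))"
      by (rule shift_integral[of "\<lambda>y. \<phi> n y * complex_of_real (indicator Q (y - x))"]) measurable
    finally show ?thesis by (simp add: box_average_def)
  qed
  have IQx: "(\<lambda>y. complex_of_real (indicator Q (y - x))) \<in> L2" for x
    using L2_translate[OF IQ, of "- x"] by simp
  have bd: "cmod (box_average Q (\<phi> n) x) \<le> c" for n x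
  proof -
    have "cmod (LBINT y. \<phi> n y * complex_of_real (indicator Q (y - x)))
        \<le> norm_L2 (\<phi> n) * norm_L2 (\<lambda>y. complex_of_real (indicator Q (y - x)))"
      by (rule L2_inner_bound[OF \<phi> IQx])
    also have "norm_L2 (\<lambda>y. complex_of_real (indicator Q (y - x))) = norm_L2 (\<lambda>y. complex_of_real (indicat_real Q y))"
      using norm_L2_translate[OF IQ, of "- x"] by simp
    also have "norm_L2 (\<phi> n) * \<dots> \<le> M * \<dots>" using n1 by (intro mult_right_mono) (auto simp: norm_L2_nonneg)
    finally show ?thesis by (simp add: eq c_def norm_divide divide_right_mono)
  qed
  have lim: "(\<lambda>n. box_average Q (\<phi> n) x) \<longlonglongrightarrow> 0" for x
  proof -
    have "(\<lambda>n. LBINT y. \<phi> n y * cnj (complex_of_real (indicator Q (y - x)))) \<longlonglongrightarrow> 0"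
      by (rule wk[unfolded weakly_null_L2_def, rule_format, OF IQx])
    then show ?thesis unfolding eq by (auto intro!: tendsto_divide_zero)
  qed
  have "(\<lambda>n. LBINT x. indicator K x * (cmod (box_average Q (\<phi> n) x))\<^sup>2) \<longlonglongrightarrow> (LBINT x::'a. 0)"
  proof (rule integral_dominated_convergence)
    have "integrable lborel (\<lambda>x. indicator K x *\<^sub>R c\<^sup>2)"
      by (rule borel_integrable_compact[OF K]) simp
    then show "integrable lborel (\<lambda>x. indicator K x * c\<^sup>2)" by simp
    show "(\<lambda>x. indicator K x * (cmod (box_average Q (\<phi> n) x))\<^sup>2) \<in> borel_measurable lborel" for n
      unfolding box_average_def set_lebesgue_integral_def by measurable
    show "AE x in lborel. (\<lambda>n. indicator K x * (cmod (box_average Q (\<phi> n) x))\<^sup>2) \<longlonglongrightarrow> 0"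
    proof (intro AE_I2)
      fix x
      have "(\<lambda>n. indicator K x * (cmod (box_average Q (\<phi> n) x))\<^sup>2) \<longlonglongrightarrow> indicator K x * (cmod 0)\<^sup>2"
        by (intro tendsto_intros lim)
      then show "(\<lambda>n. indicator K x * (cmod (box_average Q (\<phi> n) x))\<^sup>2) \<longlonglongrightarrow> 0" by simp
    qed
    show "AE x in lborel. norm (indicator K x * (cmod (box_average Q (\<phi> n) x))\<^sup>2) \<le> indicator K x * c\<^sup>2" for n
      using bd by (intro AE_I2) (auto simp: indicator_def intro!: power_mono)
  qed simp
  then show ?thesis by simp
qed

text \<open>This takes the role of the Rellich compactness theorem. The distance to the averages
  over a small cube is small uniformly in \<open>n\<close>, because the gradients are bounded; for
  this fixed cube the averages tend to 0 on \<open>K\<close>.\<close>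

lemma weakly_null_local_L2:
  fixes \<phi> :: "nat \<Rightarrow> 'a::euclidean_space \<Rightarrow> complex"
  assumes \<phi>: "\<And>n. \<phi> n \<in> L2" and n1: "\<And>n. norm_L2 (\<phi> n) \<le> M" and wk: "weakly_null_L2 \<phi>"
    and w: "\<And>n b. b \<in> Basis \<Longrightarrow> \<exists>g\<in>L2. is_weak_partial b (\<phi> n) g \<and> norm_L2 g \<le> M'"
    and K: "compact K"
  shows "(\<lambda>n. LBINT x. indicator K x * (cmod (\<phi> n x))\<^sup>2) \<longlonglongrightarrow> 0"
proof (rule LIMSEQ_I)
  fix r :: real assume r: "0 < r"
  have [measurable]: "\<phi> n \<in> borel_measurable borel" for n by (rule L2_measurable[OF \<phi>])
  have [measurable]: "K \<in> sets borel" using K by (rule borel_compact)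
  define N where "N = real DIM('a)"
  \<comment> \<open>Any index and any basis vector will do for the sign of
    \<open>M'\<close>.\<close>
  have M': "0 \<le> M'"
    using w[OF SOME_Basis, of undefined] norm_L2_nonneg order_trans by blast
  \<comment> \<open>Chosen so that the squared distance to the averages is at most
    \<open>r / 8\<close>; the two terms, each doubled by
    \<open>(a + b)\<^sup>2 \<le> 2 a\<^sup>2 + 2 b\<^sup>2\<close>, then stay below
    \<open>r\<close>. The \<open>+ 1\<close> guards against \<open>M' = 0\<close>.\<close>
  define e where "e = sqrt (r / 8) / (N * (M' + 1))"
  have N: "0 < N" by (simp add: N_def)
  have e: "0 < e" using r M' N by (simp add: e_def)
  define d where "d = N * (e * M')"
  have d0: "0 \<le> d" using N e M' by (simp add: d_def)
  have "d \<le> N * (e * (M' + 1))" using N e by (simp add: d_def)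
  also have "\<dots> = (N * (M' + 1)) * sqrt (r / 8) / (N * (M' + 1))" by (simp add: e_def)
  also have "\<dots> = sqrt (r / 8)" using N M' by (intro nonzero_mult_div_cancel_left) simp
  finally have d: "d\<^sup>2 \<le> r / 8" using d0 r by (metis less_eq_real_def real_sqrt_le_iff real_sqrt_unique sqrt_le_D)
  \<comment> \<open>The cube has its lower corner at the origin, as \<open>L2_shift_norm\<close>
    takes shifts with nonnegative coordinates.\<close>
  define Q :: "'a set" where "Q = cbox 0 (e *\<^sub>R One)"
  have Q: "compact Q" by (simp add: Q_def)
  have mQ: "0 < measure lborel Q" using e by (simp add: Q_def measure_lborel_cbox_eq prod_pos)
  have diff: "(\<integral>\<^sup>+x. ennreal ((cmod (\<phi> n x - box_average Q (\<phi> n) x))\<^sup>2) \<partial>lborel) \<le> ennreal (d\<^sup>2)" for n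
  proof (rule box_average_diff[OF \<phi> Q mQ d0])
    fix y assume "y \<in> Q"
    then show "norm_L2 (\<lambda>x. \<phi> n (x + y) - \<phi> n x) \<le> d"
      unfolding d_def N_def by (intro L2_shift_norm[OF \<phi> w]) (auto simp: Q_def mem_box)
  qed
  from LIMSEQ_D[OF box_average_null[OF \<phi> n1 wk Q K], of "r / 8"] r
  obtain n0 where n0: "\<And>n. n \<ge> n0 \<Longrightarrow> (LBINT x. indicator K x * (cmod (box_average Q (\<phi> n) x))\<^sup>2) < r / 8"
    by (auto simp: abs_less_iff)
  have "norm ((LBINT x. indicator K x * (cmod (\<phi> n x))\<^sup>2) - 0) < r" if n: "n \<ge> n0" for n
  proof -
    have [measurable]: "box_average Q (\<phi> n) \<in> borel_measurable borel"
      using borel_compact[OF Q] unfolding box_average_def[abs_def] set_lebesgue_integral_def by measurable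
    have iD: "integrable lborel (\<lambda>x. (cmod (\<phi> n x - box_average Q (\<phi> n) x))\<^sup>2)"
      using diff[of n] by (intro integrableI_nonneg) (auto simp: le_less_trans)
    have "ennreal (LBINT x. (cmod (\<phi> n x - box_average Q (\<phi> n) x))\<^sup>2) \<le> ennreal (d\<^sup>2)"
      using diff[of n] nn_integral_eq_integral[OF iD] by simp
    then have D: "(LBINT x. (cmod (\<phi> n x - box_average Q (\<phi> n) x))\<^sup>2) \<le> r / 8"
      using d by (simp add: ennreal_le_iff)
    have pt: "indicator K x * (cmod (\<phi> n x))\<^sup>2 \<le> 2 * (cmod (\<phi> n x - box_average Q (\<phi> n) x))\<^sup>2
        + 2 * (indicator K x * (cmod (box_average Q (\<phi> n) x))\<^sup>2)" for x
    proof (cases "x \<in> K")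
      case True
      have "cmod (\<phi> n x) \<le> cmod (\<phi> n x - box_average Q (\<phi> n) x) + cmod (box_average Q (\<phi> n) x)"
        using norm_triangle_sub by (metis add.commute)
      then have "(cmod (\<phi> n x))\<^sup>2 \<le> (cmod (\<phi> n x - box_average Q (\<phi> n) x) + cmod (box_average Q (\<phi> n) x))\<^sup>2"
        by (intro power_mono) auto
      also have "\<dots> \<le> 2 * (cmod (\<phi> n x - box_average Q (\<phi> n) x))\<^sup>2 + 2 * (cmod (box_average Q (\<phi> n) x))\<^sup>2"
        using zero_le_power2[of "cmod (\<phi> n x - box_average Q (\<phi> n) x) - cmod (box_average Q (\<phi> n) x)"]
        unfolding power2_sum power2_diff by linarith
      finally show ?thesis using True by simp
    qed simp
    have i1: "integrable lborel (\<lambda>x. indicator K x * (cmod (\<phi> n x))\<^sup>2)"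
      by (rule Bochner_Integration.integrable_bound[OF L2_integrable[OF \<phi>[of n]]]) (auto simp: indicator_def)
    have i2: "integrable lborel (\<lambda>x. indicator K x * (cmod (box_average Q (\<phi> n) x))\<^sup>2)"
    proof -
      have i: "integrable lborel (\<lambda>x. 2 * (cmod (\<phi> n x - box_average Q (\<phi> n) x))\<^sup>2 + 2 * (cmod (\<phi> n x))\<^sup>2)"
        using iD L2_integrable[OF \<phi>[of n]] by simp
      show ?thesis
      proof (rule Bochner_Integration.integrable_bound[OF i])
        have "(cmod (box_average Q (\<phi> n) x))\<^sup>2 \<le> 2 * (cmod (\<phi> n x - box_average Q (\<phi> n) x))\<^sup>2 + 2 * (cmod (\<phi> n x))\<^sup>2" for x
        proof -
          have "cmod (box_average Q (\<phi> n) x) \<le> cmod (\<phi> n x - box_average Q (\<phi> n) x) + cmod (\<phi> n x)"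
            using norm_triangle_sub by (metis add.commute norm_minus_commute)
          then have "(cmod (box_average Q (\<phi> n) x))\<^sup>2 \<le> (cmod (\<phi> n x - box_average Q (\<phi> n) x) + cmod (\<phi> n x))\<^sup>2"
            by (intro power_mono) auto
          also have "\<dots> \<le> 2 * (cmod (\<phi> n x - box_average Q (\<phi> n) x))\<^sup>2 + 2 * (cmod (\<phi> n x))\<^sup>2"
            using zero_le_power2[of "cmod (\<phi> n x - box_average Q (\<phi> n) x) - cmod (\<phi> n x)"]
            unfolding power2_sum power2_diff by linarith
          finally show ?thesis .
        qed
        then show "AE x in lborel. norm (indicator K x * (cmod (box_average Q (\<phi> n) x))\<^sup>2)
            \<le> norm (2 * (cmod (\<phi> n x - box_average Q (\<phi> n) x))\<^sup>2 + 2 * (cmod (\<phi> n x))\<^sup>2)"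
          by (intro AE_I2) (auto simp: indicator_def)
      qed measurable
    qed
    have "(LBINT x. indicator K x * (cmod (\<phi> n x))\<^sup>2) \<le>
      (LBINT x. 2 * (cmod (\<phi> n x - box_average Q (\<phi> n) x))\<^sup>2
        + 2 * (indicator K x * (cmod (box_average Q (\<phi> n) x))\<^sup>2))"
      by (rule integral_mono[OF i1 _ pt]) (use iD i2 in simp)
    also have "\<dots> = 2 * (LBINT x. (cmod (\<phi> n x - box_average Q (\<phi> n) x))\<^sup>2)
        + 2 * (LBINT x. indicator K x * (cmod (box_average Q (\<phi> n) x))\<^sup>2)"
      using iD i2 by simp
    also have "\<dots> < r" using D n0[OF n] r by simp
    finally show ?thesis by simp
  qed
  then show "\<exists>n0. \<forall>n\<ge>n0. norm ((LBINT x. indicator K x * (cmod (\<phi> n x))\<^sup>2) - 0) < r" by blast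
qed

subsection \<open>Decay of the profile\<close>

lemma partial_of_real:
  "f differentiable (at x) \<Longrightarrow> partial b (\<lambda>y. complex_of_real (f y)) x = complex_of_real (partial b f x)"
  by (rule partial_bounded_linear[OF bounded_linear_of_real])

lemma partial_of_real_smooth:
  "smooth f \<Longrightarrow> partial b (\<lambda>y. complex_of_real (f y)) = (\<lambda>x. complex_of_real (partial b f x))"
  by (intro ext partial_of_real smooth_differentiable)

lemma smooth_power2:
  fixes u :: "'a::euclidean_space \<Rightarrow> real"
  shows "smooth u \<Longrightarrow> smooth (\<lambda>x. (u x)\<^sup>2)"
  unfolding power2_eq_square by (intro smooth_mult)

lemma laplacian_power2:
  fixes u :: "'a::euclidean_space \<Rightarrow> real"
  assumes s: "smooth u"
  shows "laplacian (\<lambda>y. (u y)\<^sup>2) x = 2 * (\<Sum>b\<in>Basis. (partial b u x)\<^sup>2) + 2 * u x * laplacian u x"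
proof -
  have "partial b (partial b (\<lambda>y. (u y)\<^sup>2)) x = 2 * (partial b u x)\<^sup>2 + 2 * u x * partial b (partial b u) x"
    if b: "b \<in> Basis" for b
  proof -
    note sb = smooth_partial[OF s b]
    have 1: "partial b (\<lambda>y. (u y)\<^sup>2) = (\<lambda>x. partial b u x * u x + u x * partial b u x)"
      unfolding power2_eq_square by (intro ext partial_mult smooth_differentiable s)
    have d: "(\<lambda>x. partial b u x * u x) differentiable (at x)" "(\<lambda>x. u x * partial b u x) differentiable (at x)"
      by (intro smooth_differentiable smooth_mult s sb)+
    show ?thesis unfolding 1 partial_add[OF d]
      by (simp add: partial_mult smooth_differentiable[OF s] smooth_differentiable[OF sb] power2_eq_square)
  qed
  then show ?thesis
    by (simp add: laplacian_def sum.distrib sum_distrib_left)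
qed

lemma continuous_AE_zero:
  fixes F :: "'a::euclidean_space \<Rightarrow> complex"
  assumes c: "continuous_on UNIV F" and z: "AE x in lborel. F x = 0"
  shows "F x = 0"
proof (rule ccontr)
  assume x: "F x \<noteq> 0"
  have o: "open {x. F x \<noteq> 0}" by (rule open_Collect_neq) (use c in \<open>auto intro: continuous_intros\<close>)
  then have "{x. F x \<noteq> 0} \<in> sets lborel" by simp
  then have "{x. F x \<noteq> 0} \<in> null_sets lborel"
    using z by (subst (asm) AE_iff_null) (auto simp: Collect_neg_eq)
  then have "negligible {x. F x \<noteq> 0}"
    by (simp add: negligible_iff_null_sets null_sets_completionI)
  then show False using open_not_negligible[OF o] x by auto
qed

text \<open>For smooth \<open>u\<close> the weak derivatives are classical almost everywhere, and
  both gradient terms can be moved off the test function, the second one with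
  \<open>U x * \<psi> x\<close> as test function. What remains is a continuous \<open>F\<close>
  annihilated by all test functions; it vanishes almost everywhere, hence everywhere.\<close>

lemma smooth_solution_classical:
  fixes u :: "'a::euclidean_space \<Rightarrow> real"
  assumes sol: "is_solution \<omega> p (\<lambda>x. complex_of_real (u x))" and s: "smooth u" and pos: "\<And>x. 0 < u x"
  shows "laplacian u x + u x * laplacian (\<lambda>y. (u y)\<^sup>2) x = (\<omega> - u x powr (p - 1)) * u x"
proof -
  define U where "U x = complex_of_real (u x)" for x
  define U2 where "U2 x = complex_of_real ((u x)\<^sup>2)" for x
  define k where "k x = complex_of_real (\<omega> - u x powr (p - 1))" for x
  have sU: "smooth U" unfolding U_def[abs_def] by (rule smooth_of_real[OF s])
  have sU2: "smooth U2" unfolding U2_def[abs_def] by (rule smooth_of_real[OF smooth_power2[OF s]])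
  define F where "F x = - (\<Sum>b\<in>Basis. partial b (partial b U) x)
     - U x * (\<Sum>b\<in>Basis. partial b (partial b U2) x) + k x * U x" for x
  note ss = smooth_partial[OF smooth_partial]
  have ck: "continuous_on UNIV k" unfolding k_def
    by (intro continuous_intros smooth_continuous[OF s]) (use pos in \<open>force simp: less_le\<close>)
  have cF: "continuous_on UNIV F" unfolding F_def
    by (intro continuous_intros ck smooth_continuous sU) (auto intro: ss sU sU2)
  have weak: "Re (LBINT x. F x * \<psi> x) = 0" if \<psi>: "test_function \<psi>" for \<psi> :: "'a \<Rightarrow> complex"
  proof -
    \<comment> \<open>The equation conjugates its test function, so it is tested with the conjugate
      of \<open>\<psi>\<close>.\<close>
    note sol' = sol[unfolded is_solution_def, THEN conjunct2, rule_format, OF test_function_cnj[OF \<psi>]]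
    have s\<psi>: "smooth \<psi>" using \<psi> by (simp add: test_function_def)
    have U\<psi>: "test_function (\<lambda>x. U x * \<psi> x)" by (rule test_function_mult[OF sU \<psi>])
    have sU\<psi>: "smooth (\<lambda>x. U x * \<psi> x)" using U\<psi> by (simp add: test_function_def)
    have m: "cmod (U x) = u x" for x using pos[of x] by (simp add: U_def)
    define I1 where "I1 b x = partial b U x * partial b \<psi> x" for b x
    define I2 where "I2 b x = partial b U2 x * partial b (\<lambda>x. U x * \<psi> x) x" for b x
    define J1 where "J1 b x = partial b (partial b U) x * \<psi> x" for b x
    define J2 where "J2 b x = partial b (partial b U2) x * (U x * \<psi> x)" for b x
    have lc: "smooth f \<Longrightarrow> locally_integrable f" for f :: "'a \<Rightarrow> complex"
      by (intro continuous_locally_integrable smooth_continuous)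
    have iI1: "integrable lborel (I1 b)" if "b \<in> Basis" for b
      unfolding I1_def by (intro locint_cc_integrable lc test_function_cc test_function_partial \<psi> smooth_partial sU that)
    have iI2: "integrable lborel (I2 b)" if "b \<in> Basis" for b
      unfolding I2_def by (intro locint_cc_integrable lc test_function_cc test_function_partial U\<psi> smooth_partial sU2 that)
    have iJ1: "integrable lborel (J1 b)" if "b \<in> Basis" for b
      unfolding J1_def by (intro locint_cc_integrable lc test_function_cc \<psi> ss sU that)
    have iJ2: "integrable lborel (J2 b)" if "b \<in> Basis" for b
      unfolding J2_def by (intro locint_cc_integrable lc test_function_cc U\<psi> ss sU2 that)
    have iK: "integrable lborel (\<lambda>x. k x * (U x * \<psi> x))"
      by (intro locint_cc_integrable continuous_locally_integrable ck test_function_cc U\<psi>)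
    have e1: "(LBINT x. I1 b x) = - (LBINT x. J1 b x)" if b: "b \<in> Basis" for b
      unfolding I1_def J1_def
      by (rule is_weak_partialD[OF smooth_is_weak_partial[OF smooth_partial[OF sU b] b] \<psi>])
    have e2: "(LBINT x. I2 b x) = - (LBINT x. J2 b x)" if b: "b \<in> Basis" for b
      unfolding I2_def J2_def
      by (rule is_weak_partialD[OF smooth_is_weak_partial[OF smooth_partial[OF sU2 b] b] U\<psi>])
    have wpU: "AE x in lborel. \<forall>b\<in>Basis. weak_partial b U x = partial b U x"
      by (intro AE_finite_allI finite_Basis weak_partial_AE smooth_is_weak_partial sU)
    have wpU2: "AE x in lborel. \<forall>b\<in>Basis. weak_partial b U2 x = partial b U2 x"
      by (intro AE_finite_allI finite_Basis weak_partial_AE smooth_is_weak_partial sU2)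
    have wpU\<psi>: "AE x in lborel. \<forall>b\<in>Basis. weak_partial b (\<lambda>x. U x * \<psi> x) x = partial b (\<lambda>x. U x * \<psi> x) x"
      by (intro AE_finite_allI finite_Basis weak_partial_AE smooth_is_weak_partial sU\<psi>)
    have meas: "weak_partial b f \<in> borel_measurable lborel" if "smooth f" "b \<in> Basis" for f :: "'a \<Rightarrow> complex" and b
      using is_weak_partial_weak_partial[OF smooth_is_weak_partial[OF that]]
      by (simp add: is_weak_partial_def locally_integrable_def)
    have cm: "smooth f \<Longrightarrow> f \<in> borel_measurable lborel" for f :: "'a \<Rightarrow> complex"
      using borel_measurable_continuous_onI[OF smooth_continuous[of f]] by simp
    have "(LBINT x. (\<Sum>b\<in>Basis. weak_partial b U x * partial b \<psi> x)
        + (\<Sum>b\<in>Basis. weak_partial b U2 x * weak_partial b (\<lambda>x. U x * \<psi> x) x)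
        + complex_of_real \<omega> * U x * \<psi> x - complex_of_real (u x powr (p - 1)) * U x * \<psi> x)
      = (LBINT x. (\<Sum>b\<in>Basis. I1 b x) + (\<Sum>b\<in>Basis. I2 b x) + k x * (U x * \<psi> x))" (is "?L = ?R")
    proof (rule integral_cong_AE)
      have [measurable]: "u \<in> borel_measurable borel"
        by (rule borel_measurable_continuous_onI[OF smooth_continuous[OF s]])
      show "(\<lambda>x. (\<Sum>b\<in>Basis. weak_partial b U x * partial b \<psi> x)
        + (\<Sum>b\<in>Basis. weak_partial b U2 x * weak_partial b (\<lambda>x. U x * \<psi> x) x)
        + complex_of_real \<omega> * U x * \<psi> x - complex_of_real (u x powr (p - 1)) * U x * \<psi> x) \<in> borel_measurable lborel"
        by (intro borel_measurable_add borel_measurable_diff borel_measurable_sum borel_measurable_times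
              meas cm[OF s\<psi>] cm[OF sU] cm[OF smooth_partial[OF s\<psi>]] sU sU2 sU\<psi>) measurable
      show "(\<lambda>x. (\<Sum>b\<in>Basis. I1 b x) + (\<Sum>b\<in>Basis. I2 b x) + k x * (U x * \<psi> x)) \<in> borel_measurable lborel"
        by (intro borel_measurable_add borel_measurable_sum borel_measurable_integrable iI1 iI2 iK)
      show "AE x in lborel. (\<Sum>b\<in>Basis. weak_partial b U x * partial b \<psi> x)
        + (\<Sum>b\<in>Basis. weak_partial b U2 x * weak_partial b (\<lambda>x. U x * \<psi> x) x)
        + complex_of_real \<omega> * U x * \<psi> x - complex_of_real (u x powr (p - 1)) * U x * \<psi> x
        = (\<Sum>b\<in>Basis. I1 b x) + (\<Sum>b\<in>Basis. I2 b x) + k x * (U x * \<psi> x)"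
        using wpU wpU2 wpU\<psi>
        by eventually_elim (simp add: I1_def I2_def k_def algebra_simps)
    qed
    also have "?R = (\<Sum>b\<in>Basis. LBINT x. I1 b x) + (\<Sum>b\<in>Basis. LBINT x. I2 b x) + (LBINT x. k x * (U x * \<psi> x))"
      using iI1 iI2 iK by simp
    also have "\<dots> = - (\<Sum>b\<in>Basis. LBINT x. J1 b x) - (\<Sum>b\<in>Basis. LBINT x. J2 b x) + (LBINT x. k x * (U x * \<psi> x))"
      by (simp add: e1 e2 sum_negf)
    also have "\<dots> = (LBINT x. - (\<Sum>b\<in>Basis. J1 b x) - (\<Sum>b\<in>Basis. J2 b x) + k x * (U x * \<psi> x))"
      using iJ1 iJ2 iK by simp
    also have "\<dots> = (LBINT x. F x * \<psi> x)"
      by (intro Bochner_Integration.integral_cong)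
         (auto simp: J1_def J2_def F_def algebra_simps sum_distrib_left sum_distrib_right)
    finally have "?L = (LBINT x. F x * \<psi> x)" .
    then show ?thesis using sol'
      by (simp add: m U_def[symmetric] U2_def[symmetric] del: of_real_power)
  qed
  have "AE x in lborel. F x = 0"
  proof (rule locint_AE_zero[OF continuous_locally_integrable[OF cF]])
    fix \<psi> :: "'a \<Rightarrow> complex" assume \<psi>: "test_function \<psi>"
    \<comment> \<open>The equation controls real parts only; testing with
      \<open>\<i> * \<psi> x\<close> recovers the imaginary part.\<close>
    have "(LBINT x. F x * (\<i> * \<psi> x)) = \<i> * (LBINT x. F x * \<psi> x)"
      by (subst integral_mult_right_zero[symmetric]) (simp add: mult_ac)
    then show "(LBINT x. F x * \<psi> x) = 0"
      using weak[OF \<psi>] weak[OF test_function_mult[OF smooth_const \<psi>, of \<i>]] by (simp add: complex_eq_iff)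
  qed
  from continuous_AE_zero[OF cF this, of x] have "F x = 0" .
  moreover have "F x = complex_of_real (- laplacian u x - u x * laplacian (\<lambda>y. (u y)\<^sup>2) x + (\<omega> - u x powr (p - 1)) * u x)"
  proof -
    have "partial b (partial b U) x = complex_of_real (partial b (partial b u) x)" if "b \<in> Basis" for b
      unfolding U_def[abs_def]
      by (simp add: partial_of_real_smooth s smooth_partial[OF s that])
    moreover have "partial b (partial b U2) x = complex_of_real (partial b (partial b (\<lambda>y. (u y)\<^sup>2)) x)" if "b \<in> Basis" for b
      unfolding U2_def[abs_def]
      by (simp add: partial_of_real_smooth smooth_power2[OF s] smooth_partial[OF smooth_power2[OF s] that] del: of_real_power)
    ultimately show ?thesis by (simp add: F_def laplacian_def k_def U_def)
  qed
  ultimately show ?thesis by (simp only: of_real_eq_0_iff)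
qed

text \<open>If \<open>D\<close> were positive, \<open>g'\<close> would be positive just to the right
  of its zero at 0, and the mean value theorem would give a value above the maximum.\<close>

lemma second_derivative_max_nonpos:
  fixes g :: "real \<Rightarrow> real"
  assumes g: "\<And>t. (g has_real_derivative g' t) (at t)" and g': "(g' has_real_derivative D) (at 0)"
    and mx: "\<And>t. g t \<le> g 0"
  shows "g' 0 = 0" "D \<le> 0"
proof -
  show 0: "g' 0 = 0" by (rule DERIV_local_max[OF g, where d=1]) (use mx in auto)
  show "D \<le> 0"
  proof (rule ccontr)
    assume "\<not> D \<le> 0"
    then obtain d where d: "d > 0" "\<And>h. 0 < h \<Longrightarrow> h < d \<Longrightarrow> g' 0 < g' (0 + h)"
      using DERIV_pos_inc_right[OF g'] by auto
    obtain z where "z > 0" "z < d / 2" "g (d / 2) - g 0 = (d / 2 - 0) * g' z"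
      using MVT2[of 0 "d / 2" g g'] g d(1) by auto
    moreover have "g' z > 0" using d \<open>z > 0\<close> \<open>z < d / 2\<close> 0 by force
    ultimately have "g (d / 2) > g 0" using d(1) by (smt (verit) mult_pos_pos)
    then show False using mx[of "d / 2"] by simp
  qed
qed

lemma has_real_derivative_line:
  fixes u :: "'a::euclidean_space \<Rightarrow> real"
  assumes "u differentiable (at (a + t *\<^sub>R b))"
  shows "((\<lambda>t. u (a + t *\<^sub>R b)) has_real_derivative partial b u (a + t *\<^sub>R b)) (at t)"
proof -
  have *: "((\<lambda>t. a + t *\<^sub>R b) has_derivative (\<lambda>s. s *\<^sub>R b)) (at t)"
    by (auto intro!: derivative_eq_intros)
  note D = partial_has_derivative[OF assms]
  have "((\<lambda>t. u (a + t *\<^sub>R b)) has_derivative (\<lambda>s. partial (s *\<^sub>R b) u (a + t *\<^sub>R b))) (at t)"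
    by (rule has_derivative_compose[OF * D])
  moreover have "partial (s *\<^sub>R b) u (a + t *\<^sub>R b) = partial b u (a + t *\<^sub>R b) * s" for s
    using linear_scale[OF has_derivative_linear[OF D]] by simp
  ultimately show ?thesis by (simp add: has_field_derivative_def)
qed

text \<open>A function bounded below by \<open>e > 0\<close> cannot be square integrable over a
  space of infinite measure, so \<open>u\<close> drops below \<open>e\<close> at some point;
  monotonicity extends this to all points at least as far out.\<close>

lemma L2_decreasing_tendsto_0:
  fixes u :: "'a::euclidean_space \<Rightarrow> real"
  assumes L: "(\<lambda>x. complex_of_real (u x)) \<in> L2" and pos: "\<And>x. 0 < u x" and dec: "radially_decreasing u"
  shows "(u \<longlongrightarrow> 0) at_infinity"
  unfolding tendsto_iff eventually_at_infinity dist_real_def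
proof (intro allI impI)
  fix e :: real assume e: "0 < e"
  have "\<exists>y. u y < e"
  proof (rule ccontr)
    assume "\<not> (\<exists>y. u y < e)"
    then have ge: "e \<le> u y" for y by (auto simp: not_less)
    have "integrable lborel (\<lambda>x::'a. e\<^sup>2)"
    proof (rule Bochner_Integration.integrable_bound[OF L2_integrable[OF L]])
      show "AE x in lborel. norm (e\<^sup>2) \<le> norm ((cmod (complex_of_real (u x)))\<^sup>2)"
        using ge e by (intro AE_I2) (auto intro!: power_mono simp: abs_of_pos[OF pos])
    qed simp
    then show False using e by (simp add: integrable_iff_bounded emeasure_lborel_UNIV ennreal_mult_top)
  qed
  then obtain y where y: "u y < e" by blast
  then have "\<bar>u x - 0\<bar> < e" if "norm x \<ge> norm y" for x
    using dec[unfolded radially_decreasing_def, rule_format, OF that] pos[of x] by simp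
  then show "\<exists>b. \<forall>x. b \<le> norm x \<longrightarrow> \<bar>u x - 0\<bar> < e" by blast
qed

text \<open>Radiality gives \<open>u x = u (norm x *\<^sub>R e)\<close>, and the chain rule away
  from the origin produces the factor \<open>sgn x \<bullet> b\<close>, of modulus at most 1.
  Gradient decay is thus reduced to a single ray.\<close>

lemma radial_partial_bound:
  fixes u :: "'a::euclidean_space \<Rightarrow> real"
  assumes rad: "radial u" and s: "smooth u" and e: "e \<in> Basis" and b: "b \<in> Basis" and x: "x \<noteq> 0"
  shows "\<bar>partial b u x\<bar> \<le> \<bar>partial e u (norm x *\<^sub>R e)\<bar>"
proof -
  have u: "u = (\<lambda>x. u (norm x *\<^sub>R e))"
    using rad e by (fastforce simp: radial_def)
  have *: "((\<lambda>x. norm x *\<^sub>R e) has_derivative (\<lambda>h. (sgn x \<bullet> h) *\<^sub>R e)) (at x)"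
    by (rule has_derivative_scaleR_left) (use has_derivative_norm[OF x] in \<open>simp add: inner_commute\<close>)
  note D = partial_has_derivative[OF smooth_differentiable[OF s], of "norm x *\<^sub>R e"]
  have "((\<lambda>x. u (norm x *\<^sub>R e)) has_derivative (\<lambda>h. partial ((sgn x \<bullet> h) *\<^sub>R e) u (norm x *\<^sub>R e))) (at x)"
    by (rule has_derivative_compose[OF * D])
  then have "partial b u x = partial ((sgn x \<bullet> b) *\<^sub>R e) u (norm x *\<^sub>R e)"
    using u by (intro partial_eq) simp
  also have "\<dots> = (sgn x \<bullet> b) * partial e u (norm x *\<^sub>R e)"
    using linear_scale[OF has_derivative_linear[OF D]] by simp
  finally have "\<bar>partial b u x\<bar> = \<bar>sgn x \<bullet> b\<bar> * \<bar>partial e u (norm x *\<^sub>R e)\<bar>" by (simp add: abs_mult)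
  moreover have "\<bar>sgn x \<bullet> b\<bar> \<le> 1"
    using Cauchy_Schwarz_ineq2[of "sgn x" b] b x by (simp add: norm_sgn)
  ultimately show ?thesis by (simp add: mult_left_le_one_le)
qed

text \<open>A positive value of the monotone \<open>k\<close> would persist and make
  \<open>f\<close> increase, so \<open>k \<le> 0\<close>. If \<open>k\<close> stayed below
  \<open>- d\<close>, then \<open>f\<close> would fall at least linearly and become negative. Hence
  \<open>k\<close> enters the interval from \<open>- d\<close> to 0 and, being monotone, stays
  there; \<open>c \<ge> 1\<close> passes this on to \<open>f'\<close>.\<close>

lemma decreasing_derivative_tendsto_0:
  fixes f k f' :: "real \<Rightarrow> real"
  assumes f: "\<And>r. R \<le> r \<Longrightarrow> (f has_real_derivative f' r) (at r)"
    and k: "\<And>r s. R \<le> r \<Longrightarrow> r \<le> s \<Longrightarrow> k r \<le> k s"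
    and kf: "\<And>r. R \<le> r \<Longrightarrow> k r = c r * f' r" and c: "\<And>r. 1 \<le> c r" "\<And>r. R \<le> r \<Longrightarrow> c r \<le> C"
    and pos: "\<And>r. 0 < f r" and dec: "\<And>r s. R \<le> r \<Longrightarrow> r \<le> s \<Longrightarrow> f s \<le> f r"
  shows "(f' \<longlongrightarrow> 0) at_top"
  unfolding tendsto_iff eventually_at_top_linorder dist_real_def
proof (intro allI impI)
  fix d :: real assume d: "0 < d"
  have C: "1 \<le> C" using c(1)[of R] c(2)[of R] by simp
  have nonpos: "k r \<le> 0" if r: "R \<le> r" for r
  proof (rule ccontr)
    assume "\<not> k r \<le> 0"
    obtain z where z: "r < z" "z < r + 1" "f (r + 1) - f r = (r + 1 - r) * f' z"
      using MVT2[of r "r + 1" f f'] f r by auto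
    have "0 < k z" using k[of r z] r z \<open>\<not> k r \<le> 0\<close> by simp
    then have "0 < f' z" using kf[of z] c(1)[of z] r z by (simp add: zero_less_mult_iff)
    then show False using z dec[of r "r + 1"] r by simp
  qed
  have "\<exists>r\<ge>R. - d < k r"
  proof (rule ccontr)
    assume "\<not> (\<exists>r\<ge>R. - d < k r)"
    then have le: "k r \<le> - d" if "R \<le> r" for r using that by (auto simp: not_less)
    have f'le: "f' r \<le> - (d / C)" if r: "R \<le> r" for r
    proof -
      have "d \<le> c r * (- f' r)" using le[OF r] kf[OF r] by simp
      moreover have "0 \<le> - f' r" using le[OF r] kf[OF r] c(1)[of r] d by (smt (verit) mult_nonneg_nonneg)
      ultimately have "d \<le> C * (- f' r)" using c(2)[OF r] by (smt (verit) mult_right_mono)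
      then show ?thesis using C by (simp add: field_simps)
    qed
    \<comment> \<open>At slope at most \<open>- (d / C)\<close>, this length takes \<open>f\<close>
      from \<open>f R\<close> to at most \<open>- (d / C)\<close>.\<close>
    define T where "T = f R * C / d + 1"
    have T: "0 < T" using pos[of R] C d by (simp add: T_def add_nonneg_pos)
    obtain z where z: "R < z" "z < R + T" "f (R + T) - f R = (R + T - R) * f' z"
      using MVT2[of R "R + T" f f'] f T by auto
    have "f (R + T) = f R + T * f' z" using z by simp
    also have "\<dots> \<le> f R + T * (- (d / C))" using f'le[of z] z T by (intro add_left_mono mult_left_mono) auto
    also have "\<dots> = - (d / C)" using C d by (simp add: T_def field_simps)
    also have "\<dots> < 0" using C d by simp
    finally show False using pos[of "R + T"] by simp
  qed
  then obtain r0 where r0: "r0 \<ge> R" "- d < k r0" by blast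
  have "\<bar>f' r - 0\<bar> < d" if r: "r0 \<le> r" for r
  proof -
    have Rr: "R \<le> r" using r r0 by simp
    have kr: "- d < k r" "k r \<le> 0" using k[OF r0(1) r] r0 nonpos[OF Rr] by auto
    have "\<bar>f' r\<bar> * 1 \<le> \<bar>f' r\<bar> * c r" using c(1)[of r] by (intro mult_left_mono) auto
    also have "\<dots> = \<bar>k r\<bar>" using kf[OF Rr] c(1)[of r] by (simp add: abs_mult)
    finally show ?thesis using kr by simp
  qed
  then show "\<exists>N. \<forall>n\<ge>N. \<bar>f' n - 0\<bar> < d" by blast
qed

section \<open>Gradient and Laplacian of a positive, radially decreasing solution\<close>

context
  fixes u :: "'a::euclidean_space \<Rightarrow> real" and \<omega> p :: real
  assumes \<omega>: "0 < \<omega>" and p: "1 < p"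
    and sol: "is_solution \<omega> p (\<lambda>x. complex_of_real (u x))"
    and s: "smooth u" and pos: "\<And>x. 0 < u x" and rad: "radial u" and dec: "radially_decreasing u"
begin

text \<open>Expanding the Laplacian of \<open>u\<^sup>2\<close> collects the second derivatives of
  \<open>u\<close> under the nonvanishing coefficient \<open>1 + 2 * (u x)\<^sup>2\<close>, so the
  equation can be solved for \<open>laplacian u\<close>.\<close>

lemma profile_equation:
  "(1 + 2 * (u x)\<^sup>2) * laplacian u x + 2 * u x * (\<Sum>b\<in>Basis. (partial b u x)\<^sup>2) = (\<omega> - u x powr (p - 1)) * u x"
  using smooth_solution_classical[OF sol s pos, of x] unfolding laplacian_power2[OF s]
  by (simp add: algebra_simps power2_eq_square)

lemma profile_tendsto_0: "(u \<longlongrightarrow> 0) at_infinity"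
proof -
  have "(\<lambda>x. complex_of_real (u x)) \<in> L2"
    using sol by (simp add: is_solution_def X_C_def H1_def)
  then show ?thesis by (rule L2_decreasing_tendsto_0[OF _ pos dec])
qed

lemma profile_powr_tendsto_0: "((\<lambda>x. u x powr (p - 1)) \<longlongrightarrow> 0) at_infinity"
  using p pos by (intro tendsto_zero_powrI[OF profile_tendsto_0 tendsto_const]) (auto simp: less_imp_le)

text \<open>Moving off the axis in an orthogonal direction increases the norm, so \<open>u\<close>
  restricted to that line is maximal on the axis: its first derivative there is 0 and its second is
  nonpositive.\<close>

lemma profile_axis:
  assumes e: "e \<in> Basis" and r: "0 \<le> r"
  shows "laplacian u (r *\<^sub>R e) \<le> partial e (partial e u) (r *\<^sub>R e)"
    and "(\<Sum>b\<in>Basis. (partial b u (r *\<^sub>R e))\<^sup>2) = (partial e u (r *\<^sub>R e))\<^sup>2"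
proof -
  have cross: "partial b u (r *\<^sub>R e) = 0 \<and> partial b (partial b u) (r *\<^sub>R e) \<le> 0" if b: "b \<in> Basis - {e}" for b
  proof -
    have bB: "b \<in> Basis" using b by simp
    have g: "((\<lambda>t. u (r *\<^sub>R e + t *\<^sub>R b)) has_real_derivative partial b u (r *\<^sub>R e + t *\<^sub>R b)) (at t)" for t
      by (rule has_real_derivative_line[OF smooth_differentiable[OF s]])
    have g': "((\<lambda>t. partial b u (r *\<^sub>R e + t *\<^sub>R b)) has_real_derivative partial b (partial b u) (r *\<^sub>R e + 0 *\<^sub>R b)) (at 0)"
      by (rule has_real_derivative_line[OF smooth_differentiable[OF smooth_partial[OF s bB]]])
    have mx: "u (r *\<^sub>R e + t *\<^sub>R b) \<le> u (r *\<^sub>R e + 0 *\<^sub>R b)" for t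
    proof -
      have "e \<bullet> b = 0" using inner_not_same_Basis[OF e bB] b by auto
      then have "(norm (r *\<^sub>R e + t *\<^sub>R b))\<^sup>2 = (norm (r *\<^sub>R e))\<^sup>2 + (norm (t *\<^sub>R b))\<^sup>2"
        by (intro norm_add_Pythagorean) (simp add: orthogonal_def)
      then have "norm (r *\<^sub>R e) \<le> norm (r *\<^sub>R e + t *\<^sub>R b)"
        using zero_le_power2[of "norm (t *\<^sub>R b)"] by (intro power2_le_imp_le[OF _ norm_ge_zero]) linarith
      then show ?thesis using dec by (simp add: radially_decreasing_def)
    qed
    from second_derivative_max_nonpos[OF g g' mx] show ?thesis by simp
  qed
  show "laplacian u (r *\<^sub>R e) \<le> partial e (partial e u) (r *\<^sub>R e)"
    unfolding laplacian_def using e cross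
    by (subst sum.remove[OF finite_Basis e]) (auto intro: sum_nonpos)
  show "(\<Sum>b\<in>Basis. (partial b u (r *\<^sub>R e))\<^sup>2) = (partial e u (r *\<^sub>R e))\<^sup>2"
    using cross by (subst sum.remove[OF finite_Basis e]) auto
qed

text \<open>The substitution \<open>v = G(u)\<close> with \<open>G' s = sqrt (1 + 2 s\<^sup>2)\<close> turns the quasilinear operator into the
  Laplacian.  Along the ray through \<open>e\<close> the derivative of \<open>v\<close> is monotone as soon as
  \<open>u\<^sup>p\<^sup>-\<^sup>1 \<le> \<omega>\<close>, because the tangential second derivatives are non-positive.\<close>

lemma profile_axis_derivative_tendsto_0:
  assumes e: "e \<in> Basis"
  shows "((\<lambda>r. partial e u (r *\<^sub>R e)) \<longlongrightarrow> 0) at_top"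
proof -
  define f where "f r = u (r *\<^sub>R e)" for r
  define f' where "f' r = partial e u (r *\<^sub>R e)" for r
  define f'' where "f'' r = partial e (partial e u) (r *\<^sub>R e)" for r
  have df: "(f has_real_derivative f' r) (at r)" for r
    using has_real_derivative_line[OF smooth_differentiable[OF s], of 0 e r] by (simp add: f_def[abs_def] f'_def)
  have df': "(f' has_real_derivative f'' r) (at r)" for r
    using has_real_derivative_line[OF smooth_differentiable[OF smooth_partial[OF s e]], of 0 e r]
    by (simp add: f'_def[abs_def] f''_def)
  have "\<forall>\<^sub>F x in at_infinity. u x powr (p - 1) < \<omega>"
    using profile_powr_tendsto_0 \<omega> by (rule order_tendstoD)
  then obtain R0 where R0: "\<And>x. R0 \<le> norm x \<Longrightarrow> u x powr (p - 1) < \<omega>" by (auto simp: eventually_at_infinity)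
  \<comment> \<open>The maximum with 0 keeps the ray parameter nonnegative, where it equals the norm
    of the point.\<close>
  define R where "R = max R0 0"
  define c where "c r = sqrt (1 + 2 * (f r)\<^sup>2)" for r
  have c1: "1 \<le> c r" for r by (simp add: c_def)
  have c2: "(c r)\<^sup>2 = 1 + 2 * (f r)\<^sup>2" for r by (simp add: c_def)
  have fpos: "0 < f r" for r by (simp add: f_def pos)
  have fdec: "f t \<le> f r" if "R \<le> r" "r \<le> t" for r t
    using that dec e by (auto simp: f_def radially_decreasing_def R_def)
  define k where "k r = c r * f' r" for r
  \<comment> \<open>As \<open>c\<close> times its derivative is \<open>2 * f r * f' r\<close>, the
    numerator is the left side of \<open>profile_equation\<close> with the Laplacian replaced by the
    second derivative along the axis.\<close>
  have dk: "(k has_real_derivative ((1 + 2 * (f r)\<^sup>2) * f'' r + 2 * f r * (f' r)\<^sup>2) / c r) (at r)" for r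
  proof -
    have p0: "0 < 1 + 2 * (f r)\<^sup>2" by (simp add: add_pos_nonneg)
    have c0: "c r > 0" using c1[of r] by linarith
    have "(c has_real_derivative 2 * f r * f' r / c r) (at r)"
      unfolding c_def[abs_def] using p0
      by (auto intro!: derivative_eq_intros df simp: field_simps)
    from DERIV_mult[OF this df'[of r]]
    have "(k has_real_derivative 2 * f r * f' r / c r * f' r + f'' r * c r) (at r)"
      by (simp add: k_def[abs_def])
    moreover have "2 * f r * f' r / c r * f' r + f'' r * c r = ((1 + 2 * (f r)\<^sup>2) * f'' r + 2 * f r * (f' r)\<^sup>2) / c r"
      unfolding c2[symmetric] using c0 by (simp add: field_simps power2_eq_square)
    ultimately show ?thesis by simp
  qed
  have kmono: "k r \<le> k t" if "R \<le> r" "r \<le> t" for r t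
  proof (rule DERIV_nonneg_imp_nondecreasing[OF that(2)])
    fix q assume q: "r \<le> q" "q \<le> t"
    have q0: "0 \<le> q" "R0 \<le> norm (q *\<^sub>R e)" using q that e by (auto simp: R_def)
    have "0 \<le> (\<omega> - f q powr (p - 1)) * f q"
      using R0[OF q0(2)] fpos[of q] by (simp add: f_def)
    also have "\<dots> = (1 + 2 * (f q)\<^sup>2) * laplacian u (q *\<^sub>R e) + 2 * f q * (f' q)\<^sup>2"
      using profile_equation[of "q *\<^sub>R e"] profile_axis(2)[OF e q0(1)] by (simp add: f_def f'_def)
    also have "\<dots> \<le> (1 + 2 * (f q)\<^sup>2) * f'' q + 2 * f q * (f' q)\<^sup>2"
      using profile_axis(1)[OF e q0(1)]
      by (intro add_right_mono mult_left_mono) (auto simp: f''_def add_nonneg_nonneg)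
    finally have "0 \<le> ((1 + 2 * (f q)\<^sup>2) * f'' q + 2 * f q * (f' q)\<^sup>2) / c q"
      using c1[of q] by simp
    then show "\<exists>y. (k has_real_derivative y) (at q) \<and> 0 \<le> y" using dk by blast
  qed
  have cC: "c r \<le> c R" if "R \<le> r" for r
    using fdec[OF order_refl that] fpos[of r] unfolding c_def by (intro real_sqrt_le_mono) (simp add: power_mono)
  have "(f' \<longlongrightarrow> 0) at_top"
    by (rule decreasing_derivative_tendsto_0[OF df kmono k_def c1 cC fpos fdec])
  then show ?thesis by (simp add: f'_def[abs_def])
qed

text \<open>The derivative along one axis dominates every partial derivative at the same nonzero
  distance from the origin.\<close>

lemma profile_partial_tendsto_0:
  assumes b: "b \<in> Basis"
  shows "(partial b u \<longlongrightarrow> 0) at_infinity"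
proof -
  define e :: 'a where "e = (SOME e. e \<in> Basis)"
  have e: "e \<in> Basis" by (simp add: e_def SOME_Basis)
  have "((\<lambda>x. partial e u (norm x *\<^sub>R e)) \<longlongrightarrow> 0) at_infinity"
    by (rule filterlim_compose[OF profile_axis_derivative_tendsto_0[OF e] filterlim_norm_at_top])
  then have lim: "((\<lambda>x. \<bar>partial e u (norm x *\<^sub>R e)\<bar>) \<longlongrightarrow> 0) at_infinity"
    by (rule tendsto_rabs_zero)
  show ?thesis
  proof (rule Lim_null_comparison[OF _ lim])
    have "\<forall>\<^sub>F x in at_infinity. (x::'a) \<noteq> 0"
      unfolding eventually_at_infinity by (rule exI[of _ 1]) auto
    then show "\<forall>\<^sub>F x in at_infinity. norm (partial b u x) \<le> \<bar>partial e u (norm x *\<^sub>R e)\<bar>"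
      by eventually_elim (simp add: radial_partial_bound[OF rad s e b])
  qed
qed

lemma profile_laplacian_tendsto_0: "(laplacian u \<longlongrightarrow> 0) at_infinity"
proof -
  have eq: "laplacian u x = ((\<omega> - u x powr (p - 1)) * u x - 2 * u x * (\<Sum>b\<in>Basis. (partial b u x)\<^sup>2)) / (1 + 2 * (u x)\<^sup>2)" for x
  proof -
    have "1 + 2 * (u x)\<^sup>2 \<noteq> 0" using zero_le_power2[of "u x"] by linarith
    then show ?thesis using profile_equation[of x] by (simp add: field_simps)
  qed
  have "((\<lambda>x. ((\<omega> - u x powr (p - 1)) * u x - 2 * u x * (\<Sum>b\<in>Basis. (partial b u x)\<^sup>2)) / (1 + 2 * (u x)\<^sup>2))
      \<longlongrightarrow> ((\<omega> - 0) * 0 - 2 * 0 * (\<Sum>b\<in>(Basis::'a set). 0\<^sup>2)) / (1 + 2 * 0\<^sup>2)) at_infinity"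
    by (intro tendsto_intros profile_tendsto_0 profile_powr_tendsto_0 profile_partial_tendsto_0) simp_all
  then show ?thesis by (simp add: eq[abs_def])
qed

lemma profile_laplacian_power2_tendsto_0: "(laplacian (\<lambda>y. (u y)\<^sup>2) \<longlongrightarrow> 0) at_infinity"
proof -
  have "((\<lambda>x. 2 * (\<Sum>b\<in>Basis. (partial b u x)\<^sup>2) + 2 * u x * laplacian u x)
      \<longlongrightarrow> 2 * (\<Sum>b\<in>(Basis::'a set). 0\<^sup>2) + 2 * 0 * 0) at_infinity"
    by (intro tendsto_intros profile_tendsto_0 profile_partial_tendsto_0 profile_laplacian_tendsto_0)
  then show ?thesis by (simp add: laplacian_power2[OF s, abs_def])
qed

end

subsection \<open>Operators in divergence form\<close>

lemma continuous_vanishing_bounded: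
  fixes g :: "'a::euclidean_space \<Rightarrow> real"
  assumes c: "continuous_on UNIV g" and lim: "(g \<longlongrightarrow> 0) at_infinity"
  shows "\<exists>M. \<forall>x. \<bar>g x\<bar> \<le> M"
proof -
  have "\<forall>\<^sub>F x in at_infinity. dist (g x) 0 < 1" using lim by (rule tendstoD) simp
  then obtain R where R: "\<And>x. R \<le> norm x \<Longrightarrow> \<bar>g x\<bar> < 1" by (auto simp: eventually_at_infinity)
  have "compact (g ` cball 0 R)"
    using c by (intro compact_continuous_image) (auto intro: continuous_on_subset)
  then obtain M where M: "\<And>x. x \<in> cball 0 R \<Longrightarrow> \<bar>g x\<bar> \<le> M"
    by (force simp: bounded_iff dest!: compact_imp_bounded)
  have "\<bar>g x\<bar> \<le> max M 1" for x
    using R[of x] M[of x] by (cases "R \<le> norm x") auto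
  then show ?thesis by blast
qed

lemma L2_cong_AE:
  assumes f: "f \<in> L2" and g: "g \<in> borel_measurable borel" and eq: "AE x in lborel. g x = f x"
  shows "g \<in> L2"
  by (rule L2_bound[OF g L2_integrable[OF f]]) (use eq in auto)

lemma norm_L2_cong_AE:
  assumes [measurable]: "f \<in> borel_measurable borel" "g \<in> borel_measurable borel"
    and eq: "AE x in lborel. f x = g x"
  shows "norm_L2 f = norm_L2 g"
  unfolding norm_L2_def by (intro arg_cong[of _ _ sqrt] integral_cong_AE) (use eq in auto)

lemma is_weak_partial_measurable:
  "is_weak_partial b f g \<Longrightarrow> g \<in> borel_measurable borel"
  by (simp add: is_weak_partial_def locally_integrable_def)

lemma is_weak_partial_cnj:
  assumes w: "is_weak_partial b f g"
  shows "is_weak_partial b (\<lambda>x. cnj (f x)) (\<lambda>x. cnj (g x))"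
  unfolding is_weak_partial_def
proof (intro conjI allI impI)
  have l: "locally_integrable (\<lambda>x. cnj (f x))" if "locally_integrable f" for f :: "'a \<Rightarrow> complex"
    unfolding locally_integrable_def
  proof (intro conjI allI impI)
    show "(\<lambda>x. cnj (f x)) \<in> borel_measurable lborel"
      using that by (auto simp: locally_integrable_def)
    fix K :: "'a set" assume "compact K"
    then have "integrable lborel (\<lambda>x. cnj (indicator K x *\<^sub>R f x))"
      using that unfolding locally_integrable_def set_integrable_def by (intro integrable_cnj) blast
    then show "set_integrable lborel K (\<lambda>x. cnj (f x))"
      by (simp add: set_integrable_def scaleR_conv_of_real)
  qed
  show "locally_integrable (\<lambda>x. cnj (f x))" "locally_integrable (\<lambda>x. cnj (g x))"
    using w by (auto intro: l simp: is_weak_partial_def)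
  fix \<psi> :: "'a \<Rightarrow> complex" assume \<psi>: "test_function \<psi>"
  then have s: "smooth \<psi>" by (simp add: test_function_def)
  have "partial b (\<lambda>x. cnj (\<psi> x)) = (\<lambda>x. cnj (partial b \<psi> x))"
    by (intro ext partial_bounded_linear[OF bounded_linear_cnj] smooth_differentiable s)
  then have "cnj (LBINT x. f x * cnj (partial b \<psi> x)) = - cnj (LBINT x. g x * cnj (\<psi> x))"
    using is_weak_partialD[OF w test_function_cnj[OF \<psi>]] by simp
  moreover have "(LBINT x. cnj (f x) * k x) = cnj (LBINT x. f x * cnj (k x))" for f k :: "'a \<Rightarrow> complex"
    by (subst Bochner_Integration.integral_cnj[symmetric]) simp
  ultimately show "(LBINT x. cnj (f x) * partial b \<psi> x) = - (LBINT x. cnj (g x) * \<psi> x)"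
    by simp
qed

text \<open>\<open>H2\<close> provides some representative of each derivative with the required
  regularity, while \<open>weak_partial\<close> may pick another. The two agree almost everywhere,
  so weak derivatives and membership in \<open>L2\<close> carry over, at both orders.\<close>

lemma H2_weak_partial:
  assumes \<eta>: "\<eta> \<in> H2" and b: "b \<in> Basis"
  shows "is_weak_partial b \<eta> (weak_partial b \<eta>)" "weak_partial b \<eta> \<in> L2"
    "is_weak_partial b (weak_partial b \<eta>) (weak_partial b (weak_partial b \<eta>))"
    "weak_partial b (weak_partial b \<eta>) \<in> L2"
proof -
  obtain g where g: "g \<in> H1" "is_weak_partial b \<eta> g" using \<eta> b by (auto simp: H2_def)
  obtain h where h: "h \<in> L2" "is_weak_partial b g h" using g b by (auto simp: H1_def)
  show w1: "is_weak_partial b \<eta> (weak_partial b \<eta>)" by (rule is_weak_partial_weak_partial[OF g(2)])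
  have "g \<in> L2" using g by (simp add: H1_def)
  then show L1: "weak_partial b \<eta> \<in> L2"
    by (rule L2_cong_AE[OF _ is_weak_partial_measurable[OF w1] weak_partial_AE[OF g(2)]])
  have w2: "is_weak_partial b (weak_partial b \<eta>) h"
    by (rule is_weak_partial_cong[OF h(2) L2_locint[OF L1] weak_partial_AE[OF g(2)] b])
  show w3: "is_weak_partial b (weak_partial b \<eta>) (weak_partial b (weak_partial b \<eta>))"
    by (rule is_weak_partial_weak_partial[OF w2])
  show "weak_partial b (weak_partial b \<eta>) \<in> L2"
    by (rule L2_cong_AE[OF h(1) is_weak_partial_measurable[OF w3] weak_partial_AE[OF w2]])
qed

lemma H2_L2: "\<eta> \<in> H2 \<Longrightarrow> \<eta> \<in> L2"
  by (simp add: H2_def)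

text \<open>This is \<open>- div (a grad \<eta>) + V \<eta>\<close> with the derivative of the flux
  already expanded by the product rule, so that it can be compared with \<open>L_plus\<close>
  pointwise.\<close>

definition divergence_op ::
    "('a::euclidean_space \<Rightarrow> real) \<Rightarrow> ('a \<Rightarrow> real) \<Rightarrow> ('a \<Rightarrow> complex) \<Rightarrow> 'a \<Rightarrow> complex" where
  "divergence_op a V \<eta> = (\<lambda>x.
     - (\<Sum>b\<in>Basis. complex_of_real (partial b a x) * weak_partial b \<eta> x
                  + complex_of_real (a x) * weak_partial b (weak_partial b \<eta>) x)
     + complex_of_real (V x) * \<eta> x)"

context
  fixes a V :: "'a::euclidean_space \<Rightarrow> real" and A :: real
  assumes sa: "smooth a" and A: "\<And>x. \<bar>a x\<bar> \<le> A" "\<And>b x. b \<in> Basis \<Longrightarrow> \<bar>partial b a x\<bar> \<le> A"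
    and V: "continuous_on UNIV V" "\<And>x. \<bar>V x\<bar> \<le> A"
begin

lemma bounded_real_mult_L2:
  assumes "continuous_on UNIV c" "\<And>x. \<bar>c x\<bar> \<le> A" "f \<in> L2"
  shows "(\<lambda>x. complex_of_real (c x) * f x) \<in> L2"
  using borel_measurable_continuous_onI[OF assms(1)] assms(2,3)
  by (intro L2_bounded_mult[where M=A]) auto

lemma flux_weak_partial:
  assumes \<eta>: "\<eta> \<in> H2" and b: "b \<in> Basis"
  shows "is_weak_partial b (\<lambda>x. complex_of_real (a x) * weak_partial b \<eta> x)
      (\<lambda>x. complex_of_real (partial b a x) * weak_partial b \<eta> x
        + complex_of_real (a x) * weak_partial b (weak_partial b \<eta>) x)"
    and "(\<lambda>x. complex_of_real (a x) * weak_partial b \<eta> x) \<in> L2"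
    and "(\<lambda>x. complex_of_real (partial b a x) * weak_partial b \<eta> x
        + complex_of_real (a x) * weak_partial b (weak_partial b \<eta>) x) \<in> L2"
  using weak_partial_mult[OF smooth_of_real[OF sa] H2_weak_partial(3)[OF \<eta> b] b]
    partial_of_real_smooth[OF sa, of b]
  by (auto intro!: L2_add bounded_real_mult_L2 H2_weak_partial[OF \<eta> b] A b smooth_continuous sa smooth_partial)

text \<open>Membership in \<open>L2\<close> is not a formality: the Bochner integral, and hence \<open>norm_L2\<close>, is 0 on functions
  that are not square integrable, which would make the singular-sequence condition vacuous.\<close>

lemma divergence_op_L2:
  assumes \<eta>: "\<eta> \<in> H2"
  shows "divergence_op a V \<eta> \<in> L2"
proof -
  have 1: "(\<lambda>x. \<Sum>b\<in>Basis. complex_of_real (partial b a x) * weak_partial b \<eta> x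
        + complex_of_real (a x) * weak_partial b (weak_partial b \<eta>) x) \<in> L2"
    by (intro L2_sum flux_weak_partial(3)[OF \<eta>]) auto
  have 2: "(\<lambda>x. complex_of_real (V x) * \<eta> x) \<in> L2"
    by (rule bounded_real_mult_L2[OF V H2_L2[OF \<eta>]])
  show ?thesis unfolding divergence_op_def using L2_diff[OF 2 1] by simp
qed

text \<open>Each flux component is integrated by parts against the conjugate of
  \<open>\<eta>\<close>, leaving \<open>a\<close> times a squared modulus. That the value is real is
  what later puts the spectrum on the real line.\<close>

lemma divergence_op_form:
  assumes \<eta>: "\<eta> \<in> H2"
  shows "(LBINT x. divergence_op a V \<eta> x * cnj (\<eta> x))
    = complex_of_real ((\<Sum>b\<in>Basis. LBINT x. a x * (cmod (weak_partial b \<eta> x))\<^sup>2) + (LBINT x. V x * (cmod (\<eta> x))\<^sup>2))"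
proof -
  define F where "F b x = complex_of_real (partial b a x) * weak_partial b \<eta> x
        + complex_of_real (a x) * weak_partial b (weak_partial b \<eta>) x" for b x
  note c\<eta> = L2_cnj[OF H2_L2[OF \<eta>]]
  have iF: "integrable lborel (\<lambda>x. F b x * cnj (\<eta> x))" if "b \<in> Basis" for b
    unfolding F_def by (rule L2_mult_integrable[OF flux_weak_partial(3)[OF \<eta> that] c\<eta>])
  have iV: "integrable lborel (\<lambda>x. complex_of_real (V x) * \<eta> x * cnj (\<eta> x))"
    by (rule L2_mult_integrable[OF bounded_real_mult_L2[OF V H2_L2[OF \<eta>]] c\<eta>])
  have parts: "(LBINT x. F b x * cnj (\<eta> x)) = - complex_of_real (LBINT x. a x * (cmod (weak_partial b \<eta> x))\<^sup>2)"
    if b: "b \<in> Basis" for b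
  proof -
    have "(LBINT x. F b x * cnj (\<eta> x))
        = - (LBINT x. cnj (weak_partial b \<eta> x) * (complex_of_real (a x) * weak_partial b \<eta> x))"
      unfolding F_def
      by (rule weak_integration_by_parts[OF flux_weak_partial(1)[OF \<eta> b] is_weak_partial_cnj[OF H2_weak_partial(1)[OF \<eta> b]] b
          flux_weak_partial(2,3)[OF \<eta> b] c\<eta> L2_cnj[OF H2_weak_partial(2)[OF \<eta> b]]])
    also have "(LBINT x. cnj (weak_partial b \<eta> x) * (complex_of_real (a x) * weak_partial b \<eta> x))
        = (LBINT x. complex_of_real (a x * (cmod (weak_partial b \<eta> x))\<^sup>2))"
      by (intro Bochner_Integration.integral_cong) (auto simp: complex_norm_square mult_ac simp del: of_real_power)
    finally show ?thesis by (simp only: integral_complex_of_real)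
  qed
  have "(LBINT x. divergence_op a V \<eta> x * cnj (\<eta> x))
      = (LBINT x. - (\<Sum>b\<in>Basis. F b x * cnj (\<eta> x)) + complex_of_real (V x) * \<eta> x * cnj (\<eta> x))"
    by (intro Bochner_Integration.integral_cong)
       (simp_all add: divergence_op_def F_def distrib_right left_diff_distrib sum_distrib_right)
  also have "\<dots> = - (\<Sum>b\<in>Basis. LBINT x. F b x * cnj (\<eta> x)) + (LBINT x. complex_of_real (V x) * \<eta> x * cnj (\<eta> x))"
    using iF iV by simp
  also have "(LBINT x. complex_of_real (V x) * \<eta> x * cnj (\<eta> x)) = (LBINT x. complex_of_real (V x * (cmod (\<eta> x))\<^sup>2))"
    by (intro Bochner_Integration.integral_cong) (auto simp: complex_norm_square mult_ac simp del: of_real_power)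
  finally show ?thesis using parts by (simp add: sum_negf integral_complex_of_real del: of_real_mult of_real_power)
qed

end

section \<open>Singular sequences for operators in divergence form\<close>

lemma real_mult_norm_integrable:
  assumes c: "continuous_on UNIV c" "\<And>x. \<bar>c x\<bar> \<le> A" and f: "f \<in> L2"
  shows "integrable lborel (\<lambda>x. c x * (cmod (f x))\<^sup>2)"
proof -
  note [measurable] = borel_measurable_continuous_onI[OF c(1)] L2_measurable[OF f]
  have i: "integrable lborel (\<lambda>x. A * (cmod (f x))\<^sup>2)" using L2_integrable[OF f] by simp
  have A: "0 \<le> A" using c(2) abs_ge_zero order_trans by blast
  show ?thesis
    by (rule Bochner_Integration.integrable_bound[OF i])
       (auto simp: abs_mult A intro!: mult_right_mono c(2))
qed

lemma cont_spectrum_divergence_op: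
  fixes a W :: "'a::euclidean_space \<Rightarrow> real"
  assumes sa: "smooth a" and A: "\<And>x. \<bar>a x\<bar> \<le> A" "\<And>b x. b \<in> Basis \<Longrightarrow> \<bar>partial b a x\<bar> \<le> A"
    and a1: "\<And>x. 1 \<le> a x"
    and W: "continuous_on UNIV W" and W0: "(W \<longlongrightarrow> 0) at_infinity"
  shows "cont_spectrum H2 (divergence_op a (\<lambda>x. \<omega> - W x)) \<subseteq> complex_of_real ` {\<omega>..}"
proof
  fix z assume "z \<in> cont_spectrum H2 (divergence_op a (\<lambda>x. \<omega> - W x))"
  then obtain \<phi> where \<phi>: "\<And>n. \<phi> n \<in> H2" and n1: "\<And>n. norm_L2 (\<phi> n) = 1" and wk: "weakly_null_L2 \<phi>"
    and lim: "(\<lambda>n. norm_L2 (\<lambda>x. divergence_op a (\<lambda>x. \<omega> - W x) (\<phi> n) x - z * \<phi> n x)) \<longlonglongrightarrow> 0"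
    unfolding cont_spectrum_def by blast
  obtain M where M: "\<And>x. \<bar>W x\<bar> \<le> M" using continuous_vanishing_bounded[OF W W0] by blast
  define V where "V x = \<omega> - W x" for x
  define B where "B = max A (\<bar>\<omega>\<bar> + M)"
  have cV: "continuous_on UNIV V" unfolding V_def by (intro continuous_intros W)
  have BV: "\<bar>V x\<bar> \<le> B" for x using M[of x] by (auto simp: V_def B_def le_max_iff_disj)
  have BA: "\<bar>a x\<bar> \<le> B" "b \<in> Basis \<Longrightarrow> \<bar>partial b a x\<bar> \<le> B" for b x
    using A by (auto simp: B_def le_max_iff_disj)
  note L = H2_L2[OF \<phi>]
  define T where "T n = divergence_op a V (\<phi> n)" for n
  have T: "T n \<in> L2" for n
    unfolding T_def by (rule divergence_op_L2[OF sa BA cV BV \<phi>])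
  define grad where "grad n = (\<Sum>b\<in>Basis. LBINT x. a x * (cmod (weak_partial b (\<phi> n) x))\<^sup>2)" for n
  define pot where "pot n = (LBINT x. W x * (cmod (\<phi> n x))\<^sup>2)" for n
  have mass: "(LBINT x. (cmod (\<phi> n x))\<^sup>2) = 1" for n
    using norm_L2_sq[of "\<phi> n"] n1 by simp
  have iW: "integrable lborel (\<lambda>x. W x * (cmod (\<phi> n x))\<^sup>2)" for n
    by (rule real_mult_norm_integrable[OF W M L])
  have form: "(LBINT x. T n x * cnj (\<phi> n x)) = complex_of_real (grad n + \<omega> - pot n)" for n
  proof -
    have "(LBINT x. V x * (cmod (\<phi> n x))\<^sup>2) = \<omega> - pot n"
      using iW[of n] L2_integrable[OF L[of n]] by (simp add: V_def pot_def mass left_diff_distrib)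
    then show ?thesis
      unfolding T_def by (subst divergence_op_form[OF sa BA cV BV \<phi>]) (auto simp: grad_def)
  qed
  \<comment> \<open>The difference is the residual paired with \<open>\<phi> n\<close>; as
    \<open>\<phi> n\<close> has norm 1, it is at most the norm of the residual.\<close>
  have "(\<lambda>n. complex_of_real (grad n + \<omega> - pot n) - z) \<longlonglongrightarrow> 0"
  proof (rule Lim_null_comparison[OF _ lim], intro always_eventually allI)
    fix n
    have c: "(\<lambda>x. cnj (\<phi> n x)) \<in> L2" by (rule L2_cnj[OF L])
    have zL: "(\<lambda>x. z * \<phi> n x) \<in> L2" by (rule L2_cmult[OF L])
    have "(LBINT x. z * \<phi> n x * cnj (\<phi> n x)) = z * complex_of_real (LBINT x. (cmod (\<phi> n x))\<^sup>2)"
      by (simp only: complex_norm_square mult.assoc integral_mult_right_zero flip: integral_complex_of_real)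
    then have "complex_of_real (grad n + \<omega> - pot n) - z = (LBINT x. (T n x - z * \<phi> n x) * cnj (\<phi> n x))"
      using L2_mult_integrable[OF T[of n] c] L2_mult_integrable[OF zL c]
      by (simp add: mass left_diff_distrib form)
    also have "cmod \<dots> \<le> norm_L2 (\<lambda>x. T n x - z * \<phi> n x) * norm_L2 (\<lambda>x. cnj (\<phi> n x))"
      by (rule L2_inner_bound[OF L2_diff[OF T zL] c])
    finally show "cmod (complex_of_real (grad n + \<omega> - pot n) - z)
        \<le> norm_L2 (\<lambda>x. divergence_op a (\<lambda>x. \<omega> - W x) (\<phi> n) x - z * \<phi> n x)"
      by (simp add: norm_L2_cnj n1 T_def V_def[abs_def])
  qed
  then have q: "(\<lambda>n. complex_of_real (grad n + \<omega> - pot n)) \<longlonglongrightarrow> z" by (rule LIM_zero_cancel)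
  \<comment> \<open>The form takes real values, so the imaginary part of its limit is 0.\<close>
  have "(\<lambda>n. 0::real) \<longlonglongrightarrow> Im z" using tendsto_Im[OF q] by simp
  then have zr: "z = complex_of_real (Re z)" by (simp add: LIMSEQ_const_iff complex_eq_iff)
  have rq: "(\<lambda>n. grad n + \<omega> - pot n) \<longlonglongrightarrow> Re z" using tendsto_Re[OF q] by simp
  have grad0: "0 \<le> grad n" for n
    unfolding grad_def using a1 by (intro sum_nonneg integral_nonneg_AE AE_I2 mult_nonneg_nonneg) (auto intro: order_trans[OF zero_le_one])
  have potM: "pot n \<le> M" for n
  proof -
    have "pot n \<le> (LBINT x. M * (cmod (\<phi> n x))\<^sup>2)"
      unfolding pot_def using iW L2_integrable[OF L] M
      by (intro integral_mono) (auto intro!: mult_right_mono simp: abs_le_iff)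
    then show ?thesis by (simp add: mass)
  qed
  \<comment> \<open>Convergence bounds the form and \<open>potM\<close> bounds the potential part,
    so the gradient part is bounded; \<open>a1\<close> turns this into one bound \<open>G\<close>
    for all weak derivatives.\<close>
  obtain K where K: "\<And>n. \<bar>grad n + \<omega> - pot n\<bar> \<le> K"
    using convergent_imp_Bseq[OF convergentI[OF rq]] by (auto simp: Bseq_def)
  have gradK: "grad n \<le> K + \<bar>\<omega>\<bar> + M" for n
    using K[of n] potM[of n] by linarith
  define G where "G = sqrt (K + \<bar>\<omega>\<bar> + M)"
  have w: "\<exists>g\<in>L2. is_weak_partial b (\<phi> n) g \<and> norm_L2 g \<le> G" if b: "b \<in> Basis" for n b
  proof (intro bexI conjI)
    show "weak_partial b (\<phi> n) \<in> L2" "is_weak_partial b (\<phi> n) (weak_partial b (\<phi> n))"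
      by (rule H2_weak_partial[OF \<phi> b])+
    note ga = real_mult_norm_integrable[OF smooth_continuous[OF sa] A(1) H2_weak_partial(2)[OF \<phi>]]
    have "(LBINT x. (cmod (weak_partial b (\<phi> n) x))\<^sup>2) \<le> (LBINT x. a x * (cmod (weak_partial b (\<phi> n) x))\<^sup>2)"
      using mult_right_mono[OF a1]
      by (intro integral_mono ga b L2_integrable H2_weak_partial[OF \<phi> b]) simp
    also have "\<dots> \<le> grad n"
      unfolding grad_def using a1 b
      by (intro member_le_sum integral_nonneg_AE AE_I2 mult_nonneg_nonneg) (auto intro: order_trans[OF zero_le_one])
    also have "\<dots> \<le> K + \<bar>\<omega>\<bar> + M" by (rule gradK)
    finally show "norm_L2 (weak_partial b (\<phi> n)) \<le> G" by (simp add: norm_L2_def G_def)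
  qed
  \<comment> \<open>Outside a large ball \<open>W\<close> is below \<open>e\<close>; inside it costs
    at most \<open>M\<close> times the local mass, which tends to 0.\<close>
  have "\<omega> \<le> Re z + e" if e: "0 < e" for e
  proof -
    have "\<forall>\<^sub>F x in at_infinity. dist (W x) 0 < e" using W0 e by (rule tendstoD)
    then obtain R where R: "\<And>x. R \<le> norm x \<Longrightarrow> \<bar>W x\<bar> < e" by (auto simp: eventually_at_infinity)
    define loc where "loc n = (LBINT x. indicator (cball 0 R) x * (cmod (\<phi> n x))\<^sup>2)" for n
    have loc0: "loc \<longlonglongrightarrow> 0"
      unfolding loc_def by (rule weakly_null_local_L2[OF L eq_refl[OF n1] wk w]) auto
    have "pot n \<le> M * loc n + e" for n
    proof -
      have [measurable]: "\<phi> n \<in> borel_measurable borel" by (rule L2_measurable[OF L])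
      have i: "integrable lborel (\<lambda>x. indicator (cball 0 R) x * (cmod (\<phi> n x))\<^sup>2)"
        by (rule Bochner_Integration.integrable_bound[OF L2_integrable[OF L[of n]]]) (auto simp: indicator_def)
      have pt: "W x * (cmod (\<phi> n x))\<^sup>2
          \<le> M * (indicator (cball 0 R) x * (cmod (\<phi> n x))\<^sup>2) + e * (cmod (\<phi> n x))\<^sup>2" for x
      proof (cases "norm x \<le> R")
        case True
        have "W x \<le> M" using M[of x] by simp
        then have "W x * (cmod (\<phi> n x))\<^sup>2 \<le> M * (cmod (\<phi> n x))\<^sup>2" by (rule mult_right_mono) simp
        moreover have "0 \<le> e * (cmod (\<phi> n x))\<^sup>2" using e by simp
        ultimately show ?thesis using True by simp
      next
        case False
        then have "W x \<le> e" using R[of x] by simp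
        then have "W x * (cmod (\<phi> n x))\<^sup>2 \<le> e * (cmod (\<phi> n x))\<^sup>2" by (rule mult_right_mono) simp
        then show ?thesis using False by simp
      qed
      have "pot n \<le> (LBINT x. M * (indicator (cball 0 R) x * (cmod (\<phi> n x))\<^sup>2) + e * (cmod (\<phi> n x))\<^sup>2)"
        unfolding pot_def by (rule integral_mono[OF iW _ pt]) (use i L2_integrable[OF L[of n]] in simp)
      also have "\<dots> = M * loc n + e"
        using i L2_integrable[OF L[of n]] by (simp add: loc_def mass)
      finally show ?thesis .
    qed
    then have le: "\<omega> - (M * loc n + e) \<le> grad n + \<omega> - pot n" for n
      using grad0[of n] by (smt (verit))
    have "(\<lambda>n. \<omega> - (M * loc n + e)) \<longlonglongrightarrow> \<omega> - (M * 0 + e)" by (intro tendsto_intros loc0)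
    then have "\<omega> - (M * 0 + e) \<le> Re z" by (rule LIMSEQ_le[OF _ rq]) (use le in blast)
    then show ?thesis by simp
  qed
  then have "\<omega> \<le> Re z" by (rule field_le_epsilon)
  then show "z \<in> complex_of_real ` {\<omega>..}" using zr by (intro image_eqI[of _ _ "Re z"]) auto
qed

section \<open>Identification of \<open>L_plus\<close> with an operator in divergence form\<close>

lemma cont_spectrum_cong_AE:
  assumes m: "\<And>\<eta>. \<eta> \<in> D \<Longrightarrow> \<eta> \<in> borel_measurable borel"
    "\<And>\<eta>. \<eta> \<in> D \<Longrightarrow> T \<eta> \<in> borel_measurable borel" "\<And>\<eta>. \<eta> \<in> D \<Longrightarrow> T' \<eta> \<in> borel_measurable borel"
    and eq: "\<And>\<eta>. \<eta> \<in> D \<Longrightarrow> AE x in lborel. T \<eta> x = T' \<eta> x"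
  shows "cont_spectrum D T \<subseteq> cont_spectrum D T'"
proof -
  have "norm_L2 (\<lambda>x. T \<eta> x - z * \<eta> x) = norm_L2 (\<lambda>x. T' \<eta> x - z * \<eta> x)" if \<eta>: "\<eta> \<in> D" for \<eta> z
  proof (rule norm_L2_cong_AE)
    note [measurable] = m[OF \<eta>]
    show "(\<lambda>x. T \<eta> x - z * \<eta> x) \<in> borel_measurable borel" "(\<lambda>x. T' \<eta> x - z * \<eta> x) \<in> borel_measurable borel"
      by measurable
    show "AE x in lborel. T \<eta> x - z * \<eta> x = T' \<eta> x - z * \<eta> x" using eq[OF \<eta>] by eventually_elim simp
  qed
  then show ?thesis unfolding cont_spectrum_def by fastforce
qed

text \<open>The product rule is applied twice; in between, its explicit first derivative has to be
  exchanged for the representative that the outer \<open>weak_partial\<close> actually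
  differentiates.\<close>

lemma weak_partial_twice_mult:
  assumes s: "smooth f" and \<eta>: "\<eta> \<in> H2" and b: "b \<in> Basis"
  shows "AE x in lborel. weak_partial b (weak_partial b (\<lambda>y. f y * \<eta> y)) x
      = partial b (partial b f) x * \<eta> x + 2 * (partial b f x * weak_partial b \<eta> x)
        + f x * weak_partial b (weak_partial b \<eta>) x"
    and "weak_partial b (weak_partial b (\<lambda>y. f y * \<eta> y)) \<in> borel_measurable borel"
proof -
  note w = H2_weak_partial[OF \<eta> b]
  note w1 = weak_partial_mult[OF s w(1) b]
  have l: "locally_integrable (weak_partial b (\<lambda>y. f y * \<eta> y))"
    using is_weak_partial_weak_partial[OF w1] by (simp add: is_weak_partial_def)
  have "is_weak_partial b (\<lambda>x. partial b f x * \<eta> x + f x * weak_partial b \<eta> x)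
    (\<lambda>x. (partial b (partial b f) x * \<eta> x + partial b f x * weak_partial b \<eta> x)
      + (partial b f x * weak_partial b \<eta> x + f x * weak_partial b (weak_partial b \<eta>) x))"
    by (rule is_weak_partial_add[OF weak_partial_mult[OF smooth_partial[OF s b] w(1) b] weak_partial_mult[OF s w(3) b] b])
  note w2 = is_weak_partial_cong[OF this l weak_partial_AE[OF w1] b]
  show "AE x in lborel. weak_partial b (weak_partial b (\<lambda>y. f y * \<eta> y)) x
      = partial b (partial b f) x * \<eta> x + 2 * (partial b f x * weak_partial b \<eta> x)
        + f x * weak_partial b (weak_partial b \<eta>) x"
    using weak_partial_AE[OF w2] by eventually_elim simp
  show "weak_partial b (weak_partial b (\<lambda>y. f y * \<eta> y)) \<in> borel_measurable borel"
    by (rule is_weak_partial_measurable[OF is_weak_partial_weak_partial[OF w2]])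
qed

lemma smooth_laplacian_continuous: "smooth f \<Longrightarrow> continuous_on UNIV (laplacian f)"
  unfolding laplacian_def by (intro continuous_intros smooth_continuous smooth_partial)

lemma partial_one_plus_power2:
  fixes u :: "'a::euclidean_space \<Rightarrow> real"
  assumes s: "smooth u"
  shows "partial b (\<lambda>x. 1 + 2 * (u x)\<^sup>2) x = 4 * u x * partial b u x"
proof (rule partial_eq)
  show "((\<lambda>x. 1 + 2 * (u x)\<^sup>2) has_derivative (\<lambda>h. 4 * u x * partial h u x)) (at x)"
    by (auto intro!: derivative_eq_intros partial_has_derivative smooth_differentiable s)
qed

text \<open>In \<open>2 u Lap (u \<eta>)\<close> the second-order part adds \<open>2 u^2\<close> to
  the coefficient 1 of the Laplacian, the first-order part \<open>4 u grad u . grad \<eta>\<close>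
  is the gradient of the new coefficient paired with \<open>grad \<eta>\<close>, and
  \<open>2 u Lap u\<close> is left for the potential \<open>W\<close>.\<close>

lemma L_plus_eq_divergence_op:
  fixes u :: "'a::euclidean_space \<Rightarrow> real" and p :: real
  assumes s: "smooth u" and \<eta>: "\<eta> \<in> H2"
  defines "W \<equiv> \<lambda>x. 2 * u x * laplacian u x + laplacian (\<lambda>y. (u y)\<^sup>2) x + p * u x powr (p - 1)"
  shows "AE x in lborel. L_plus \<omega> p u \<eta> x = divergence_op (\<lambda>x. 1 + 2 * (u x)\<^sup>2) (\<lambda>x. \<omega> - W x) \<eta> x"
    and "L_plus \<omega> p u \<eta> \<in> borel_measurable borel"
proof -
  have sU: "smooth (\<lambda>x. complex_of_real (u x))" by (rule smooth_of_real[OF s])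
  note pa = partial_one_plus_power2[OF s]
  have "AE x in lborel. \<forall>b\<in>Basis. weak_partial b (weak_partial b (\<lambda>y. complex_of_real (u y) * \<eta> y)) x
      = complex_of_real (partial b (partial b u) x) * \<eta> x + 2 * (complex_of_real (partial b u x) * weak_partial b \<eta> x)
        + complex_of_real (u x) * weak_partial b (weak_partial b \<eta>) x"
    using weak_partial_twice_mult(1)[OF sU \<eta>]
    by (intro AE_finite_allI finite_Basis) (simp add: partial_of_real_smooth s smooth_partial)
  then show "AE x in lborel. L_plus \<omega> p u \<eta> x = divergence_op (\<lambda>x. 1 + 2 * (u x)\<^sup>2) (\<lambda>x. \<omega> - W x) \<eta> x"
  proof eventually_elim
    case (elim x)
    define S0 where "S0 = (\<Sum>b\<in>Basis. weak_partial b (weak_partial b \<eta>) x)"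
    define S1 where "S1 = (\<Sum>b\<in>Basis. complex_of_real (partial b u x) * weak_partial b \<eta> x)"
    have "weak_laplacian (\<lambda>y. complex_of_real (u y) * \<eta> y) x
        = complex_of_real (laplacian u x) * \<eta> x + 2 * S1 + complex_of_real (u x) * S0"
      using elim by (simp add: weak_laplacian_def laplacian_def sum.distrib sum_distrib_left sum_distrib_right S0_def S1_def)
    moreover have "(\<Sum>b\<in>Basis. complex_of_real (partial b (\<lambda>x. 1 + 2 * (u x)\<^sup>2) x) * weak_partial b \<eta> x
          + complex_of_real (1 + 2 * (u x)\<^sup>2) * weak_partial b (weak_partial b \<eta>) x)
        = 4 * complex_of_real (u x) * S1 + (1 + 2 * (complex_of_real (u x))\<^sup>2) * S0"
      by (simp add: pa sum.distrib sum_distrib_left sum_distrib_right S0_def S1_def mult_ac)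
    ultimately show ?case
      by (simp add: L_plus_def divergence_op_def W_def weak_laplacian_def[of \<eta>] S0_def[symmetric]
          algebra_simps power2_eq_square)
  qed
  have [measurable]: "u \<in> borel_measurable borel" "laplacian (\<lambda>y. (u y)\<^sup>2) \<in> borel_measurable borel"
    by (intro borel_measurable_continuous_onI smooth_continuous smooth_laplacian_continuous smooth_power2 s)+
  have [measurable]: "\<eta> \<in> borel_measurable borel" by (rule L2_measurable[OF H2_L2[OF \<eta>]])
  have [measurable]: "weak_laplacian \<eta> \<in> borel_measurable borel"
    unfolding weak_laplacian_def
    by (intro borel_measurable_sum L2_measurable H2_weak_partial(4)[OF \<eta>])
  have [measurable]: "weak_laplacian (\<lambda>y. complex_of_real (u y) * \<eta> y) \<in> borel_measurable borel"
    unfolding weak_laplacian_def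
    by (intro borel_measurable_sum weak_partial_twice_mult(2)[OF sU \<eta>])
  show "L_plus \<omega> p u \<eta> \<in> borel_measurable borel" unfolding L_plus_def by measurable
qed

theorem lemma2p4:
  fixes u :: "'a::euclidean_space \<Rightarrow> real" and \<omega> p :: real
  assumes "DIM('a) \<ge> 2" and "\<omega> > 0" and "1 < p" and "ereal p < p_max DIM('a)"
    and "ground_state \<omega> p (\<lambda>x. complex_of_real (u x))"
    and "smooth u"
    and "\<And>x. u x > 0" and "radial u" and "radially_decreasing u"
  shows "cont_spectrum H2 (L_plus \<omega> p u) \<subseteq> complex_of_real ` {\<omega>..}"
proof -
  have sol: "is_solution \<omega> p (\<lambda>x. complex_of_real (u x))"
    using assms(5) by (simp add: ground_state_def nontrivial_solutions_def)
  note s = assms(6)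
  note ctx = assms(2,3) sol s assms(7-9)
  note u0 = profile_tendsto_0[OF ctx]
  define a where "a x = 1 + 2 * (u x)\<^sup>2" for x
  define W where "W x = 2 * u x * laplacian u x + laplacian (\<lambda>y. (u y)\<^sup>2) x + p * u x powr (p - 1)" for x
  have sa: "smooth a"
    unfolding a_def[abs_def] by (intro smooth_add smooth_mult smooth_const smooth_power2 s)
  have cont: "continuous_on UNIV (\<lambda>x. u x powr (p - 1))"
    by (intro continuous_intros smooth_continuous s) (use assms(7) in \<open>force simp: less_le\<close>)
  have W: "continuous_on UNIV W"
    unfolding W_def by (intro continuous_intros cont smooth_laplacian_continuous smooth_continuous smooth_power2 s)
  have "(W \<longlongrightarrow> 2 * 0 * 0 + 0 + p * 0) at_infinity"
    unfolding W_def
    by (intro tendsto_intros u0 profile_laplacian_tendsto_0[OF ctx] profile_laplacian_power2_tendsto_0[OF ctx]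
        profile_powr_tendsto_0[OF ctx])
  then have W0: "(W \<longlongrightarrow> 0) at_infinity" by simp
  have pa: "partial b a x = 4 * u x * partial b u x" for b x
    unfolding a_def[abs_def] by (rule partial_one_plus_power2[OF s])
  have "((\<lambda>x. 2 * (u x)\<^sup>2) \<longlongrightarrow> 2 * 0\<^sup>2) at_infinity"
    by (intro tendsto_intros u0)
  then have lim_a: "((\<lambda>x. a x - 1) \<longlongrightarrow> 0) at_infinity" by (simp add: a_def)
  \<comment> \<open>The coefficient tends to 1 at infinity, so boundedness is read off from
    \<open>a - 1\<close>.\<close>
  have "continuous_on UNIV (\<lambda>x. a x - 1)" by (intro continuous_intros smooth_continuous sa)
  from continuous_vanishing_bounded[OF this lim_a] obtain A0 where A0: "\<And>x. \<bar>a x - 1\<bar> \<le> A0" by blast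
  have "\<exists>M. \<forall>x. \<bar>partial b a x\<bar> \<le> M" if b: "b \<in> Basis" for b
  proof (rule continuous_vanishing_bounded)
    show "continuous_on UNIV (partial b a)" by (rule smooth_continuous[OF smooth_partial[OF sa b]])
    have "((\<lambda>x. 4 * u x * partial b u x) \<longlongrightarrow> 4 * 0 * 0) at_infinity"
      by (intro tendsto_intros u0 profile_partial_tendsto_0[OF ctx b])
    then show "(partial b a \<longlongrightarrow> 0) at_infinity" by (simp add: pa[abs_def])
  qed
  then obtain Ab where Ab: "\<And>b x. b \<in> Basis \<Longrightarrow> \<bar>partial b a x\<bar> \<le> Ab b" by metis
  \<comment> \<open>One constant for \<open>a\<close> and for its finitely many partial
    derivatives.\<close>
  define A where "A = max (A0 + 1) (Max (Ab ` Basis))"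
  have A: "\<bar>a x\<bar> \<le> A" "b \<in> Basis \<Longrightarrow> \<bar>partial b a x\<bar> \<le> A" for b x
  proof -
    show "\<bar>a x\<bar> \<le> A" using A0[of x] by (auto simp: A_def le_max_iff_disj)
    assume b: "b \<in> Basis"
    have "Ab b \<le> Max (Ab ` Basis)" using b by (intro Max_ge) auto
    then show "\<bar>partial b a x\<bar> \<le> A" using Ab[OF b, of x] by (auto simp: A_def le_max_iff_disj)
  qed
  have a1: "1 \<le> a x" for x by (simp add: a_def)
  obtain B where B: "\<And>x. \<bar>W x\<bar> \<le> B" using continuous_vanishing_bounded[OF W W0] by blast
  have "cont_spectrum H2 (L_plus \<omega> p u) \<subseteq> cont_spectrum H2 (divergence_op a (\<lambda>x. \<omega> - W x))"
  \<comment> \<open>The two operators differ on a null set that depends on \<open>\<eta>\<close>;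
    \<open>norm_L2\<close> does not see it, provided all functions involved are measurable.\<close>
  proof (rule cont_spectrum_cong_AE)
    fix \<eta> :: "'a \<Rightarrow> complex" assume \<eta>: "\<eta> \<in> H2"
    show "\<eta> \<in> borel_measurable borel" by (rule L2_measurable[OF H2_L2[OF \<eta>]])
    show "L_plus \<omega> p u \<eta> \<in> borel_measurable borel" by (rule L_plus_eq_divergence_op(2)[OF s \<eta>])
    show "AE x in lborel. L_plus \<omega> p u \<eta> x = divergence_op a (\<lambda>x. \<omega> - W x) \<eta> x"
      using L_plus_eq_divergence_op(1)[OF s \<eta>] by (simp add: a_def[abs_def] W_def[abs_def])
    define C where "C = max A (\<bar>\<omega>\<bar> + B)"
    have "divergence_op a (\<lambda>x. \<omega> - W x) \<eta> \<in> L2"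
    proof (rule divergence_op_L2[OF sa, where A=C])
      show "continuous_on UNIV (\<lambda>x. \<omega> - W x)" by (intro continuous_intros W)
      show "\<bar>\<omega> - W x\<bar> \<le> C" for x using B[of x] by (auto simp: C_def le_max_iff_disj)
    qed (use A \<eta> in \<open>auto simp: C_def le_max_iff_disj\<close>)
    then show "divergence_op a (\<lambda>x. \<omega> - W x) \<eta> \<in> borel_measurable borel" by (rule L2_measurable)
  qed
  also have "\<dots> \<subseteq> complex_of_real ` {\<omega>..}"
    by (rule cont_spectrum_divergence_op[OF sa A a1 W W0])
  finally show ?thesis .
qed

end
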